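(* Let $E: y^2=x^3+c$ be any Mordell curve defined over a cubic field. Then $\Phi^{M}(3) = \{\mathbb{Z}/9\mathbb{Z},\mathbb{Z}/6\mathbb{Z},\mathbb{Z}/3\mathbb{Z},\mathbb{Z}/2\mathbb{Z},\{\mathcal{O}\}\}$. Moreover, if $K/\mathbb{Q}$ is a cubic field, $c\in K$ is nonzero, and $T$ is the torsion subgroup of $E(K)$, then $T$ is isomorphic to one of the following groups: (1) $\mathbb{Z}/9\mathbb{Z}$, if $c$ is a square and $4c$ is a cube in $K$, with $K=\mathbb{Q}(r)$ where $r$ satisfies $r^3-3r^2+1=0$; (2) $\mathbb{Z}/6\mathbb{Z}$, if $c$ is both a square and a cube in $K$, or if $c$ and $4$ are cubes and $-3c$ is a square in $K$; (3) $\mathbb{Z}/3\mathbb{Z}$, if $c$ is a square and $4c$ is a cube in $K$, with $K\neq\mathbb{Q}(r)$ where $r$ satisfies $r^3-3r^2+1=0$; or if $c$ is a square but $4c$ is not a cube in $K$; or if $4c$ is a cube and $-3c$ is a square in $K$; (4) $\mathbb{Z}/2\mathbb{Z}$, if $c$ is a cube but not a square in $K$ and $-3c$ is not a square in $K$, or if $c$ is a cube but not a square in $K$ and $4$ is not a cube in $K$; (5) $\{\mathcal{O}\}$, otherwise.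
   Context: A Mordell curve over a number field $K$ is an elliptic curve $y^2=x^3+c$ with $c\in K$, $c\neq 0$. $\mathcal{O}$ is the identity of the group $E(K)$. $\Phi^{M}(d)$ is the set of isomorphism classes of groups $E(K)_{tors}$, where $K$ runs over all number fields of degree $d$ and $E$ runs over all Mordell curves over $K$. "Square (cube) in $K$" means square (cube) of an element of $K$.
   Formalization: Case (3) is asserted only when case (2) does not apply, since the two overlap: for example c=1 is a square and a cube (giving Z/6Z), yet where 4 is not a cube in K it also meets the condition of (3) (giving Z/3Z). *)

theory Defs
  imports
    Complex_Main
    "HOL-Algebra.Algebra"
    "HOL-Algebra.Algebraic_Closure_Type"
begin

subsection \<open>Number fields\<close>

text \<open>Number fields are taken to be the subfields of the complex numbers that have finite
  dimension over the rationals; up to isomorphism these are all number fields.\<close>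

abbreviation complex_ring :: "complex ring" where
  "complex_ring \<equiv> ring_of_type_algebra"

definition number_field_of_degree :: "nat \<Rightarrow> complex set \<Rightarrow> bool" where
  "number_field_of_degree d K \<longleftrightarrow>
     subfield K complex_ring \<and> ring.dimension complex_ring d \<rat> K"

definition adjoin_rat :: "complex \<Rightarrow> complex set" where
  "adjoin_rat r = generate_field complex_ring (\<rat> \<union> {r})"

definition is_square_in :: "'a::comm_ring_1 set \<Rightarrow> 'a \<Rightarrow> bool" where
  "is_square_in K a \<longleftrightarrow> (\<exists>s\<in>K. a = s ^ 2)"

definition is_cube_in :: "'a::comm_ring_1 set \<Rightarrow> 'a \<Rightarrow> bool" where
  "is_cube_in K a \<longleftrightarrow> (\<exists>s\<in>K. a = s ^ 3)"


subsection \<open>Groups of points and their torsion\<close>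

datatype 'a ec_point = Infinity | Affine 'a 'a

text \<open>Chord-and-tangent addition on \<open>y^2 = x^3 + a x + b\<close>.  The formulas do not involve
  \<open>b\<close>, which only enters through the equation satisfied by the points.\<close>

fun ec_add :: "'a::field \<Rightarrow> 'a ec_point \<Rightarrow> 'a ec_point \<Rightarrow> 'a ec_point" where
  "ec_add a Infinity Q = Q"
| "ec_add a P Infinity = P"
| "ec_add a (Affine x1 y1) (Affine x2 y2) =
     (if x1 = x2 \<and> y1 = - y2 then Infinity
      else let m = (if x1 = x2 then (3 * x1 ^ 2 + a) / (2 * y1) else (y2 - y1) / (x2 - x1));
               x3 = m ^ 2 - x1 - x2
           in Affine x3 (m * (x1 - x3) - y1))"

definition weierstrass_group :: "'a::field set \<Rightarrow> 'a \<Rightarrow> 'a \<Rightarrow> 'a ec_point monoid" where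
  "weierstrass_group K a b =
     \<lparr> carrier = insert Infinity {Affine x y | x y. x \<in> K \<and> y \<in> K \<and> y ^ 2 = x ^ 3 + a * x + b},
       monoid.mult = ec_add a,
       one = Infinity \<rparr>"

definition mordell_group :: "'a::field set \<Rightarrow> 'a \<Rightarrow> 'a ec_point monoid" where
  "mordell_group K c = weierstrass_group K 0 c"

definition torsion_subgroup :: "('a, 'b) monoid_scheme \<Rightarrow> ('a, 'b) monoid_scheme" where
  "torsion_subgroup G =
     G\<lparr>carrier := {x \<in> carrier G. \<exists>n::nat. n > 0 \<and> x [^]\<^bsub>G\<^esub> n = \<one>\<^bsub>G\<^esub>}\<rparr>"


subsection \<open>Isomorphism classes\<close>

text \<open>The isomorphism class of a group is represented by its members whose elements are
  integers.  Every countable group has such copies, so two countable groups (in particular two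
  groups of points over number fields) have the same class iff they are isomorphic.\<close>

definition iso_class :: "('a, 'b) monoid_scheme \<Rightarrow> int monoid set" where
  "iso_class G = {H. group H \<and> G \<cong> H}"

definition mordell_torsion_classes :: "nat \<Rightarrow> int monoid set set" where
  "mordell_torsion_classes d =
     {iso_class (torsion_subgroup (mordell_group K c)) | K c.
        number_field_of_degree d K \<and> c \<in> K \<and> c \<noteq> 0}"


subsection \<open>Conditions on the coefficient\<close>

text \<open>The cases form a list to be read in order: \<open>cond_Z6\<close> and \<open>cond_Z3\<close> overlap.  For
  instance \<open>c = 1\<close> satisfies both in every cubic field, and the torsion is then \<open>Z/6Z\<close>.  So
  \<open>cond_Z3\<close> has to be combined with the negation of \<open>cond_Z6\<close>; no other two conditions
  overlap for nonzero \<open>c\<close> in a cubic field.\<close>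

definition cond_Z9 :: "complex set \<Rightarrow> complex \<Rightarrow> bool" where
  "cond_Z9 K c \<longleftrightarrow>
     is_square_in K c \<and> is_cube_in K (4 * c) \<and>
     (\<exists>r. r ^ 3 - 3 * r ^ 2 + 1 = 0 \<and> K = adjoin_rat r)"

definition cond_Z6 :: "complex set \<Rightarrow> complex \<Rightarrow> bool" where
  "cond_Z6 K c \<longleftrightarrow>
     is_square_in K c \<and> is_cube_in K c \<or>
     is_cube_in K c \<and> is_cube_in K 4 \<and> is_square_in K (- 3 * c)"

definition cond_Z3 :: "complex set \<Rightarrow> complex \<Rightarrow> bool" where
  "cond_Z3 K c \<longleftrightarrow>
     is_square_in K c \<and> is_cube_in K (4 * c) \<and>
       \<not> (\<exists>r. r ^ 3 - 3 * r ^ 2 + 1 = 0 \<and> K = adjoin_rat r) \<or>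
     is_square_in K c \<and> \<not> is_cube_in K (4 * c) \<or>
     is_cube_in K (4 * c) \<and> is_square_in K (- 3 * c)"

definition cond_Z2 :: "complex set \<Rightarrow> complex \<Rightarrow> bool" where
  "cond_Z2 K c \<longleftrightarrow>
     is_cube_in K c \<and> \<not> is_square_in K c \<and> \<not> is_square_in K (- 3 * c) \<or>
     is_cube_in K c \<and> \<not> is_square_in K c \<and> \<not> is_cube_in K 4"

end

theory Submission
  imports Defs "HOL-Number_Theory.Residues"
begin

text \<open>For a point \<open>P = (x, y)\<close> on \<open>y^2 = x^3 + c\<close> put \<open>t = x^3 / (4 c)\<close>.  Doubling acts on \<open>t\<close> by
  \<open>t \<mapsto> t (t - 2)^3 / (1 + 4 t)^3\<close> and multiplies \<open>y\<close> by \<open>18 t (1 + t) / (1 + 4 t)^2 - 1\<close>.  These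
  formulas have good supersingular reduction at 2: the map on \<open>t\<close> becomes \<open>t \<mapsto> t^4\<close>, with
  derivative divisible by 2.  If \<open>P\<close> has odd order, \<open>t\<close> is periodic, hence 2-integral, and since \<open>t\<close>
  lies in a cubic field some prime above 2 has \<open>t^8 = t\<close> in its residue field.  Therefore \<open>8 P\<close> has
  the same \<open>t\<close> as \<open>P\<close>, the factor of \<open>y\<close> excludes \<open>8 P = P\<close>, and so \<open>8 P = - P\<close>: points of odd order
  are killed by 9.  Points of order 4 would put \<open>sqrt 3\<close> into a cubic field, so the torsion is killed
  by 18.

  Points of order 3 have \<open>x = 0\<close> or \<open>x^3 = - 4 c\<close>.  Solving \<open>2 P = Q - P\<close> with \<open>Q\<close> of order 3 gives a
  cubic for \<open>y / s\<close> when \<open>Q = (0, s)\<close>, whose roots generate the field of \<open>r^3 - 3 r^2 + 1\<close>, and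
  otherwise a polynomial of degree 9 without factors of degree 1 or 3 modulo 5.\<close>

section \<open>The group law\<close>

text \<open>\<open>t\<close> is a coordinate on the quotient of the curve by its six automorphisms,
  so all Mordell curves share one doubling map, whatever their reduction at 2. On the supersingular
  curve y^2 + y = x^3 over the field with two elements, Frobenius F satisfies F^2 = -2; hence 2 acts
  by t -> t^4, and 8 = -F^6 accounts for both the exponent 8 and the sign in 8 P = - P. Residue
  degrees above 2, counted with ramification, add up to 3, so some prime has residue degree 1 or 3,
  the degrees for which t^8 = t holds.

  That prime enters through the ideal (2, g) of integer polynomials, with g a linear or cubic factor
  modulo 2 of the minimal polynomial of t, and through a localisation of Z[t].

  In a cubic field an element with rational square is rational, so -3 is no square; hence cubing is
  injective on K, and t determines P up to sign.

  The group law has to be established as well: associativity is proved for points in general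
  position and extended to all points by a generic translation over the complex numbers.\<close>

definition on_curve :: "'a::field \<Rightarrow> 'a ec_point \<Rightarrow> bool" where
  "on_curve c P \<longleftrightarrow> (case P of Infinity \<Rightarrow> True | Affine x y \<Rightarrow> y ^ 2 = x ^ 3 + c)"

lemma on_curve_simps [simp]:
  "on_curve c Infinity" "on_curve c (Affine x y) \<longleftrightarrow> y ^ 2 = x ^ 3 + c"
  by (simp_all add: on_curve_def)

fun ec_neg :: "'a::field ec_point \<Rightarrow> 'a ec_point" where
  "ec_neg Infinity = Infinity"
| "ec_neg (Affine x y) = Affine x (- y)"

text \<open>Chord and tangent slopes satisfy the same two equations: the second is the difference of
  the curve equations divided by \<open>x2 - x1\<close>, and at a double point it reads
  \<open>2 * y * m = 3 * x ^ 2\<close>. Free of division, it spares later computations the case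
  distinction.\<close>

definition ec_slope :: "'a::field \<Rightarrow> 'a \<Rightarrow> 'a \<Rightarrow> 'a \<Rightarrow> 'a \<Rightarrow> bool" where
  "ec_slope x1 y1 x2 y2 m \<longleftrightarrow>
     m * (x2 - x1) = y2 - y1 \<and> m * (y1 + y2) = x1 ^ 2 + x1 * x2 + x2 ^ 2"

lemma ec_add_Infinity_right [simp]: "ec_add a P Infinity = P"
  by (cases P) auto

lemma ec_add_affine_cases:
  fixes c :: "'a::field_char_0"
  assumes "y1 ^ 2 = x1 ^ 3 + c" "y2 ^ 2 = x2 ^ 3 + c"
  obtains "x1 = x2" "y1 = - y2" "ec_add 0 (Affine x1 y1) (Affine x2 y2) = Infinity"
  | m where "\<not> (x1 = x2 \<and> y1 = - y2)" "ec_slope x1 y1 x2 y2 m"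
      "ec_add 0 (Affine x1 y1) (Affine x2 y2) =
         Affine (m ^ 2 - x1 - x2) (m * (x1 - (m ^ 2 - x1 - x2)) - y1)"
proof (cases "x1 = x2 \<and> y1 = - y2")
  case True
  with that(1) show ?thesis by simp
next
  case False
  define m where "m = (if x1 = x2 then (3 * x1 ^ 2) / (2 * y1) else (y2 - y1) / (x2 - x1))"
  have "ec_slope x1 y1 x2 y2 m"
  proof (cases "x1 = x2")
    case True
    from assms True have "(y1 - y2) * (y1 + y2) = 0" by (simp add: algebra_simps power2_eq_square)
    with False True have "y2 = y1" by (auto simp: add_eq_0_iff2)
    with False True have "y1 \<noteq> 0" "y2 = y1" by auto
    then show ?thesis
      using True by (simp add: ec_slope_def m_def field_simps power2_eq_square)
  next
    case neq: False
    have "(y2 - y1) * (y1 + y2) = (x1 ^ 2 + x1 * x2 + x2 ^ 2) * (x2 - x1)"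
      using assms by (simp add: algebra_simps power2_eq_square power3_eq_cube)
    then show ?thesis
      using neq by (simp add: ec_slope_def m_def field_simps)
  qed
  moreover have "ec_add 0 (Affine x1 y1) (Affine x2 y2) =
         Affine (m ^ 2 - x1 - x2) (m * (x1 - (m ^ 2 - x1 - x2)) - y1)"
    using False by (simp add: m_def Let_def)
  ultimately show ?thesis using False that(2) by blast
qed

text \<open>\<open>(x3, - y3)\<close> is the third point of the line, and
  \<open>m ^ 2 = x1 + x2 + x3\<close> is Vieta. The second identity turns products
  \<open>m * y1\<close> into polynomials in the abscissae; the third says that the line may be based
  at either point.\<close>

lemma ec_slope_sum:
  fixes c :: "'a::field_char_0"
  assumes c1: "y1 ^ 2 = x1 ^ 3 + c"
    and m: "ec_slope x1 y1 x2 y2 m"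
    and x3: "x3 = m ^ 2 - x1 - x2"
    and y3: "y3 = m * (x1 - x3) - y1"
  shows "y3 ^ 2 = x3 ^ 3 + c"
    and "2 * m * y1 = 2 * x1 ^ 2 + x1 * x2 - x2 * x3 + x1 * x3"
    and "y3 = m * (x2 - x3) - y2"
proof -
  have i: "m * (x2 - x1) = y2 - y1" and ii: "m * (y1 + y2) = x1 ^ 2 + x1 * x2 + x2 ^ 2"
    using m by (auto simp: ec_slope_def)
  have m2: "m ^ 2 = x1 + x2 + x3" using x3 by simp
  have "2 * m * y1 = m * (y1 + y2) - m * (y2 - y1)" by (simp add: algebra_simps)
  also have "\<dots> = x1 ^ 2 + x1 * x2 + x2 ^ 2 - m ^ 2 * (x2 - x1)"
    by (simp add: ii i [symmetric] power2_eq_square mult.assoc)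
  finally show 1: "2 * m * y1 = 2 * x1 ^ 2 + x1 * x2 - x2 * x3 + x1 * x3"
    unfolding m2 by (simp add: algebra_simps power2_eq_square)
  have "y3 = m * (x2 - x3) - m * (x2 - x1) - y1" using y3 by (simp add: algebra_simps)
  then show "y3 = m * (x2 - x3) - y2" unfolding i by simp
  have "y3 ^ 2 = m ^ 2 * (x1 - x3) ^ 2 - (2 * m * y1) * (x1 - x3) + y1 ^ 2"
    unfolding y3 by (simp add: algebra_simps power2_eq_square)
  also have "\<dots> = x3 ^ 3 + c"
    unfolding m2 1 c1 by (simp add: algebra_simps power2_eq_square power3_eq_cube)
  finally show "y3 ^ 2 = x3 ^ 3 + c" .
qed

lemma on_curve_ec_add:
  fixes c :: "'a::field_char_0"
  assumes "on_curve c P" "on_curve c Q"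
  shows "on_curve c (ec_add 0 P Q)"
proof (cases P; cases Q)
  fix x1 y1 x2 y2
  assume [simp]: "P = Affine x1 y1" "Q = Affine x2 y2"
  have c: "y1 ^ 2 = x1 ^ 3 + c" "y2 ^ 2 = x2 ^ 3 + c" using assms by simp_all
  from c show ?thesis
  proof (cases rule: ec_add_affine_cases)
    case (2 m)
    show ?thesis
      using ec_slope_sum(1)[OF c(1) 2(2) refl refl] 2(3) by simp
  qed simp
qed (use assms in simp_all)

lemma ec_add_commute:
  fixes c :: "'a::field_char_0"
  assumes "on_curve c P" "on_curve c Q"
  shows "ec_add 0 P Q = ec_add 0 Q P"
proof (cases P; cases Q)
  fix x1 y1 x2 y2
  assume [simp]: "P = Affine x1 y1" "Q = Affine x2 y2"
  have c: "y1 ^ 2 = x1 ^ 3 + c" "y2 ^ 2 = x2 ^ 3 + c" using assms by simp_all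
  show ?thesis
  proof (cases "x1 = x2")
    case True
    then have "y1 = y2 \<or> y1 = - y2" using c by (metis power2_eq_iff)
    with True show ?thesis by auto
  next
    case False
    define k where "k = (y1 - y2) / (x1 - x2)"
    have sl: "(y2 - y1) / (x2 - x1) = k"
      using False by (simp add: k_def field_simps)
    have "k * (x1 - x2) = y1 - y2"
      using False by (simp add: k_def)
    then have *: "k * (x1 - z) - y1 = k * (x2 - z) - y2" for z
      by (simp add: algebra_simps)
    have **: "k ^ 2 - x1 - x2 = k ^ 2 - x2 - x1" by simp
    have "ec_add 0 P Q = Affine (k ^ 2 - x1 - x2) (k * (x1 - (k ^ 2 - x1 - x2)) - y1)"
      using False by (simp add: Let_def sl)
    also have "\<dots> = Affine (k ^ 2 - x2 - x1) (k * (x2 - (k ^ 2 - x2 - x1)) - y2)"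
      unfolding * unfolding ** ..
    also have "\<dots> = ec_add 0 Q P" using False by (simp add: Let_def k_def)
    finally show ?thesis .
  qed
qed auto

lemma on_curve_ec_neg [simp]: "on_curve c (ec_neg P) \<longleftrightarrow> on_curve c P"
  by (cases P) auto

lemma ec_neg_ec_neg [simp]: "ec_neg (ec_neg P) = P"
  by (cases P) auto

lemma ec_add_neg [simp]: "ec_add a P (ec_neg P) = Infinity" "ec_add a (ec_neg P) P = Infinity"
  by (cases P; simp)+

text \<open>Deliberately asymmetric: the second argument must be affine, the first may be
  \<open>Infinity\<close>. So \<open>apart Z T\<close> can hold for one generic \<open>T\<close> and
  all \<open>Z\<close> under consideration.\<close>

fun apart :: "'a ec_point \<Rightarrow> 'a ec_point \<Rightarrow> bool" where
  "apart P Infinity \<longleftrightarrow> False"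
| "apart Infinity (Affine x2 y2) \<longleftrightarrow> True"
| "apart (Affine x1 y1) (Affine x2 y2) \<longleftrightarrow> x1 \<noteq> x2"

lemma apart_cases:
  assumes "apart P Q"
  obtains x y where "P = Infinity" "Q = Affine x y"
  | x1 y1 x2 y2 where "P = Affine x1 y1" "Q = Affine x2 y2" "x1 \<noteq> x2"
  using assms by (cases P; cases Q) auto

text \<open>The chord through -P and P + Q is the mirror image of the chord through P and Q, hence
  has slope \<open>- m\<close>.\<close>

lemma ec_add_neg_cancel:
  fixes c :: "'a::field_char_0"
  assumes "on_curve c P" "on_curve c Q" "apart P Q" "apart P (ec_add 0 P Q)"
  shows "ec_add 0 (ec_neg P) (ec_add 0 P Q) = Q"
  using assms(3)
proof (cases rule: apart_cases)
  case (2 x1 y1 x2 y2)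
  have c: "y1 ^ 2 = x1 ^ 3 + c" "y2 ^ 2 = x2 ^ 3 + c" using assms 2 by simp_all
  from c show ?thesis
  proof (cases rule: ec_add_affine_cases)
    case 1 with 2 show ?thesis by simp
  next
    case (2 m)
    define x3 where "x3 = m ^ 2 - x1 - x2"
    define y3 where "y3 = m * (x1 - x3) - y1"
    have s: "ec_add 0 P Q = Affine x3 y3"
      using 2 \<open>P = _\<close> \<open>Q = _\<close> by (simp add: x3_def y3_def)
    have ne: "x1 \<noteq> x3" using assms(4) s \<open>P = _\<close> by simp
    have m': "(y3 - - y1) / (x3 - x1) = - m"
      using ne unfolding y3_def by (simp add: field_simps)
    have "m * (x2 - x1) = y2 - y1" using 2 by (simp add: ec_slope_def)
    then have "- m * (x1 - x2) + y1 = y2" by (simp add: algebra_simps)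
    moreover have "(- m) ^ 2 - x1 - x3 = x2" by (simp add: x3_def)
    ultimately show ?thesis
      unfolding s using ne \<open>P = _\<close> \<open>Q = _\<close> by (simp only: ec_neg.simps ec_add.simps m' Let_def) auto
  qed
qed auto

text \<open>If the line of slope \<open>m\<close> meets the curve in \<open>P1\<close>, \<open>P2\<close>, \<open>-P4\<close> and the line of slope \<open>p\<close> meets
  it in \<open>P4\<close>, \<open>P3\<close>, \<open>-P5\<close>, the product of the two lines divided by \<open>x - x4\<close> is the function
  \<open>x^2 + b x + d - a y\<close> with the coefficients below.  It vanishes at \<open>P1\<close>, \<open>P2\<close>, \<open>P3\<close> and
  \<open>-P5\<close>.  As \<open>P1\<close>, \<open>P2\<close>, \<open>P3\<close> already determine it, it does not depend on the bracketing
  of \<open>P5 = P1 + P2 + P3\<close>.\<close>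

lemma ec_two_lines:
  fixes c :: "'a::field_char_0"
  assumes c1: "y1 ^ 2 = x1 ^ 3 + c" and m: "ec_slope x1 y1 x2 y2 m"
    and x4: "x4 = m ^ 2 - x1 - x2" and y4: "y4 = m * (x1 - x4) - y1"
  shows "x1 ^ 2 + (x4 + m * p) * x1 + (x4 ^ 2 - m * p * x4 + (m - p) * y4) = (m + p) * y1"
proof -
  note s = ec_slope_sum(2)[OF c1 m x4 y4]
  have m2: "m ^ 2 = x1 + x2 + x4" using x4 by simp
  have "x1 ^ 2 + (x4 + m * p) * x1 + (x4 ^ 2 - m * p * x4 + (m - p) * y4) - (m + p) * y1 =
        x1 ^ 2 + x1 * x4 + x4 ^ 2 + m ^ 2 * (x1 - x4) - 2 * m * y1"
    unfolding y4 by (simp add: algebra_simps power2_eq_square)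
  also have "\<dots> = 0"
    unfolding s m2 by (simp add: algebra_simps power2_eq_square)
  finally show ?thesis by simp
qed

lemma ec_slope_commute: "ec_slope x1 y1 x2 y2 m \<longleftrightarrow> ec_slope x2 y2 x1 y1 m"
  by (auto simp: ec_slope_def algebra_simps)

text \<open>The line through P1 and P2 also passes through -P3, so it can be read as the line
  through P1 and -P3, with sum -P2.\<close>

lemma ec_slope_rotate:
  fixes c :: "'a::field_char_0"
  assumes c1: "y1 ^ 2 = x1 ^ 3 + c" and m: "ec_slope x1 y1 x2 y2 m"
    and x3: "x3 = m ^ 2 - x1 - x2" and y3: "y3 = m * (x1 - x3) - y1"
  shows "ec_slope x1 y1 x3 (- y3) m" "x2 = m ^ 2 - x1 - x3" "- y2 = m * (x1 - x2) - y1"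
proof -
  note s = ec_slope_sum(2)[OF c1 m x3 y3]
  have m2: "m ^ 2 = x1 + x2 + x3" using x3 by simp
  have "m * (y1 + - y3) = 2 * m * y1 - m ^ 2 * (x1 - x3)"
    unfolding y3 by (simp add: algebra_simps power2_eq_square)
  also have "\<dots> = x1 ^ 2 + x1 * x3 + x3 ^ 2"
    unfolding s m2 by (simp add: algebra_simps power2_eq_square)
  finally show "ec_slope x1 y1 x3 (- y3) m"
    unfolding ec_slope_def by (simp add: y3 algebra_simps)
  show "x2 = m ^ 2 - x1 - x3" using x3 by simp
  show "- y2 = m * (x1 - x2) - y1" using m by (simp add: ec_slope_def algebra_simps)
qed

text \<open>The last equation is Vieta for
  \<open>(x ^ 2 + b * x + d) ^ 2 = a ^ 2 * (x ^ 3 + c)\<close>, whose roots are the four abscissae.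
  The others are instances of \<open>ec_two_lines\<close>, based at each of the points in
  turn.\<close>

lemma ec_three_points:
  fixes c :: "'a::field_char_0"
  assumes c1: "y1 ^ 2 = x1 ^ 3 + c" and c2: "y2 ^ 2 = x2 ^ 3 + c" and c3: "y3 ^ 2 = x3 ^ 3 + c"
    and m: "ec_slope x1 y1 x2 y2 m" and p: "ec_slope x4 y4 x3 y3 p"
    and x4: "x4 = m ^ 2 - x1 - x2" and y4: "y4 = m * (x1 - x4) - y1"
    and x5: "x5 = p ^ 2 - x4 - x3" and y5: "y5 = p * (x4 - x5) - y4"
    and a: "a = m + p" and b: "b = x4 + m * p" and d: "d = x4 ^ 2 - m * p * x4 + (m - p) * y4"
  shows "x1 ^ 2 + b * x1 + d = a * y1" "x2 ^ 2 + b * x2 + d = a * y2"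
    "x3 ^ 2 + b * x3 + d = a * y3" "x5 ^ 2 + b * x5 + d = - (a * y5)"
    "x5 = a ^ 2 - 2 * b - x1 - x2 - x3"
proof -
  show "x1 ^ 2 + b * x1 + d = a * y1"
    using ec_two_lines[OF c1 m x4 y4, of p] by (simp add: a b d)
  have m': "ec_slope x2 y2 x1 y1 m" using m by (simp add: ec_slope_commute)
  have y4': "y4 = m * (x2 - x4) - y2" using ec_slope_sum(3)[OF c1 m x4 y4] .
  have x4': "x4 = m ^ 2 - x2 - x1" using x4 by simp
  show "x2 ^ 2 + b * x2 + d = a * y2"
    using ec_two_lines[OF c2 m' x4' y4', of p] by (simp add: a b d)
  have c4: "y4 ^ 2 = x4 ^ 3 + c" using ec_slope_sum(1)[OF c1 m x4 y4] .
  have c5: "(- y5) ^ 2 = x5 ^ 3 + c" using ec_slope_sum(1)[OF c4 p x5 y5] by simp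
  have p': "ec_slope x3 y3 x4 y4 p" using p by (simp add: ec_slope_commute)
  have y5': "y5 = p * (x3 - x5) - y3" using ec_slope_sum(3)[OF c4 p x5 y5] .
  have x5': "x5 = p ^ 2 - x3 - x4" using x5 by simp
  \<comment> \<open>Read from P3, the second line passes through -P5 with sum -P4, which makes P3
    and -P5 admissible base points.\<close>
  note r = ec_slope_rotate[OF c3 p' x5' y5']
  show "x3 ^ 2 + b * x3 + d = a * y3"
    using ec_two_lines[OF c3 r, of m] by (simp add: a b d algebra_simps)
  have r1: "ec_slope x5 (- y5) x3 y3 p" using r(1) by (simp add: ec_slope_commute)
  have r2: "x4 = p ^ 2 - x5 - x3" using r(2) by simp
  have r3: "- y4 = p * (x5 - x4) - (- y5)" using ec_slope_sum(3)[OF c3 r] .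
  show "x5 ^ 2 + b * x5 + d = - (a * y5)"
    using ec_two_lines[OF c5 r1 r2 r3, of m] by (simp add: a b d algebra_simps)
  show "x5 = a ^ 2 - 2 * b - x1 - x2 - x3"
    unfolding x5 a b x4 by (simp add: algebra_simps power2_eq_square)
qed

lemma ec_add_assoc_apart:
  fixes c :: "'a::field_char_0"
  assumes on: "on_curve c P" "on_curve c Q" "on_curve c T"
    and PT: "apart P T" and QT: "apart Q T"
    and P_QT: "apart P (ec_add 0 Q T)" and PQ_T: "apart (ec_add 0 P Q) T"
  shows "ec_add 0 (ec_add 0 P Q) T = ec_add 0 P (ec_add 0 Q T)"
proof (cases "P = Infinity \<or> Q = Infinity \<or> Q = ec_neg P")
  case True
  have "ec_add 0 P (ec_add 0 (ec_neg P) T) = T" if "P \<noteq> Infinity" "Q = ec_neg P"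
  proof -
    have ap: "apart (ec_neg P) Z \<longleftrightarrow> apart P Z" for Z
      by (cases P; cases Z) auto
    show ?thesis
      using ec_add_neg_cancel[of c "ec_neg P" T] on that PT P_QT by (simp add: ap)
  qed
  with True show ?thesis by (cases "P = Infinity"; cases "Q = Infinity") auto
next
  case False
  then obtain x1 y1 x2 y2 where PQ: "P = Affine x1 y1" "Q = Affine x2 y2"
    by (cases P; cases Q) auto
  obtain x3 y3 where T: "T = Affine x3 y3" using QT by (cases T) auto
  have c1: "y1 ^ 2 = x1 ^ 3 + c" and c2: "y2 ^ 2 = x2 ^ 3 + c" and c3: "y3 ^ 2 = x3 ^ 3 + c"
    using on PQ T by simp_all
  have x13: "x1 \<noteq> x3" and x23: "x2 \<noteq> x3" using PT QT PQ T by simp_all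
  have nPQ: "\<not> (x1 = x2 \<and> y1 = - y2)" using False PQ by auto
  obtain m where m: "ec_slope x1 y1 x2 y2 m"
    and add12: "ec_add 0 P Q = Affine (m ^ 2 - x1 - x2) (m * (x1 - (m ^ 2 - x1 - x2)) - y1)"
    using c1 c2 unfolding PQ by (cases rule: ec_add_affine_cases) (use nPQ in auto)
  define x4 where "x4 = m ^ 2 - x1 - x2"
  define y4 where "y4 = m * (x1 - x4) - y1"
  have P4: "ec_add 0 P Q = Affine x4 y4" using add12 by (simp add: x4_def y4_def)
  have c4: "y4 ^ 2 = x4 ^ 3 + c" using ec_slope_sum(1)[OF c1 m x4_def y4_def] .
  have x43: "x4 \<noteq> x3" using PQ_T P4 T by simp
  obtain p where p: "ec_slope x4 y4 x3 y3 p"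
    and add43: "ec_add 0 (Affine x4 y4) (Affine x3 y3) =
      Affine (p ^ 2 - x4 - x3) (p * (x4 - (p ^ 2 - x4 - x3)) - y4)"
    using c4 c3 by (cases rule: ec_add_affine_cases) (use x43 in auto)
  define x5 where "x5 = p ^ 2 - x4 - x3"
  define y5 where "y5 = p * (x4 - x5) - y4"
  have P5: "ec_add 0 (ec_add 0 P Q) T = Affine x5 y5"
    unfolding P4 T using add43 by (simp add: x5_def y5_def)
  obtain n where n: "ec_slope x2 y2 x3 y3 n"
    and add23: "ec_add 0 Q T = Affine (n ^ 2 - x2 - x3) (n * (x2 - (n ^ 2 - x2 - x3)) - y2)"
    using c2 c3 unfolding PQ T by (cases rule: ec_add_affine_cases) (use x23 in auto)
  define x6 where "x6 = n ^ 2 - x2 - x3"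
  define y6 where "y6 = n * (x2 - x6) - y2"
  have P6: "ec_add 0 Q T = Affine x6 y6" using add23 by (simp add: x6_def y6_def)
  have c6: "y6 ^ 2 = x6 ^ 3 + c" using ec_slope_sum(1)[OF c2 n x6_def y6_def] .
  have x16: "x6 \<noteq> x1" using P_QT P6 PQ by simp
  obtain q where q: "ec_slope x6 y6 x1 y1 q"
    and add61: "ec_add 0 (Affine x6 y6) (Affine x1 y1) =
      Affine (q ^ 2 - x6 - x1) (q * (x6 - (q ^ 2 - x6 - x1)) - y6)"
    using c6 c1 by (cases rule: ec_add_affine_cases) (use x16 in auto)
  define x7 where "x7 = q ^ 2 - x6 - x1"
  define y7 where "y7 = q * (x6 - x7) - y6"
  have "ec_add 0 P (ec_add 0 Q T) = ec_add 0 (ec_add 0 Q T) P"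
    by (rule ec_add_commute) (use on in \<open>auto intro: on_curve_ec_add\<close>)
  then have P7: "ec_add 0 P (ec_add 0 Q T) = Affine x7 y7"
    unfolding P6 PQ(1) using add61 by (simp add: x7_def y7_def)

  define a1 where "a1 = m + p"
  define b1 where "b1 = x4 + m * p"
  define d1 where "d1 = x4 ^ 2 - m * p * x4 + (m - p) * y4"
  define a2 where "a2 = n + q"
  define b2 where "b2 = x6 + n * q"
  define d2 where "d2 = x6 ^ 2 - n * q * x6 + (n - q) * y6"
  note f1 = ec_three_points[OF c1 c2 c3 m p x4_def y4_def x5_def y5_def a1_def b1_def d1_def]
  note f2 = ec_three_points[OF c2 c3 c1 n q x6_def y6_def x7_def y7_def a2_def b2_def d2_def]
  \<comment> \<open>The functions of the two bracketings differ by
    \<open>B * x + (d1 - d2) - A * y\<close>, which vanishes at all three points; the aim is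
    \<open>A = 0\<close> and \<open>B = 0\<close>.\<close>
  define A where "A = a1 - a2"
  define B where "B = b1 - b2"
  have e1: "A * y1 = B * x1 + (d1 - d2)"
    unfolding A_def B_def left_diff_distrib f1(1) [symmetric] f2(3) [symmetric] by simp
  have e2: "A * y2 = B * x2 + (d1 - d2)"
    unfolding A_def B_def left_diff_distrib f1(2) [symmetric] f2(1) [symmetric] by simp
  have e3: "A * y3 = B * x3 + (d1 - d2)"
    unfolding A_def B_def left_diff_distrib f1(3) [symmetric] f2(2) [symmetric] by simp
  have mm: "m * (x2 - x1) = y2 - y1" "m * (y1 + y2) = x1 ^ 2 + x1 * x2 + x2 ^ 2"
    using m by (auto simp: ec_slope_def)
  \<comment> \<open>For P = Q, vanishing at both points has to become vanishing to second order: the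
    derivative of \<open>x ^ 2 + b * x + d - a * y\<close> along the tangent of slope
    \<open>m\<close> is zero.\<close>
  have tangent: "2 * x1 + b1 = a1 * m \<and> 2 * x1 + b2 = a2 * m" if "x1 = x2"
  proof
    have "y1 = y2" "y1 \<noteq> 0" using that mm nPQ by auto
    have m2: "2 * y1 * m = 3 * x1 ^ 2" using mm(2) that \<open>y1 = y2\<close>
      by (simp add: algebra_simps power2_eq_square)
    show "2 * x1 + b1 = a1 * m"
      using that unfolding b1_def a1_def x4_def by (simp add: algebra_simps power2_eq_square)
    have n2: "n ^ 2 = x1 + x3 + x6" using that by (simp add: x6_def)
    have y6: "y6 = n * (x1 - x6) - y1" using y6_def that \<open>y1 = y2\<close> by simp
    have "q * (x1 - x6) = y1 - y6" using q by (simp add: ec_slope_def)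
    then have k1: "(q + n) * (x1 - x6) = 2 * y1" by (simp add: y6 algebra_simps)
    have k2: "2 * n * y1 = 2 * x1 ^ 2 + x1 * x3 - x3 * x6 + x1 * x6"
      using ec_slope_sum(2)[OF c2 n x6_def y6_def] that \<open>y1 = y2\<close> by simp
    have "n * q * (x1 - x6) = n * ((q + n) * (x1 - x6)) - n ^ 2 * (x1 - x6)"
      by (simp add: algebra_simps power2_eq_square)
    also have "\<dots> = 2 * n * y1 - n ^ 2 * (x1 - x6)" unfolding k1 by simp
    also have "\<dots> = x1 ^ 2 + x1 * x6 + x6 ^ 2"
      unfolding k2 n2 by (simp add: algebra_simps power2_eq_square)
    finally have "(x1 - x6) * (2 * x1 + b2) = 3 * x1 ^ 2"
      unfolding b2_def by (simp add: algebra_simps power2_eq_square)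
    then have "(q + n) * ((x1 - x6) * (2 * x1 + b2)) = (q + n) * (2 * y1 * m)" unfolding m2 by simp
    then have "2 * y1 * (2 * x1 + b2) = 2 * y1 * (a2 * m)"
      unfolding mult.assoc [symmetric] k1 by (simp add: a2_def algebra_simps)
    with \<open>y1 \<noteq> 0\<close> show "2 * x1 + b2 = a2 * m" by simp
  qed
  have BA: "B = A * m"
  proof (cases "x1 = x2")
    case True
    from tangent[OF this] have "b1 = a1 * m - 2 * x1" "b2 = a2 * m - 2 * x1"
      by (simp_all add: algebra_simps eq_diff_eq)
    then have "B = (a1 * m - 2 * x1) - (a2 * m - 2 * x1)" by (simp only: B_def)
    then show ?thesis by (simp add: A_def left_diff_distrib)
  next
    case False
    have "A * (y2 - y1) = B * (x2 - x1)" unfolding right_diff_distrib e1 e2 by simp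
    then have "(x2 - x1) * (A * m) = (x2 - x1) * B" unfolding mm(1) [symmetric] by (simp add: algebra_simps)
    with False show ?thesis by simp
  qed
  \<comment> \<open>Otherwise P, Q, T lie on one line of slope \<open>m\<close>, whose third point
    has abscissa \<open>x4\<close>, so \<open>x3\<close> would be one of \<open>x1\<close>,
    \<open>x2\<close>, \<open>x4\<close>.\<close>
  have A0: "A = 0"
  proof (rule ccontr)
    assume "A \<noteq> 0"
    have "A * (y3 - y1) = A * (m * (x3 - x1))" 
      unfolding right_diff_distrib e1 e3 by (simp add: BA right_diff_distrib mult.assoc)
    with \<open>A \<noteq> 0\<close> have "y3 - y1 = m * (x3 - x1)" by simp
    then have y3: "y3 = y1 + m * (x3 - x1)" by (simp only: diff_eq_eq add.commute)
    have m2: "m ^ 2 = x1 + x2 + x4" by (simp add: x4_def)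
    have k: "2 * m * y1 = 2 * x1 ^ 2 + x1 * x2 - x2 * x4 + x1 * x4"
      using ec_slope_sum(2)[OF c1 m x4_def y4_def] .
    have "y3 ^ 2 = y1 ^ 2 + (2 * m * y1) * (x3 - x1) + m ^ 2 * (x3 - x1) ^ 2"
      unfolding y3 by (simp add: algebra_simps power2_eq_square)
    then have "(x3 - x1) * (x3 - x2) * (x3 - x4) = 0"
      unfolding k m2 c1 c3 by (simp add: algebra_simps power2_eq_square power3_eq_cube)
    then show False using x13 x23 x43 by simp
  qed
  then have a: "a2 = a1" and b: "b2 = b1" using BA by (auto simp: A_def B_def)
  have d: "d2 = d1" using e1 A0 BA by simp
  \<comment> \<open>With \<open>a1 = 0\<close> the function is a quadratic in \<open>x\<close>
    alone, with roots \<open>x1\<close> and \<open>x2\<close> (double if they agree) and also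
    \<open>x3\<close>, one root too many.\<close>
  have "a1 \<noteq> 0"
  proof
    assume a0: "a1 = 0"
    have s: "x1 + x2 + b1 = 0"
    proof (cases "x1 = x2")
      case True with tangent a0 show ?thesis by simp
    next
      case False
      have "(x1 - x2) * (x1 + x2 + b1) = (x1 ^ 2 + b1 * x1 + d1) - (x2 ^ 2 + b1 * x2 + d1)"
        by (simp add: algebra_simps power2_eq_square)
      also have "\<dots> = 0" unfolding f1(1) f1(2) a0 by simp
      finally have "(x1 - x2) * (x1 + x2 + b1) = 0" .
      with False show ?thesis by simp
    qed
    have "(x1 - x3) * (x1 + x3 + b1) = (x1 ^ 2 + b1 * x1 + d1) - (x3 ^ 2 + b1 * x3 + d1)"
        by (simp add: algebra_simps power2_eq_square)
      also have "\<dots> = 0" unfolding f1(1) f1(3) a0 by simp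
      finally have "(x1 - x3) * (x1 + x3 + b1) = 0" .
    with x13 have "x1 + x3 + b1 = 0" by simp
    then have "x1 + x3 + b1 = x1 + x2 + b1" using s by simp
    then have "x3 = x2" by simp
    with x23 show False by simp
  qed
  have x57: "x5 = x7" unfolding f1(5) f2(5) a b by simp
  have "a1 * y5 = a1 * y7" using f1(4) f2(4) unfolding a b d x57 by auto
  with \<open>a1 \<noteq> 0\<close> have "y5 = y7" by simp
  with x57 show ?thesis unfolding P5 P7 by simp
qed


text \<open>Used for a generic choice: translating a fixed point by a point of abscissa
  \<open>x\<close> hits a prescribed abscissa \<open>w\<close> for few \<open>x\<close>
  only.\<close>

lemma finite_chord_abscissa_const:
  fixes c :: complex
  assumes "c \<noteq> 0" and on: "y0 ^ 2 = x0 ^ 3 + c"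
  shows "finite {x. \<exists>y. y ^ 2 = x ^ 3 + c \<and> x \<noteq> x0 \<and> ((y - y0) / (x - x0)) ^ 2 - x0 - x = w}"
proof -
  define s where "s = w + x0"
  \<comment> \<open>The cubic terms of \<open>(y - y0) ^ 2 = (s + x) * (x - x0) ^ 2\<close> cancel,
    so \<open>2 * y0 * y\<close> equals the quadratic \<open>e0 + e1 * x + e2 * x ^ 2\<close>;
    squaring eliminates \<open>y\<close>. \<open>F\<close> can vanish identically only for
    \<open>x0 = 0\<close> and \<open>y0 = 0\<close>, which would force \<open>c = 0\<close>.\<close>
  define e0 e1 e2 where "e0 = c + y0 ^ 2 - s * x0 ^ 2" and "e1 = 2 * x0 * s - x0 ^ 2" and "e2 = 2 * x0 - s"
  define F where "F = [: e0 ^ 2 - 4 * y0 ^ 2 * c, 2 * e0 * e1, e1 ^ 2 + 2 * e0 * e2,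
      2 * e1 * e2 - 4 * y0 ^ 2, e2 ^ 2 :]"
  have "F \<noteq> 0"
  proof
    assume "F = 0"
    then have e: "coeff F 4 = 0" "coeff F 3 = 0" "coeff F 2 = 0" by simp_all
    then have "e2 = 0" by (simp add: F_def numeral_eq_Suc)
    with e have "e1 = 0" "y0 = 0" by (simp_all add: F_def numeral_eq_Suc)
    have "s = 2 * x0" using \<open>e2 = 0\<close> by (simp add: e2_def)
    with \<open>e1 = 0\<close> have "x0 = 0" by (simp add: e1_def power2_eq_square)
    with on \<open>y0 = 0\<close> \<open>c \<noteq> 0\<close> show False by simp
  qed
  moreover have "{x. \<exists>y. y ^ 2 = x ^ 3 + c \<and> x \<noteq> x0 \<and> ((y - y0) / (x - x0)) ^ 2 - x0 - x = w}
      \<subseteq> {x. poly F x = 0}"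
  proof safe
    fix x y
    assume y: "y ^ 2 = x ^ 3 + c" and ne: "x \<noteq> x0" and w: "w = ((y - y0) / (x - x0)) ^ 2 - x0 - x"
    have "(y - y0) ^ 2 / (x - x0) ^ 2 = s + x" by (simp add: w s_def power_divide)
    then have "(y - y0) ^ 2 = (s + x) * (x - x0) ^ 2" using ne by (simp add: field_simps)
    then have "2 * y0 * y = y ^ 2 + y0 ^ 2 - (s + x) * (x - x0) ^ 2"
      by (simp add: power2_eq_square algebra_simps)
    also have "\<dots> = e0 + e1 * x + e2 * x ^ 2"
      unfolding y e0_def e1_def e2_def by (simp add: power2_eq_square power3_eq_cube algebra_simps)
    finally have "(e0 + e1 * x + e2 * x ^ 2) ^ 2 = (2 * y0 * y) ^ 2" by simp
    also have "\<dots> = 4 * y0 ^ 2 * (x ^ 3 + c)" by (simp add: power_mult_distrib y)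
    finally show "poly F x = 0"
      unfolding F_def by (simp add: power2_eq_square power3_eq_cube algebra_simps)
  qed
  ultimately show ?thesis using finite_subset[OF _ poly_roots_finite[OF \<open>F \<noteq> 0\<close>]] by blast
qed

text \<open>The same elimination with \<open>w\<close> replaced by \<open>x\<close> yields a monic
  polynomial of degree six.\<close>

lemma finite_chord_abscissa_same:
  fixes c :: complex
  shows "finite {x. \<exists>y. y ^ 2 = x ^ 3 + c \<and> x \<noteq> x0 \<and> ((y - y0) / (x - x0)) ^ 2 - x0 - x = x}"
proof -
  define e where "e = c + y0 ^ 2 - x0 ^ 3"
  define F where "F = [: e ^ 2 - 4 * y0 ^ 2 * c, 0, 6 * e * x0, - 2 * e - 4 * y0 ^ 2,
      9 * x0 ^ 2, - 6 * x0, 1 :]"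
  have "F \<noteq> 0" by (simp add: F_def)
  moreover have "{x. \<exists>y. y ^ 2 = x ^ 3 + c \<and> x \<noteq> x0 \<and> ((y - y0) / (x - x0)) ^ 2 - x0 - x = x}
      \<subseteq> {x. poly F x = 0}"
  proof safe
    fix x y
    assume y: "y ^ 2 = x ^ 3 + c" and ne: "x \<noteq> x0" and w: "((y - y0) / (x - x0)) ^ 2 - x0 - x = x"
    have "(y - y0) ^ 2 / (x - x0) ^ 2 = x0 + x + x" using w by (simp add: power_divide algebra_simps)
    then have "(y - y0) ^ 2 = (x0 + x + x) * (x - x0) ^ 2" using ne by (simp add: field_simps)
    then have "2 * y0 * y = y ^ 2 + y0 ^ 2 - (x0 + x + x) * (x - x0) ^ 2"
      by (simp add: power2_eq_square algebra_simps)
    also have "\<dots> = e + 3 * x0 * x ^ 2 - x ^ 3"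
      unfolding y e_def by (simp add: power2_eq_square power3_eq_cube algebra_simps)
    finally have "(e + 3 * x0 * x ^ 2 - x ^ 3) ^ 2 = (2 * y0 * y) ^ 2" by simp
    also have "\<dots> = 4 * y0 ^ 2 * (x ^ 3 + c)" by (simp add: power_mult_distrib y)
    finally show "poly F x = 0"
      unfolding F_def by (simp add: power2_eq_square power3_eq_cube algebra_simps)
  qed
  ultimately show ?thesis using finite_subset[OF _ poly_roots_finite[OF \<open>F \<noteq> 0\<close>]] by blast
qed

text \<open>Each condition excludes finitely many abscissae, and over the complex numbers every
  remaining abscissa carries a point. This is why associativity is proved over the complex numbers
  and not over \<open>K\<close>.\<close>

lemma ex_apart_point:
  fixes c :: complex
  assumes c: "c \<noteq> 0" and fin: "finite ZS" and on: "\<And>Z. Z \<in> ZS \<Longrightarrow> on_curve c Z"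
  obtains T where "on_curve c T" "\<And>Z. Z \<in> ZS \<Longrightarrow> apart Z T"
    "\<And>Z W. Z \<in> ZS \<Longrightarrow> W \<in> ZS \<Longrightarrow> apart W (ec_add 0 Z T)"
    "\<And>Z. Z \<in> ZS \<Longrightarrow> Z \<noteq> Infinity \<Longrightarrow> apart (ec_add 0 Z T) T"
proof -
  define C where "C = (\<lambda>x0 y0 w. {x. \<exists>y. y ^ 2 = x ^ 3 + c \<and> x \<noteq> x0 \<and>
      ((y - y0) / (x - x0)) ^ 2 - x0 - x = w})"
  define C' where "C' = (\<lambda>x0 y0. {x. \<exists>y. y ^ 2 = x ^ 3 + c \<and> x \<noteq> x0 \<and>
      ((y - y0) / (x - x0)) ^ 2 - x0 - x = x})"
  define B where "B = (\<lambda>Z W. case Z of Infinity \<Rightarrow> {} | Affine x0 y0 \<Rightarrow>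
      (case W of Infinity \<Rightarrow> {} | Affine w v \<Rightarrow> C x0 y0 w))"
  define D where "D = (\<lambda>Z. case Z of Infinity \<Rightarrow> {} | Affine x0 y0 \<Rightarrow> C' x0 y0)"
  define xs where "xs = (\<lambda>Z. case Z of Infinity \<Rightarrow> {} | Affine x0 y0 \<Rightarrow> {x0 :: complex})"
  have finC: "finite (C x0 y0 w)" if "y0 ^ 2 = x0 ^ 3 + c" for x0 y0 w
    unfolding C_def by (rule finite_chord_abscissa_const[OF c that])
  have finC': "finite (C' x0 y0)" for x0 y0
    unfolding C'_def by (rule finite_chord_abscissa_same)
  have finB: "finite (B Z W)" if "Z \<in> ZS" for Z W
    using on[OF that] finC by (cases Z; cases W) (simp_all add: B_def)
  have finD: "finite (D Z)" for Z
    using finC' by (simp add: D_def split: ec_point.splits)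
  have finxs: "finite (xs Z)" for Z
    by (simp add: xs_def split: ec_point.splits)
  define bad where "bad = (\<Union>Z\<in>ZS. \<Union>W\<in>ZS. B Z W) \<union> (\<Union>Z\<in>ZS. D Z) \<union> (\<Union>Z\<in>ZS. xs Z)"
  have "finite bad"
    unfolding bad_def using fin finB finD finxs by (intro finite_UnI finite_UN_I)
  then obtain x where x: "x \<notin> bad"
    using infinite_UNIV_char_0 ex_new_if_finite by blast
  define y where "y = csqrt (x ^ 3 + c)"
  have y: "y ^ 2 = x ^ 3 + c" by (simp add: y_def)
  have ap: "apart Z (Affine x y)" if "Z \<in> ZS" for Z
  proof (cases Z)
    case (Affine x0 y0)
    have "x \<notin> xs Z" using x that by (auto simp: bad_def)
    then show ?thesis by (auto simp: Affine xs_def)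
  qed simp
  have sum: "ec_add 0 (Affine x0 y0) (Affine x y) = Affine (((y - y0) / (x - x0)) ^ 2 - x0 - x)
      ((y - y0) / (x - x0) * (x0 - (((y - y0) / (x - x0)) ^ 2 - x0 - x)) - y0)"
    if "x \<noteq> x0" for x0 y0
    using that by (simp add: Let_def eq_commute[of x0 x])
  show thesis
  proof
    show "on_curve c (Affine x y)" using y by simp
    show "apart W (ec_add 0 Z (Affine x y))" if "Z \<in> ZS" "W \<in> ZS" for Z W
    proof (cases Z)
      case Infinity
      then show ?thesis using ap[OF that(2)] by simp
    next
      case (Affine x0 y0)
      then have ne: "x \<noteq> x0" using ap[OF that(1)] by auto
      show ?thesis
      proof (cases W)
        case W: (Affine w v)
        have "x \<notin> B Z W" using x that by (auto simp: bad_def)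
        then have "x \<notin> C x0 y0 w" by (simp add: B_def Affine W)
        then have "((y - y0) / (x - x0)) ^ 2 - x0 - x \<noteq> w" unfolding C_def using ne y by blast
        then show ?thesis unfolding Affine W sum[OF ne] by simp
      next
        case Infinity
        show ?thesis unfolding Affine Infinity sum[OF ne] by simp
      qed
    qed
    show "apart (ec_add 0 Z (Affine x y)) (Affine x y)" if "Z \<in> ZS" "Z \<noteq> Infinity" for Z
    proof (cases Z)
      case (Affine x0 y0)
      then have ne: "x \<noteq> x0" using ap[OF that(1)] by auto
      have "x \<notin> D Z" using x that by (auto simp: bad_def)
      then have "x \<notin> C' x0 y0" by (simp add: D_def Affine)
      then have "((y - y0) / (x - x0)) ^ 2 - x0 - x \<noteq> x" unfolding C'_def using ne y by blast
      then show ?thesis unfolding Affine sum[OF ne] by simp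
    qed (use that in simp)
  qed (fact ap)
qed

lemma ec_add_right_cancel:
  fixes c :: "'a::field_char_0"
  assumes "on_curve c U" "on_curve c V" "on_curve c T" "apart U T" "apart V T"
    and "U \<noteq> Infinity \<Longrightarrow> apart (ec_add 0 U T) T" "V \<noteq> Infinity \<Longrightarrow> apart (ec_add 0 V T) T"
    and eq: "ec_add 0 U T = ec_add 0 V T"
  shows "U = V"
proof -
  have recover: "ec_add 0 (ec_neg T) (ec_add 0 Z T) = Z"
    if "on_curve c Z" "apart Z T" "Z \<noteq> Infinity \<Longrightarrow> apart (ec_add 0 Z T) T" for Z
  proof (cases "Z = Infinity")
    case False
    have "T \<noteq> Infinity" using that(2) by auto
    have sym: "apart T W" if "apart W T" "W \<noteq> Infinity" for W
      using that by (cases W; cases T) auto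
    have "ec_add 0 Z T \<noteq> Infinity"
      using that(2) False by (cases Z; cases T) (auto simp: Let_def)
    then have "apart T (ec_add 0 T Z)" "apart T Z"
      using that False sym ec_add_commute[of c Z T] assms(3) by auto
    then show ?thesis
      using ec_add_neg_cancel[of c T Z] ec_add_commute[of c Z T] assms(3) that(1) by simp
  qed simp
  show ?thesis using recover[of U] recover[of V] assms by metis
qed

text \<open>For a generic \<open>T\<close> both triple sums agree after adding \<open>T\<close>,
  because the facts \<open>1\<close> to \<open>4\<close> rebracket only triples in general position.
  Cancelling \<open>T\<close> gives the claim for arbitrary points.\<close>

theorem ec_add_assoc:
  fixes c :: complex
  assumes c: "c \<noteq> 0" and on: "on_curve c P" "on_curve c Q" "on_curve c S"
  shows "ec_add 0 (ec_add 0 P Q) S = ec_add 0 P (ec_add 0 Q S)"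
proof -
  define U where "U = ec_add 0 (ec_add 0 P Q) S"
  define V where "V = ec_add 0 P (ec_add 0 Q S)"
  have on': "on_curve c (ec_add 0 P Q)" "on_curve c (ec_add 0 Q S)" "on_curve c U" "on_curve c V"
    unfolding U_def V_def using on by (auto intro: on_curve_ec_add)
  define ZS where "ZS = {P, Q, S, ec_add 0 P Q, ec_add 0 Q S, U, V}"
  have "finite ZS" "\<And>Z. Z \<in> ZS \<Longrightarrow> on_curve c Z"
    using on on' by (auto simp: ZS_def)
  from ex_apart_point[OF c this] obtain T where "on_curve c T" "\<And>Z. Z \<in> ZS \<Longrightarrow> apart Z T"
    "\<And>Z W. Z \<in> ZS \<Longrightarrow> W \<in> ZS \<Longrightarrow> apart W (ec_add 0 Z T)"
    "\<And>Z. Z \<in> ZS \<Longrightarrow> Z \<noteq> Infinity \<Longrightarrow> apart (ec_add 0 Z T) T"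
    by metis
  note T = this
  have mem: "P \<in> ZS" "Q \<in> ZS" "S \<in> ZS" "ec_add 0 P Q \<in> ZS" "ec_add 0 Q S \<in> ZS" "U \<in> ZS" "V \<in> ZS"
    by (simp_all add: ZS_def)
  have onST: "on_curve c (ec_add 0 S T)" using on(3) T(1) by (rule on_curve_ec_add)
  have 1: "ec_add 0 U T = ec_add 0 (ec_add 0 P Q) (ec_add 0 S T)"
    unfolding U_def
    by (rule ec_add_assoc_apart[OF on'(1) on(3) T(1) T(2)[OF mem(4)] T(2)[OF mem(3)] T(3)[OF mem(3,4)]
          T(2)[OF mem(6), unfolded U_def]])
  have 2: "ec_add 0 (ec_add 0 Q S) T = ec_add 0 Q (ec_add 0 S T)"
    by (rule ec_add_assoc_apart[OF on(2,3) T(1) T(2)[OF mem(2)] T(2)[OF mem(3)] T(3)[OF mem(3,2)]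
          T(2)[OF mem(5)]])
  have 3: "ec_add 0 (ec_add 0 P Q) (ec_add 0 S T) = ec_add 0 P (ec_add 0 Q (ec_add 0 S T))"
    by (rule ec_add_assoc_apart[OF on(1,2) onST T(3)[OF mem(3,1)] T(3)[OF mem(3,2)]
          T(3)[OF mem(5,1), unfolded 2] T(3)[OF mem(3,4)]])
  have 4: "ec_add 0 V T = ec_add 0 P (ec_add 0 (ec_add 0 Q S) T)"
    unfolding V_def
    by (rule ec_add_assoc_apart[OF on(1) on'(2) T(1) T(2)[OF mem(1)] T(2)[OF mem(5)] T(3)[OF mem(5,1)]
          T(2)[OF mem(7), unfolded V_def]])
  have "ec_add 0 U T = ec_add 0 V T"
    unfolding 1 3 4 2 ..
  then have "U = V"
    using ec_add_right_cancel[OF on'(3,4) T(1) T(2)[OF mem(6)] T(2)[OF mem(7)]]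
      T(4)[OF mem(6)] T(4)[OF mem(7)] by blast
  then show ?thesis by (simp only: U_def V_def)
qed

section \<open>Cubic fields\<close>

interpretation CC: cring complex_ring
  by (rule cring_from_type_algebra)

lemmas field_complex_ring = field_from_type_algebra [where 'a = complex]

lemma complex_ring_simps [simp]:
  "carrier complex_ring = UNIV" "x \<otimes>\<^bsub>complex_ring\<^esub> y = x * y" "x \<oplus>\<^bsub>complex_ring\<^esub> y = x + y"
  "\<one>\<^bsub>complex_ring\<^esub> = 1" "\<zero>\<^bsub>complex_ring\<^esub> = 0"
  by (simp_all add: ring_of_type_algebra_def)

lemma complex_ring_a_inv [simp]: "\<ominus>\<^bsub>complex_ring\<^esub> x = - x"
  by (rule CC.minus_equality) simp_all

lemma complex_ring_m_inv [simp]: "x \<noteq> 0 \<Longrightarrow> inv\<^bsub>complex_ring\<^esub> x = inverse x"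
  by (rule CC.comm_inv_char) simp_all

lemma subfield_complex_ringI:
  assumes "1 \<in> K" "\<And>x. x \<in> K \<Longrightarrow> - x \<in> K" "\<And>x y. x \<in> K \<Longrightarrow> y \<in> K \<Longrightarrow> x + y \<in> K"
    "\<And>x y. x \<in> K \<Longrightarrow> y \<in> K \<Longrightarrow> x * y \<in> K" "\<And>x. x \<in> K \<Longrightarrow> inverse x \<in> K"
  shows "subfield K complex_ring"
  by (rule field.subfieldI'[OF field_complex_ring], rule CC.subringI) (use assms in auto)

lemma subfield_Rats: "subfield \<rat> complex_ring"
  by (rule subfield_complex_ringI) auto

locale complex_subfield =
  fixes K :: "complex set"
  assumes subfield: "subfield K complex_ring"
begin

lemma one_mem [simp, intro]: "1 \<in> K"
  using subringE(3)[OF subfieldE(1)[OF subfield]] by simp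

lemma zero_mem [simp, intro]: "0 \<in> K"
  using subringE(2)[OF subfieldE(1)[OF subfield]] by simp

lemma add_mem [simp, intro]: "x \<in> K \<Longrightarrow> y \<in> K \<Longrightarrow> x + y \<in> K"
  using subringE(7)[OF subfieldE(1)[OF subfield]] by simp

lemma mult_mem [simp, intro]: "x \<in> K \<Longrightarrow> y \<in> K \<Longrightarrow> x * y \<in> K"
  using subringE(6)[OF subfieldE(1)[OF subfield]] by simp

lemma uminus_mem [simp, intro]: "x \<in> K \<Longrightarrow> - x \<in> K"
  using subringE(5)[OF subfieldE(1)[OF subfield]] by simp

lemma minus_mem [simp, intro]: "x \<in> K \<Longrightarrow> y \<in> K \<Longrightarrow> x - y \<in> K"
  using add_mem[of x "- y"] by simp

lemma inverse_mem [simp, intro]: "x \<in> K \<Longrightarrow> inverse x \<in> K"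
  using CC.subfield_m_inv(1)[OF subfield, of x] by (cases "x = 0") auto

lemma divide_mem [simp, intro]: "x \<in> K \<Longrightarrow> y \<in> K \<Longrightarrow> x / y \<in> K"
  by (simp add: divide_inverse)

lemma power_mem [simp, intro]: "x \<in> K \<Longrightarrow> x ^ n \<in> K"
  by (induction n) auto

lemma of_nat_mem [simp, intro]: "of_nat n \<in> K"
  by (induction n) auto

lemma numeral_mem [simp, intro]: "numeral n \<in> K"
  using of_nat_mem[of "numeral n"] by simp

lemma of_int_mem [simp, intro]: "of_int n \<in> K"
  by (cases n rule: int_cases2) auto

lemma Rats_mem [intro]: "x \<in> \<rat> \<Longrightarrow> x \<in> K"
  by (elim Rats_cases') auto

end

lemma independent_Rats_pair:
  assumes "t \<notin> \<rat>"
  shows "CC.independent \<rat> [t, 1]"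
proof -
  have "t \<notin> CC.Span \<rat> [1]" "1 \<notin> CC.Span \<rat> []"
    using assms by (auto simp: CC.line_extension_mem_iff)
  then show ?thesis by (intro CC.li_Cons CC.li_Nil) simp_all
qed

lemma dimension_3_dependent:
  assumes dim: "CC.dimension 3 \<rat> E" and "set [u0, u1, u2, u3] \<subseteq> E"
  obtains q0 q1 q2 q3 where "q0 \<in> \<rat>" "q1 \<in> \<rat>" "q2 \<in> \<rat>" "q3 \<in> \<rat>"
    "\<not> (q0 = 0 \<and> q1 = 0 \<and> q2 = 0 \<and> q3 = 0)" "q0 * u0 + q1 * u1 + q2 * u2 + q3 * u3 = 0"
proof -
  have "CC.dependent \<rat> [u0, u1, u2, u3]"
    using CC.independent_length_le_dimension[OF subfield_Rats dim _ assms(2)] by auto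
  then obtain Ks where Ks: "length Ks = length [u0, u1, u2, u3]" "CC.combine Ks [u0, u1, u2, u3] = 0"
      "set Ks \<subseteq> \<rat>" "set Ks \<noteq> {0}"
    using CC.dependent_imp_non_trivial_combine[OF subfield_Rats, of "[u0, u1, u2, u3]"] by auto
  then obtain q0 q1 q2 q3 where "Ks = [q0, q1, q2, q3]"
    by (auto simp: length_Suc_conv)
  with Ks that[of q0 q1 q2 q3] show thesis by (auto simp: add.assoc)
qed

locale cubic_field =
  fixes K :: "complex set"
  assumes degree: "number_field_of_degree 3 K"

sublocale cubic_field \<subseteq> complex_subfield
  using degree by (intro complex_subfield.intro) (simp add: number_field_of_degree_def)

context cubic_field
begin

lemma dimension_3: "CC.dimension 3 \<rat> K"
  using degree by (simp add: number_field_of_degree_def)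

lemmas four_dependent = dimension_3_dependent[OF dimension_3]

lemma ex_outside_span:
  assumes t: "t \<in> K" "t \<notin> \<rat>"
  obtains w where "w \<in> K" "\<And>a b. a \<in> \<rat> \<Longrightarrow> b \<in> \<rat> \<Longrightarrow> w \<noteq> a + b * t"
proof -
  have dim: "CC.dimension 2 \<rat> (CC.Span \<rat> [t, 1])"
    using CC.dimension_independent[OF independent_Rats_pair[OF t(2)]] by (simp add: numeral_2_eq_2)
  have "K \<noteq> CC.Span \<rat> [t, 1]"
  proof
    assume K: "K = CC.Span \<rat> [t, 1]"
    have "(2::nat) = 3"
      by (rule CC.dimension_is_inj[OF subfield_Rats _ dimension_3]) (use dim in \<open>simp only: K\<close>)
    then show False by simp
  qed
  moreover have "CC.Span \<rat> [t, 1] \<subseteq> K"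
  proof
    fix x assume "x \<in> CC.Span \<rat> [t, 1]"
    then obtain a b where "a \<in> \<rat>" "b \<in> \<rat>" "x = a * t + b"
      by (auto simp: CC.line_extension_mem_iff)
    with t show "x \<in> K" by auto
  qed
  ultimately obtain w where w: "w \<in> K" "w \<notin> CC.Span \<rat> [t, 1]" by blast
  moreover have "a + b * t \<in> CC.Span \<rat> [t, 1]" if "a \<in> \<rat>" "b \<in> \<rat>" for a b
  proof -
    have "a + b * t = b * t + (a * 1 + 0)" by simp
    moreover have "a * 1 + 0 \<in> CC.line_extension \<rat> 1 {0}"
      using that by (simp add: CC.line_extension_mem_iff)
    ultimately show ?thesis
      using that unfolding CC.Span.simps foldr.simps comp_apply id_apply
      by (subst CC.line_extension_mem_iff) (intro bexI[of _ b] bexI[of _ a], simp_all add: add.commute)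
  qed
  ultimately show thesis using that by metis
qed

text \<open>This is the tower law by hand: for \<open>u\<close> outside the span of 1 and
  \<open>t\<close>, a relation between 1, \<open>t\<close>, \<open>u\<close>, \<open>t * u\<close>
  has the form \<open>(r2 + r3 * t) * u = - (r0 + r1 * t)\<close>, and dividing puts
  \<open>u\<close> back into the span.\<close>

lemma no_quadratic:
  assumes t: "t \<in> K" and q: "q0 \<in> \<rat>" "q1 \<in> \<rat>" "q2 \<in> \<rat>" "q2 \<noteq> 0"
    and eq: "q0 + q1 * t + q2 * t ^ 2 = 0"
  shows "t \<in> \<rat>"
proof (rule ccontr)
  assume irr: "t \<notin> \<rat>"
  define \<alpha> \<beta> where "\<alpha> = - q1 / q2" and "\<beta> = - q0 / q2"
  have ab: "\<alpha> \<in> \<rat>" "\<beta> \<in> \<rat>" using q by (auto simp: \<alpha>_def \<beta>_def)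
  have "q2 * t ^ 2 = (q0 + q1 * t + q2 * t ^ 2) - q0 - q1 * t" by simp
  also have "\<dots> = q2 * (\<alpha> * t + \<beta>)"
    unfolding eq using q by (simp add: \<alpha>_def \<beta>_def right_diff_distrib)
  finally have t2: "t * t = \<alpha> * t + \<beta>"
    using q by (simp add: power2_eq_square)
  have lin: "a = 0 \<and> b = 0" if "a \<in> \<rat>" "b \<in> \<rat>" "a + b * t = 0" for a b
  proof -
    have "b = 0"
    proof (rule ccontr)
      assume "b \<noteq> 0"
      have "t = ((a + b * t) - a) / b" using \<open>b \<noteq> 0\<close> by simp
      then have "t = - a / b" unfolding that(3) by simp
      then show False using irr that by auto
    qed
    with that show ?thesis by simp
  qed
  obtain u where u: "u \<in> K" "\<And>a b. a \<in> \<rat> \<Longrightarrow> b \<in> \<rat> \<Longrightarrow> u \<noteq> a + b * t"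
    using ex_outside_span[OF t irr] by blast
  have "set [1, t, u, t * u] \<subseteq> K" using t u by simp
  from four_dependent[OF this] obtain r0 r1 r2 r3
    where r: "r0 \<in> \<rat>" "r1 \<in> \<rat>" "r2 \<in> \<rat>" "r3 \<in> \<rat>" "\<not> (r0 = 0 \<and> r1 = 0 \<and> r2 = 0 \<and> r3 = 0)"
      "r0 * 1 + r1 * t + r2 * u + r3 * (t * u) = 0" .
  have r': "(r2 + r3 * t) * u = - (r0 + r1 * t)"
  proof -
    have "(r2 + r3 * t) * u = (r0 * 1 + r1 * t + r2 * u + r3 * (t * u)) - (r0 + r1 * t)"
      by (simp add: algebra_simps)
    then show ?thesis unfolding r(6) by simp
  qed
  show False
  proof (cases "r2 + r3 * t = 0")
    case True
    then have "r2 = 0 \<and> r3 = 0" by (rule lin[OF r(3,4)])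
    moreover have "r0 + r1 * t = 0" using r' unfolding True by (metis mult_zero_left neg_0_equal_iff_equal)
    then have "r0 = 0 \<and> r1 = 0" by (rule lin[OF r(1,2)])
    ultimately show False using r(5) by blast
  next
    case False
    \<comment> \<open>\<open>N\<close> is the norm of \<open>r2 + r3 * t\<close>; the cofactor below
      is the conjugate, as the two roots of the quadratic add up to \<open>\<alpha>\<close>.\<close>
    define N where "N = r2 ^ 2 + \<alpha> * r2 * r3 - \<beta> * r3 ^ 2"
    have N: "(r2 + r3 * t) * (r2 + r3 * \<alpha> - r3 * t) = N"
    proof -
      have "(r2 + r3 * t) * (r2 + r3 * \<alpha> - r3 * t) =
          r2 ^ 2 + \<alpha> * r2 * r3 + r3 ^ 2 * (\<alpha> * t) - r3 ^ 2 * (t * t)"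
        by (simp add: algebra_simps power2_eq_square)
      then show ?thesis unfolding t2 by (simp add: N_def algebra_simps)
    qed
    have "r2 + r3 * \<alpha> - r3 * t \<noteq> 0"
    proof
      assume "r2 + r3 * \<alpha> - r3 * t = 0"
      then have "(r2 + r3 * \<alpha>) + (- r3) * t = 0" by simp
      then have "r2 + r3 * \<alpha> = 0 \<and> - r3 = 0" by (rule lin[rotated 2]) (use r(3,4) ab in simp_all)
      then have "r3 = 0" "r2 = 0" by auto
      with False show False by simp
    qed
    with False N have N0: "N \<noteq> 0" by auto
    have "N * u = (r2 + r3 * \<alpha> - r3 * t) * ((r2 + r3 * t) * u)" unfolding N [symmetric] by simp
    also have "\<dots> = - (r0 * (r2 + r3 * \<alpha>)) + (r0 * r3 - r1 * (r2 + r3 * \<alpha>)) * t + r1 * r3 * (t * t)"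
      unfolding r' by (simp add: algebra_simps)
    also have "\<dots> = (r1 * r3 * \<beta> - r0 * (r2 + r3 * \<alpha>)) + (r0 * r3 - r1 * (r2 + r3 * \<alpha>) + r1 * r3 * \<alpha>) * t"
      unfolding t2 by (simp add: algebra_simps)
    finally have "u = (r1 * r3 * \<beta> - r0 * (r2 + r3 * \<alpha>)) / N +
        (r0 * r3 - r1 * (r2 + r3 * \<alpha>) + r1 * r3 * \<alpha>) / N * t"
      using N0 by (simp add: field_simps)
    moreover have "N \<in> \<rat>" unfolding N_def by (intro Rats_add Rats_diff Rats_mult Rats_power r(1-4) ab)
    then have "(r1 * r3 * \<beta> - r0 * (r2 + r3 * \<alpha>)) / N \<in> \<rat>"
      "(r0 * r3 - r1 * (r2 + r3 * \<alpha>) + r1 * r3 * \<alpha>) / N \<in> \<rat>"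
      by (intro Rats_add Rats_diff Rats_mult Rats_divide r(1-4) ab; assumption)+
    ultimately show False using u(2) by blast
  qed
qed

lemma irrational_generates:
  assumes t: "t \<in> K" "t \<notin> \<rat>" and u: "u \<in> K"
  obtains a b d where "a \<in> \<rat>" "b \<in> \<rat>" "d \<in> \<rat>" "u = a + b * t + d * t ^ 2"
proof -
  have "set [1, t, t ^ 2, u] \<subseteq> K" using t u by simp
  from four_dependent[OF this] obtain q0 q1 q2 q3
    where q: "q0 \<in> \<rat>" "q1 \<in> \<rat>" "q2 \<in> \<rat>" "q3 \<in> \<rat>" "\<not> (q0 = 0 \<and> q1 = 0 \<and> q2 = 0 \<and> q3 = 0)"
      "q0 * 1 + q1 * t + q2 * t ^ 2 + q3 * u = 0" .
  have "q3 \<noteq> 0"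
  proof
    assume q3: "q3 = 0"
    have "q0 + q1 * t + q2 * t ^ 2 = q0 * 1 + q1 * t + q2 * t ^ 2 + q3 * u" using q3 by simp
    then have "q2 = 0" using no_quadratic[OF t(1) q(1-3) _ trans[OF _ q(6)]] t(2) by blast
    have "q1 = 0"
    proof (rule ccontr)
      assume "q1 \<noteq> 0"
      then have "t = ((q0 * 1 + q1 * t + q2 * t ^ 2 + q3 * u) - q0) / q1" using q3 \<open>q2 = 0\<close> by simp
      then have "t = - q0 / q1" unfolding q(6) by simp
      moreover have "- q0 / q1 \<in> \<rat>" using q(1,2) by simp
      ultimately show False using t(2) by simp
    qed
    moreover have "q0 = 0" using q(6) unfolding q3 \<open>q2 = 0\<close> \<open>q1 = 0\<close> by simp
    ultimately show False using q(5) q3 \<open>q2 = 0\<close> by blast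
  qed
  have "u = ((q0 * 1 + q1 * t + q2 * t ^ 2 + q3 * u) - q0 - q1 * t - q2 * t ^ 2) / q3"
    using \<open>q3 \<noteq> 0\<close> by simp
  then have "u = - q0 / q3 + - q1 / q3 * t + - q2 / q3 * t ^ 2"
    unfolding q(6) using \<open>q3 \<noteq> 0\<close> by (simp add: diff_divide_distrib)
  moreover have "- q0 / q3 \<in> \<rat>" "- q1 / q3 \<in> \<rat>" "- q2 / q3 \<in> \<rat>" using q(1-4) by simp_all
  ultimately show thesis using that by blast
qed

lemma square_rational:
  assumes "s \<in> K" "s ^ 2 \<in> \<rat>"
  shows "s \<in> \<rat>"
  by (rule no_quadratic[of s "- (s ^ 2)" 0 1]) (use assms in simp_all)

end

lemma Rats_complex_real: "(q::complex) \<in> \<rat> \<Longrightarrow> q \<in> \<real>"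
  by (elim Rats_cases') auto

lemma Rats_square_ne_negative:
  fixes q :: complex and n :: real
  assumes "q \<in> \<rat>" "n < 0"
  shows "q ^ 2 \<noteq> of_real n"
proof
  assume "q ^ 2 = of_real n"
  moreover obtain x where "q = of_real x" using Rats_complex_real[OF assms(1)] by (auto elim: Reals_cases)
  ultimately have "x ^ 2 = n" by (metis of_real_eq_iff of_real_power)
  with assms(2) show False by (metis not_le zero_le_power2)
qed

context cubic_field
begin

text \<open>If \<open>x\<close> and \<open>y\<close> differ, \<open>x / y\<close> is a primitive
  cube root of unity and \<open>s\<close> is a square root of -3, which no cubic field
  contains.\<close>

lemma cube_inj:
  assumes "x \<in> K" "y \<in> K" "x ^ 3 = y ^ 3"
  shows "x = y"
proof (rule ccontr)
  assume ne: "x \<noteq> y"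
  have "(x - y) * (x ^ 2 + x * y + y ^ 2) = x ^ 3 - y ^ 3"
    by (simp add: algebra_simps power2_eq_square power3_eq_cube)
  with assms ne have e: "x ^ 2 + x * y + y ^ 2 = 0" by simp
  then have "y \<noteq> 0" using ne by auto
  define s where "s = (2 * x + y) / y"
  have "(2 * x + y) ^ 2 = 4 * (x ^ 2 + x * y + y ^ 2) - 3 * y ^ 2"
    by (simp add: power2_eq_square algebra_simps)
  with e have "(2 * x + y) ^ 2 = - 3 * y ^ 2" by simp
  then have s2: "s ^ 2 = - 3" using \<open>y \<noteq> 0\<close> by (simp add: s_def power_divide)
  have "s \<in> K" using assms by (auto simp: s_def)
  then have "s \<in> \<rat>" by (rule square_rational) (simp add: s2)
  then show False using Rats_square_ne_negative[of s "-3"] s2 by simp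
qed

lemma not_square_minus3:
  assumes "s \<in> K"
  shows "s ^ 2 \<noteq> - 3"
proof
  assume s2: "s ^ 2 = - 3"
  then have "s \<in> \<rat>" using square_rational[OF assms] by simp
  then show False using Rats_square_ne_negative[of s "-3"] s2 by simp
qed

end


section \<open>The points over a subfield form an abelian group\<close>

lemma carrier_mordell_group:
  "carrier (mordell_group K c) = {P. on_curve c P \<and> (\<forall>x y. P = Affine x y \<longrightarrow> x \<in> K \<and> y \<in> K)}"
proof (rule Set.set_eqI)
  fix P show "P \<in> carrier (mordell_group K c) \<longleftrightarrow>
      P \<in> {P. on_curve c P \<and> (\<forall>x y. P = Affine x y \<longrightarrow> x \<in> K \<and> y \<in> K)}"
    by (cases P) (auto simp: mordell_group_def weierstrass_group_def)
qed

lemma mordell_group_simps [simp]: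
  "P \<otimes>\<^bsub>mordell_group K c\<^esub> Q = ec_add 0 P Q" "\<one>\<^bsub>mordell_group K c\<^esub> = Infinity"
  by (simp_all add: mordell_group_def weierstrass_group_def)

lemma Affine_in_mordell_group [simp]:
  "Affine x y \<in> carrier (mordell_group K c) \<longleftrightarrow> x \<in> K \<and> y \<in> K \<and> y ^ 2 = x ^ 3 + c"
  by (auto simp: carrier_mordell_group)

lemma Infinity_in_mordell_group [simp]: "Infinity \<in> carrier (mordell_group K c)"
  by (simp add: carrier_mordell_group)

locale mordell = complex_subfield +
  fixes c :: complex and G (structure)
  assumes c_mem [simp]: "c \<in> K" and c_nonzero: "c \<noteq> 0"
  defines "G \<equiv> mordell_group K c"
begin

lemma on_curve_carrier: "P \<in> carrier G \<Longrightarrow> on_curve c P"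
  by (simp add: G_def carrier_mordell_group)

lemma ec_add_closed:
  assumes "P \<in> carrier G" "Q \<in> carrier G"
  shows "ec_add 0 P Q \<in> carrier G"
proof (cases P; cases Q)
  fix x1 y1 x2 y2
  assume PQ: "P = Affine x1 y1" "Q = Affine x2 y2"
  have mem: "x1 \<in> K" "y1 \<in> K" "x2 \<in> K" "y2 \<in> K" using assms by (auto simp: PQ G_def)
  have "on_curve c (ec_add 0 P Q)"
    using assms by (intro on_curve_ec_add on_curve_carrier)
  then show ?thesis
    unfolding PQ G_def using mem by (auto simp: Let_def carrier_mordell_group split: if_splits)
qed (use assms in simp_all)

lemma comm_group_mordell: "comm_group G"
proof (rule comm_groupI)
  show "\<And>x y. x \<in> carrier G \<Longrightarrow> y \<in> carrier G \<Longrightarrow> x \<otimes> y \<in> carrier G"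
    using ec_add_closed by (simp add: G_def)
  show "\<one> \<in> carrier G" by (simp add: G_def)
  show "x \<otimes> y \<otimes> z = x \<otimes> (y \<otimes> z)" if "x \<in> carrier G" "y \<in> carrier G" "z \<in> carrier G" for x y z
    using ec_add_assoc[OF c_nonzero] that[THEN on_curve_carrier] by (simp add: G_def)
  show "x \<otimes> y = y \<otimes> x" if "x \<in> carrier G" "y \<in> carrier G" for x y
    using ec_add_commute that[THEN on_curve_carrier] by (simp add: G_def)
  show "\<one> \<otimes> x = x" if "x \<in> carrier G" for x
    by (simp add: G_def)
  show "\<exists>y\<in>carrier G. y \<otimes> x = \<one>" if "x \<in> carrier G" for x
    using that by (intro bexI[of _ "ec_neg x"]) (cases x; auto simp: G_def)+
qed

end

sublocale mordell \<subseteq> group: comm_group G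
  by (rule comm_group_mordell)

context mordell
begin

lemma one_eq: "\<one> = Infinity"
  by (simp add: G_def)

lemma mult_eq: "P \<otimes> Q = ec_add 0 P Q"
  by (simp add: G_def)

lemma ec_neg_closed: "P \<in> carrier G \<Longrightarrow> ec_neg P \<in> carrier G"
  by (cases P) (auto simp: G_def)

lemma inv_eq: "P \<in> carrier G \<Longrightarrow> inv P = ec_neg P"
  by (rule group.inv_equality) (auto simp: ec_neg_closed mult_eq one_eq)

lemma Affine_mem: "Affine x y \<in> carrier G \<longleftrightarrow> x \<in> K \<and> y \<in> K \<and> y ^ 2 = x ^ 3 + c"
  by (simp add: G_def)

lemma pow_2: "P \<in> carrier G \<Longrightarrow> P [^] (2::nat) = ec_add 0 P P"
  by (simp add: numeral_2_eq_2 mult_eq one_eq)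

end

text \<open>The substitutions \<open>x ^ 3 = 4 * c * t\<close> and
  \<open>y ^ 2 = c * (1 + 4 * t)\<close> clear \<open>c\<close> from the tangent formulas, so each
  coordinate is multiplied by a function of \<open>t\<close> alone.\<close>

lemma mordell_double:
  fixes x y c :: complex
  defines "t \<equiv> x ^ 3 / (4 * c)"
  assumes c: "c \<noteq> 0" and on: "y ^ 2 = x ^ 3 + c" and y: "y \<noteq> 0"
  shows "y ^ 2 = c * (1 + 4 * t)" "1 + 4 * t \<noteq> 0"
    "ec_add 0 (Affine x y) (Affine x y) =
       Affine (x * (t - 2) / (1 + 4 * t)) (y * (18 * t * (1 + t) / (1 + 4 * t) ^ 2 - 1))"
proof -
  have x3: "x ^ 3 = 4 * c * t" using c by (simp add: t_def)
  show y2: "y ^ 2 = c * (1 + 4 * t)" unfolding on x3 by (simp add: algebra_simps)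
  with y show t: "1 + 4 * t \<noteq> 0" by auto
  define w where "w = 1 + 4 * t"
  have w: "w \<noteq> 0" using t by (simp add: w_def)
  define m where "m = 3 * x ^ 2 / (2 * y)"
  have yy: "y * y = c * w" using y2 by (simp add: w_def power2_eq_square)
  have "m ^ 2 = 9 * x * x ^ 3 / (4 * (y * y))"
    unfolding m_def by (simp add: power_divide power2_eq_square power3_eq_cube)
  also have "\<dots> = 9 * x * t / w"
    unfolding yy x3 using c w by (simp add: field_simps)
  finally have m2: "m ^ 2 = 9 * x * t / w" .
  define x' where "x' = x * (t - 2) / w"
  have x': "m ^ 2 - x - x = x'"
    unfolding m2 x'_def using w by (simp add: field_simps) (simp add: w_def algebra_simps)
  have d: "x - x' = 3 * x * (1 + t) / w"
    unfolding x'_def using w by (simp add: field_simps) (simp add: w_def algebra_simps)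
  have "m * (x - x') = 9 * x ^ 3 * (1 + t) / (2 * y * w)"
    unfolding d m_def by (simp add: power2_eq_square power3_eq_cube)
  also have "\<dots> = y * (9 * x ^ 3 * (1 + t) / (2 * (y * y) * w))"
    using y by (simp add: mult.assoc)
  also have "\<dots> = y * (18 * t * (1 + t) / w ^ 2)"
    unfolding yy x3 using c w by (simp add: power2_eq_square)
  finally have y': "m * (x - x') - y = y * (18 * t * (1 + t) / w ^ 2 - 1)"
    by (simp add: right_diff_distrib)
  have "y \<noteq> - y" using y by simp
  then have "ec_add 0 (Affine x y) (Affine x y) = Affine (m ^ 2 - x - x) (m * (x - (m ^ 2 - x - x)) - y)"
    by (simp add: Let_def m_def)
  then show "ec_add 0 (Affine x y) (Affine x y) =
       Affine (x * (t - 2) / (1 + 4 * t)) (y * (18 * t * (1 + t) / (1 + 4 * t) ^ 2 - 1))"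
    unfolding x' y' by (simp add: x'_def w_def)
qed

section \<open>Integral minimal polynomials\<close>

definition ieval :: "int poly \<Rightarrow> complex \<Rightarrow> complex" where
  "ieval h z = poly (map_poly of_int h) z"

lemma ieval_0 [simp]: "ieval 0 z = 0"
  by (simp add: ieval_def)

lemma ieval_pCons [simp]: "ieval (pCons a h) z = of_int a + z * ieval h z"
  by (simp add: ieval_def map_poly_pCons)

lemma ieval_1 [simp]: "ieval 1 z = 1"
  by (simp add: one_pCons)

lemma ieval_add [simp]: "ieval (g + h) z = ieval g z + ieval h z"
  by (induction g h rule: poly_induct2) (simp_all add: algebra_simps)

lemma ieval_smult [simp]: "ieval (smult a h) z = of_int a * ieval h z"
  by (induction h) (simp_all add: algebra_simps)

lemma ieval_minus [simp]: "ieval (- h) z = - ieval h z"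
  using ieval_smult[of "-1" h z] by simp

lemma ieval_diff [simp]: "ieval (g - h) z = ieval g z - ieval h z"
  using ieval_add[of g "- h" z] by simp

lemma ieval_mult [simp]: "ieval (g * h) z = ieval g z * ieval h z"
  by (induction g) (simp_all add: algebra_simps)

lemma poly_degree_1_explicit: "degree p = 1 \<Longrightarrow> p = [:coeff p 0, coeff p 1:]"
  by (rule poly_eqI) (auto simp: coeff_pCons coeff_eq_0 split: nat.splits)

lemma poly_degree_2_explicit: "degree p = 2 \<Longrightarrow> p = [:coeff p 0, coeff p 1, coeff p 2:]"
  by (rule poly_eqI) (auto simp: coeff_pCons coeff_eq_0 numeral_2_eq_2 split: nat.splits)

lemma poly_degree_3_explicit: "degree p = 3 \<Longrightarrow> p = [:coeff p 0, coeff p 1, coeff p 2, coeff p 3:]"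
  by (rule poly_eqI) (auto simp: coeff_pCons coeff_eq_0 numeral_2_eq_2 numeral_3_eq_3 split: nat.splits)

lemma Rats_clear_denominator:
  assumes "(q::complex) \<in> \<rat>"
  obtains n :: int where "n \<noteq> 0" "\<exists>m::int. of_int n * q = of_int m"
proof -
  obtain a b :: int where "b > 0" "q = of_int a / of_int b"
    using assms by (elim Rats_cases') blast
  then have "b \<noteq> 0" "of_int b * q = of_int a" by auto
  then show thesis using that by blast
qed

lemma (in cubic_field) ex_int_poly:
  assumes "t \<in> K"
  obtains h where "h \<noteq> 0" "degree h \<le> 3" "ieval h t = 0"
proof -
  have "set [1, t, t ^ 2, t ^ 3] \<subseteq> K" using assms by simp
  from four_dependent[OF this] obtain q0 q1 q2 q3
    where q: "q0 \<in> \<rat>" "q1 \<in> \<rat>" "q2 \<in> \<rat>" "q3 \<in> \<rat>" "\<not> (q0 = 0 \<and> q1 = 0 \<and> q2 = 0 \<and> q3 = 0)"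
      "q0 * 1 + q1 * t + q2 * t ^ 2 + q3 * t ^ 3 = 0" .
  obtain n0 n1 n2 n3 m0 m1 m2 m3 :: int where
    n: "n0 \<noteq> 0" "n1 \<noteq> 0" "n2 \<noteq> 0" "n3 \<noteq> 0" and
    m: "of_int n0 * q0 = of_int m0" "of_int n1 * q1 = of_int m1"
      "of_int n2 * q2 = of_int m2" "of_int n3 * q3 = of_int m3"
    using q(1-4) by (metis Rats_clear_denominator)
  define h where "h = [: n1 * n2 * n3 * m0, n0 * n2 * n3 * m1, n0 * n1 * n3 * m2, n0 * n1 * n2 * m3 :]"
  show thesis
  proof
    have "m0 \<noteq> 0 \<or> m1 \<noteq> 0 \<or> m2 \<noteq> 0 \<or> m3 \<noteq> 0"
      using q(5) m n by (metis mult_eq_0_iff of_int_eq_0_iff)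
    then show "h \<noteq> 0" using n by (auto simp: h_def)
    show "degree h \<le> 3" unfolding h_def by (intro order.trans[OF degree_pCons_le]) simp
    have "ieval h t = of_int (n0 * n1 * n2 * n3) * (q0 * 1 + q1 * t + q2 * t ^ 2 + q3 * t ^ 3)"
      by (simp add: h_def m [symmetric] power2_eq_square power3_eq_cube distrib_left mult.assoc mult.commute mult.left_commute)
    then show "ieval h t = 0" unfolding q(6) by simp
  qed
qed

text \<open>A primitive polynomial of least degree divides every annihilating polynomial even over
  the integers, by pseudo-division and the Gauss lemma; the integral quotient is what permits
  arguments modulo 2 and 5. Degree 2 is excluded by \<open>no_quadratic\<close>.\<close>

lemma (in cubic_field) ex_minimal_int_poly:
  assumes t: "t \<in> K"
  obtains f where "degree f = 1 \<or> degree f = 3" "ieval f t = 0" "\<And>h. ieval h t = 0 \<Longrightarrow> f dvd h"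
proof -
  define S where "S = (\<lambda>h. h \<noteq> 0 \<and> ieval h t = 0)"
  obtain h where "S h" and deg_h: "degree h \<le> 3" using ex_int_poly[OF t] by (metis S_def)
  obtain f0 where f0: "S f0" and min: "\<And>h. S h \<Longrightarrow> degree f0 \<le> degree h"
    using ex_has_least_nat[of S h degree] \<open>S h\<close> by blast
  define f where "f = primitive_part f0"
  have f0_eq: "f0 = smult (content f0) f" by (simp add: f_def)
  have f0_nz: "f0 \<noteq> 0" "ieval f0 t = 0" using f0 by (simp_all add: S_def)
  then have c0: "content f0 \<noteq> 0" by simp
  have f_nz: "f \<noteq> 0" using f0_nz f0_eq by auto
  have f_root: "ieval f t = 0" using f0_nz(2) c0 by (subst (asm) f0_eq) simp
  have deg_f: "degree f = degree f0" using c0 by (subst f0_eq) simp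
  have content_f: "content f = 1" using f0_nz by (simp add: f_def)
  have dvd: "f dvd h" if h: "ieval h t = 0" for h
  proof -
    define r where "r = pseudo_mod h f"
    obtain a q where aq: "a \<noteq> 0" "smult a h = f * q + r"
      using pseudo_mod(1)[OF f_nz, of h] by (auto simp: r_def)
    have "ieval (smult a h) t = ieval (f * q + r) t" using aq by simp
    then have "ieval r t = 0" using h f_root by simp
    moreover have "r = 0 \<or> degree r < degree f0"
      using pseudo_mod(2)[OF f_nz, of h] by (simp add: r_def deg_f)
    ultimately have "r = 0" using min[of r] unfolding S_def by (metis leD)
    then have eq: "smult a h = f * q" using aq by simp
    \<comment> \<open>As \<open>content f = 1\<close>, the factor \<open>a\<close> introduced by
      pseudo-division divides \<open>q\<close> and can be cancelled.\<close>
    have "content q = content (smult a h)" unfolding eq by (simp add: content_mult content_f)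
    then have "a dvd content q" by simp
    then have "[:a:] dvd q" by (simp only: const_poly_dvd_iff_dvd_content)
    then obtain q' where "q = [:a:] * q'" by (elim dvdE)
    then have q': "q = smult a q'" by simp
    have "smult a (h - f * q') = 0" using eq by (simp add: q' smult_diff_right)
    then have "h = f * q'" using aq(1) by simp
    then show ?thesis by simp
  qed
  have "degree f \<noteq> 0"
  proof
    assume "degree f = 0"
    then obtain a where "f = [:a:]" by (meson degree_eq_zeroE)
    then show False using f_root f_nz by simp
  qed
  moreover have "degree f \<noteq> 2"
  proof
    assume d2: "degree f = 2"
    then have "f = [:coeff f 0, coeff f 1, coeff f 2:]" by (rule poly_degree_2_explicit)
    then have "of_int (coeff f 0) + of_int (coeff f 1) * t + of_int (coeff f 2) * t ^ 2 = ieval f t"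
      by (metis (no_types) add.assoc add.right_neutral distrib_left ieval_0 ieval_pCons mult.commute
          mult.left_commute mult_zero_right power2_eq_square)
    then have "of_int (coeff f 0) + of_int (coeff f 1) * t + of_int (coeff f 2) * t ^ 2 = 0"
      by (simp only: f_root)
    moreover have "coeff f 2 \<noteq> 0" using d2 f_nz leading_coeff_neq_0 by metis
    ultimately have "t \<in> \<rat>" by (intro no_quadratic[OF t, of "of_int (coeff f 0)" "of_int (coeff f 1)" "of_int (coeff f 2)"]) auto
    then obtain n m :: int where nm: "n \<noteq> 0" "of_int n * t = of_int m" by (metis Rats_clear_denominator)
    then have "S [:- m, n:]" by (simp add: S_def mult.commute)
    from min[OF this] d2 nm(1) show False by (simp add: deg_f)
  qed
  moreover have "degree f \<le> 3" using min[OF \<open>S h\<close>] deg_h by (simp add: deg_f)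
  ultimately have "degree f = 1 \<or> degree f = 3" by linarith
  then show thesis using that f_root dvd by blast
qed

section \<open>Local rings with residue characteristic two\<close>

text \<open>The properties used of a ring \<open>V\<close> above 2: \<open>I\<close> is a proper
  ideal containing 2, and \<open>1 + I\<close> consists of units. \<open>V\<close> is not assumed to
  be a valuation ring, so an element outside \<open>V\<close> need not have its inverse in
  \<open>I\<close>, and integrality takes a separate argument.\<close>

locale two_adic =
  fixes V I :: "complex set"
  assumes one_V: "1 \<in> V"
    and add_V: "x \<in> V \<Longrightarrow> y \<in> V \<Longrightarrow> x + y \<in> V"
    and mult_V: "x \<in> V \<Longrightarrow> y \<in> V \<Longrightarrow> x * y \<in> V"
    and uminus_V: "x \<in> V \<Longrightarrow> - x \<in> V"
    and I_V: "x \<in> I \<Longrightarrow> x \<in> V"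
    and add_I: "x \<in> I \<Longrightarrow> y \<in> I \<Longrightarrow> x + y \<in> I"
    and mult_I: "x \<in> I \<Longrightarrow> y \<in> V \<Longrightarrow> x * y \<in> I"
    and two_I: "2 \<in> I"
    and one_I: "1 \<notin> I"
    and inverse_V: "x \<in> I \<Longrightarrow> inverse (1 + x) \<in> V"

definition poly_ideal_2 :: "int poly \<Rightarrow> int poly set" where
  "poly_ideal_2 g = {smult 2 a + g * b | a b. True}"

lemma poly_ideal_2_add: "p \<in> poly_ideal_2 g \<Longrightarrow> q \<in> poly_ideal_2 g \<Longrightarrow> p + q \<in> poly_ideal_2 g"
proof (clarsimp simp: poly_ideal_2_def)
  fix a b a' b'
  show "\<exists>a'' b''. smult 2 a + g * b + (smult 2 a' + g * b') = smult 2 a'' + g * b''"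
    by (intro exI[of _ "a + a'"] exI[of _ "b + b'"]) (simp add: smult_add_right distrib_left)
qed

lemma poly_ideal_2_mult: "p \<in> poly_ideal_2 g \<Longrightarrow> p * q \<in> poly_ideal_2 g"
proof (clarsimp simp: poly_ideal_2_def)
  fix a b
  show "\<exists>a' b'. (smult 2 a + g * b) * q = smult 2 a' + g * b'"
    by (intro exI[of _ "a * q"] exI[of _ "b * q"]) (simp add: distrib_right mult.assoc)
qed

lemma poly_ideal_2_uminus: "p \<in> poly_ideal_2 g \<Longrightarrow> - p \<in> poly_ideal_2 g"
  using poly_ideal_2_mult[of p g "-1"] by simp

lemma poly_ideal_2_diff: "p \<in> poly_ideal_2 g \<Longrightarrow> q \<in> poly_ideal_2 g \<Longrightarrow> p - q \<in> poly_ideal_2 g"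
  using poly_ideal_2_add[of p g "- q"] poly_ideal_2_uminus by simp

lemma poly_ideal_2_generators: "2 \<in> poly_ideal_2 g" "0 \<in> poly_ideal_2 g" "g \<in> poly_ideal_2 g"
proof -
  have "2 = smult 2 1 + g * 0" "0 = smult 2 0 + g * 0" "g = smult 2 0 + g * 1"
    by (simp_all add: numeral_poly one_pCons)
  then show "2 \<in> poly_ideal_2 g" "0 \<in> poly_ideal_2 g" "g \<in> poly_ideal_2 g"
    unfolding poly_ideal_2_def by blast+
qed

text \<open>Modulo 2, \<open>g\<close> keeps its positive degree and is no unit. With
  \<open>n\<close> the degree of \<open>b\<close> modulo 2, the product \<open>g * b\<close> has an
  odd coefficient at \<open>degree g + n\<close>, where the constant 1 has coefficient 0.\<close>

lemma one_notin_poly_ideal_2: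
  assumes odd: "odd (lead_coeff g)" and deg: "degree g > 0"
  shows "1 \<notin> poly_ideal_2 g"
proof
  assume "1 \<in> poly_ideal_2 g"
  then obtain a b where ab: "1 = smult 2 a + g * b" by (auto simp: poly_ideal_2_def)
  define S where "S = {n. odd (coeff b n)}"
  have finS: "finite S"
    by (rule finite_subset[of _ "{..degree b}"]) (auto simp: S_def intro: le_degree)
  have "S \<noteq> {}"
  proof
    assume "S = {}"
    have "1 = 2 * coeff a 0 + coeff g 0 * coeff b 0"
      using arg_cong[OF ab, of "\<lambda>p. coeff p 0"] by (simp add: coeff_mult)
    moreover have "even (coeff b 0)" using \<open>S = {}\<close> by (auto simp: S_def)
    ultimately have "even (1::int)" by (metis dvd_add dvd_mult dvd_triv_left)
    then show False by simp
  qed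
  define n where "n = Max S"
  have n: "odd (coeff b n)" using Max_in[OF finS \<open>S \<noteq> {}\<close>] by (simp add: n_def S_def)
  have above: "even (coeff b k)" if "k > n" for k
    using Max_ge[OF finS, of k] that by (auto simp: n_def S_def)
  have "coeff (g * b) (degree g + n) = (\<Sum>i\<le>degree g + n. coeff g i * coeff b (degree g + n - i))"
    by (simp add: coeff_mult)
  also have "\<dots> = lead_coeff g * coeff b n +
      (\<Sum>i\<in>{..degree g + n} - {degree g}. coeff g i * coeff b (degree g + n - i))"
    by (subst sum.remove[of _ "degree g"]) auto
  finally have "coeff (g * b) (degree g + n) = \<dots>" .
  moreover have "even (\<Sum>i\<in>{..degree g + n} - {degree g}. coeff g i * coeff b (degree g + n - i))"
  proof (rule dvd_sum)
    fix i assume i: "i \<in> {..degree g + n} - {degree g}"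
    show "even (coeff g i * coeff b (degree g + n - i))"
    proof (cases "i < degree g")
      case True
      then show ?thesis using above[of "degree g + n - i"] by simp
    next
      case False
      then have "coeff g i = 0" using i by (intro coeff_eq_0) auto
      then show ?thesis by simp
    qed
  qed
  ultimately have "odd (coeff (g * b) (degree g + n))" using odd n by simp
  moreover have "coeff 1 (degree g + n) = 2 * coeff a (degree g + n) + coeff (g * b) (degree g + n)"
    using arg_cong[OF ab, of "\<lambda>p. coeff p (degree g + n)"] by simp
  moreover have "coeff (1 :: int poly) (degree g + n) = 0" using deg by simp
  ultimately show False by (metis dvd_0_right dvd_add_right_iff dvd_triv_left)
qed

text \<open>\<open>V\<close> localises the ring generated by \<open>z\<close> at the polynomials
  congruent to 1 modulo (2, g), a multiplicative set whether or not the ideal is prime. A polynomial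
  vanishing at \<open>z\<close> is a multiple of \<open>f\<close> and so lies in (2, g); hence no
  denominator vanishes and 1 stays outside \<open>I\<close>.\<close>

lemma ex_two_adic:
  assumes min: "\<And>h. ieval h z = 0 \<Longrightarrow> f dvd h"
    and g: "odd (lead_coeff g)" "degree g > 0" and f: "f \<in> poly_ideal_2 g"
  obtains V I where "two_adic V I" "z \<in> V" "\<And>h. h \<in> poly_ideal_2 g \<Longrightarrow> ieval h z \<in> I"
proof -
  let ?J = "poly_ideal_2 g"
  note J = poly_ideal_2_add poly_ideal_2_mult poly_ideal_2_uminus poly_ideal_2_diff poly_ideal_2_generators
  have one: "1 \<notin> ?J" using one_notin_poly_ideal_2[OF g] .
  have nz: "ieval s z \<noteq> 0" if "s - 1 \<in> ?J" for s
  proof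
    assume "ieval s z = 0"
    from min[OF this] obtain q where "s = f * q" by (elim dvdE)
    then have "s \<in> ?J" using f J(2) by simp
    from poly_ideal_2_diff[OF this that] show False using one by simp
  qed
  have unit_mult: "s * u - 1 \<in> ?J" if "s - 1 \<in> ?J" "u - 1 \<in> ?J" for s u
  proof -
    have eq: "s * u - 1 = (s - 1) * u + (u - 1)" by (simp add: algebra_simps)
    show ?thesis unfolding eq by (intro J(1) J(2) that)
  qed
  define V where "V = {ieval a z / ieval s z | a s. s - 1 \<in> ?J}"
  define I where "I = {ieval a z / ieval s z | a s. a \<in> ?J \<and> s - 1 \<in> ?J}"
  have VI: "ieval a z / ieval s z \<in> V" if "s - 1 \<in> ?J" for a s using that by (auto simp: V_def)
  have II: "ieval a z / ieval s z \<in> I" if "a \<in> ?J" "s - 1 \<in> ?J" for a s using that by (auto simp: I_def)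
  have one1: "1 - 1 \<in> ?J" using J by simp
  have VV: "ieval a z \<in> V" for a using VI[OF one1, of a] by simp
  have IJ: "ieval a z \<in> I" if "a \<in> ?J" for a using II[OF that one1] by simp
  have addq: "ieval a z / ieval s z + ieval b z / ieval u z = ieval (a * u + b * s) z / ieval (s * u) z"
    if "s - 1 \<in> ?J" "u - 1 \<in> ?J" for a b s u
    using nz[OF that(1)] nz[OF that(2)] by (simp add: add_frac_eq)
  have "two_adic V I"
  proof
    show "1 \<in> V" using VV[of 1] by simp
    show "x + y \<in> V" if "x \<in> V" "y \<in> V" for x y
    proof -
      obtain a s b u where *: "x = ieval a z / ieval s z" "s - 1 \<in> ?J" "y = ieval b z / ieval u z" "u - 1 \<in> ?J"
        using \<open>x \<in> V\<close> \<open>y \<in> V\<close> unfolding V_def by blast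
      show ?thesis unfolding *(1,3) addq[OF *(2,4)] by (intro VI unit_mult *)
    qed
    show "x * y \<in> V" if "x \<in> V" "y \<in> V" for x y
    proof -
      obtain a s b u where *: "x = ieval a z / ieval s z" "s - 1 \<in> ?J" "y = ieval b z / ieval u z" "u - 1 \<in> ?J"
        using \<open>x \<in> V\<close> \<open>y \<in> V\<close> unfolding V_def by blast
      have "x * y = ieval (a * b) z / ieval (s * u) z" by (simp add: *)
      then show ?thesis using VI unit_mult * by metis
    qed
    show "- x \<in> V" if "x \<in> V" for x
    proof -
      obtain a s where *: "x = ieval a z / ieval s z" "s - 1 \<in> ?J" using \<open>x \<in> V\<close> unfolding V_def by blast
      have "- x = ieval (- a) z / ieval s z" by (simp add: *)
      then show ?thesis using VI * by metis
    qed
    show "x \<in> V" if "x \<in> I" for x using that unfolding V_def I_def by blast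
    show "x + y \<in> I" if "x \<in> I" "y \<in> I" for x y
    proof -
      obtain a s b u where *: "x = ieval a z / ieval s z" "a \<in> ?J" "s - 1 \<in> ?J"
        "y = ieval b z / ieval u z" "b \<in> ?J" "u - 1 \<in> ?J"
        using \<open>x \<in> I\<close> \<open>y \<in> I\<close> unfolding I_def by blast
      show ?thesis unfolding *(1,4) addq[OF *(3,6)] by (intro II unit_mult * J)
    qed
    show "x * y \<in> I" if "x \<in> I" "y \<in> V" for x y
    proof -
      obtain a s b u where *: "x = ieval a z / ieval s z" "a \<in> ?J" "s - 1 \<in> ?J"
        "y = ieval b z / ieval u z" "u - 1 \<in> ?J"
        using \<open>x \<in> I\<close> \<open>y \<in> V\<close> unfolding I_def V_def by blast
      have "x * y = ieval (a * b) z / ieval (s * u) z" by (simp add: *)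
      moreover have "\<dots> \<in> I" by (intro II unit_mult * J)
      ultimately show ?thesis by simp
    qed
    show "2 \<in> I" using IJ[OF J(5)] by (simp add: numeral_poly)
    show "1 \<notin> I"
    proof
      assume "1 \<in> I"
      then obtain a s where *: "1 = ieval a z / ieval s z" "a \<in> ?J" "s - 1 \<in> ?J" unfolding I_def by blast
      then have "ieval (s - a) z = 0" using nz[OF *(3)] by simp
      moreover have "(s - a) - 1 \<in> ?J"
        using J(4)[OF *(3,2)] by (simp add: algebra_simps)
      ultimately show False using nz by blast
    qed
    show "inverse (1 + x) \<in> V" if "x \<in> I" for x
    proof -
      obtain a s where *: "x = ieval a z / ieval s z" "a \<in> ?J" "s - 1 \<in> ?J" using \<open>x \<in> I\<close> unfolding I_def by blast
      have "(s + a) - 1 \<in> ?J" using J(1)[OF *(3,2)] by (simp add: algebra_simps)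
      moreover have "inverse (1 + x) = ieval s z / ieval (s + a) z"
        using nz[OF *(3)] by (simp add: * field_simps)
      ultimately show ?thesis using VI by metis
    qed
  qed
  moreover have "z \<in> V" using VV[of "[:0, 1:]"] by simp
  ultimately show thesis using that IJ by blast
qed

section \<open>The doubling map at the prime 2\<close>

definition dbl :: "complex \<Rightarrow> complex" where
  "dbl t = t * (t - 2) ^ 3 / (1 + 4 * t) ^ 3"

lemma dbl_eq: "dbl t = t * (t - 2) ^ 3 * inverse (1 + 4 * t) ^ 3"
  by (simp add: dbl_def divide_inverse power_inverse)

context two_adic
begin

lemma zero_V: "0 \<in> V"
  using add_V[OF one_V uminus_V[OF one_V]] by simp

lemma diff_V: "x \<in> V \<Longrightarrow> y \<in> V \<Longrightarrow> x - y \<in> V"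
  using add_V[of x "- y"] uminus_V[of y] by simp

lemma power_V: "x \<in> V \<Longrightarrow> x ^ k \<in> V"
  by (induction k) (auto intro: one_V mult_V)

lemma numeral_V: "numeral k \<in> V"
proof -
  have "of_nat m \<in> V" for m by (induction m) (auto intro: zero_V one_V add_V)
  from this[of "numeral k"] show ?thesis by simp
qed

lemmas V_intros = one_V zero_V add_V mult_V uminus_V diff_V power_V numeral_V

lemma zero_I: "0 \<in> I"
  using mult_I[OF two_I zero_V] by simp

lemma uminus_I: "x \<in> I \<Longrightarrow> - x \<in> I"
  using mult_I[of x "- 1"] V_intros by simp

lemma diff_I: "x \<in> I \<Longrightarrow> y \<in> I \<Longrightarrow> x - y \<in> I"
  using add_I[of x "- y"] uminus_I[of y] by simp

lemma mult_I': "x \<in> V \<Longrightarrow> y \<in> I \<Longrightarrow> x * y \<in> I"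
  using mult_I[of y x] by (simp add: mult.commute)

definition cg :: "complex \<Rightarrow> complex \<Rightarrow> bool" where
  "cg x y \<longleftrightarrow> x - y \<in> I"

lemma cg_refl: "cg x x"
  by (simp add: cg_def zero_I)

lemma cg_sym: "cg x y \<Longrightarrow> cg y x"
  using uminus_I[of "x - y"] by (simp add: cg_def)

lemma cg_trans [trans]: "cg x y \<Longrightarrow> cg y z \<Longrightarrow> cg x z"
  using add_I[of "x - y" "y - z"] by (simp add: cg_def)

lemma cg_add: "cg x x' \<Longrightarrow> cg y y' \<Longrightarrow> cg (x + y) (x' + y')"
  using add_I[of "x - x'" "y - y'"] by (simp add: cg_def algebra_simps)

lemma cg_diff: "cg x x' \<Longrightarrow> cg y y' \<Longrightarrow> cg (x - y) (x' - y')"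
  using diff_I[of "x - x'" "y - y'"] by (simp add: cg_def algebra_simps)

lemma cg_mult:
  assumes "cg x x'" "cg y y'" "x' \<in> V" "y \<in> V"
  shows "cg (x * y) (x' * y')"
proof -
  have "x * y - x' * y' = (x - x') * y + x' * (y - y')" by (simp add: algebra_simps)
  then show ?thesis using assms by (auto simp: cg_def intro: add_I mult_I mult_I')
qed

lemma cg_V: "cg x y \<Longrightarrow> y \<in> V \<Longrightarrow> x \<in> V"
  using add_V[OF I_V, of "x - y" y] by (simp add: cg_def)

lemma cg_power: "cg x y \<Longrightarrow> y \<in> V \<Longrightarrow> cg (x ^ k) (y ^ k)"
  by (induction k) (auto intro: cg_refl cg_mult power_V cg_V)

lemma cg_double: "x \<in> V \<Longrightarrow> cg (2 * x) 0"
  using mult_I[OF two_I] by (simp add: cg_def)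

lemma cg_unit:
  assumes "cg w 1"
  shows "w \<noteq> 0" "inverse w \<in> V" "cg (inverse w) 1"
proof -
  have "w - 1 \<in> I" using assms by (simp add: cg_def)
  from inverse_V[OF this] show V: "inverse w \<in> V" by simp
  show w: "w \<noteq> 0" using assms one_I uminus_I[of "- 1"] by (auto simp: cg_def)
  have "inverse w - 1 = inverse w * (1 - w)" using w by (simp add: right_diff_distrib)
  then show "cg (inverse w) 1"
    using cg_sym[OF assms] V by (auto simp: cg_def intro: mult_I')
qed

lemma cg_one_plus_double: "x \<in> V \<Longrightarrow> cg (1 + 4 * x) 1"
  using cg_double[of "2 * x"] by (simp add: cg_def V_intros)

lemma not_cg_one_zero: "\<not> cg 1 0"
  using one_I by (simp add: cg_def)

lemma cg_dbl:
  assumes t: "t \<in> V"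
  shows "cg (dbl t) (t ^ 4)" "dbl t \<in> V"
proof -
  note u = cg_unit[OF cg_one_plus_double[OF t]]
  have "cg (t - 2) (t - 0)" using two_I by (intro cg_diff cg_refl) (simp add: cg_def)
  then have "cg ((t - 2) ^ 3) (t ^ 3)" using cg_power[OF _ t] by simp
  moreover have "cg (inverse (1 + 4 * t) ^ 3) (1 ^ 3)" by (intro cg_power u one_V)
  ultimately have "cg (t * (t - 2) ^ 3 * inverse (1 + 4 * t) ^ 3) (t * t ^ 3 * 1 ^ 3)"
    by (intro cg_mult cg_refl V_intros t u)
  then show "cg (dbl t) (t ^ 4)" by (simp add: dbl_eq power_Suc [symmetric])
  then show "dbl t \<in> V" by (rule cg_V) (intro V_intros t)
qed

text \<open>The derivative of the doubling map is divisible by 2, so the map contracts residue classes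
  and each class contains at most one periodic point.\<close>

lemma dbl_contracts:
  assumes a: "a \<in> V" and b: "b \<in> V" and ab: "a - b \<in> I"
  obtains i where "i \<in> I" "dbl a - dbl b = (a - b) * i"
proof -
  note ua = cg_unit[OF cg_one_plus_double[OF a]] and ub = cg_unit[OF cg_one_plus_double[OF b]]
  define D where "D = (1 + 4 * b) ^ 3"
  define N where "N = b * (b - 2) ^ 3"
  \<comment> \<open>The numerator of \<open>dbl a - dbl b\<close> is \<open>a - b\<close> times a
    factor congruent modulo 2 to \<open>(a + b) * (a ^ 2 + b ^ 2) * D\<close>. Writing
    \<open>a + b = (a - b) + 2 * b\<close> splits this factor as \<open>(a - b) * p + 2 * q\<close>,
    with both parts in \<open>I\<close>.\<close>
  define p where "p = (a ^ 2 + b ^ 2) * D"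
  define q where "q = b * (a ^ 2 + b ^ 2) * D + (6 * (a + b) - 3 * (a ^ 2 + a * b + b ^ 2) - 4) * D
      - N * (6 + 24 * (a + b) + 32 * (a ^ 2 + a * b + b ^ 2))"
  have V: "D \<in> V" "N \<in> V" "p \<in> V" "q \<in> V"
    unfolding p_def q_def D_def N_def by (intro V_intros a b)+
  define i where "i = ((a - b) * p + 2 * q) * (inverse (1 + 4 * a) ^ 3 * inverse (1 + 4 * b) ^ 3)"
  have "i \<in> I" unfolding i_def
    by (intro mult_I add_I mult_I[OF ab] mult_I[OF two_I] V_intros V ua ub)
  moreover have "dbl a - dbl b = (a - b) * i"
  proof -
    have Na: "a * (a - 2) ^ 3 - N = (a - b) * ((a + b) * (a ^ 2 + b ^ 2) - 6 * (a ^ 2 + a * b + b ^ 2) + 12 * (a + b) - 8)"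
      unfolding N_def by (simp add: algebra_simps power2_eq_square power3_eq_cube)
    have Da: "(1 + 4 * a) ^ 3 - D = (a - b) * (12 + 48 * (a + b) + 64 * (a ^ 2 + a * b + b ^ 2))"
      unfolding D_def by (simp add: algebra_simps power2_eq_square power3_eq_cube)
    have "a * (a - 2) ^ 3 * D - N * (1 + 4 * a) ^ 3 = (a * (a - 2) ^ 3 - N) * D - N * ((1 + 4 * a) ^ 3 - D)"
      by (simp add: algebra_simps)
    also have "\<dots> = (a - b) * ((a - b) * p + 2 * q)"
      unfolding Na Da p_def q_def by (simp add: algebra_simps)
    finally have e: "a * (a - 2) ^ 3 * D - N * (1 + 4 * a) ^ 3 = (a - b) * ((a - b) * p + 2 * q)" .
    have "dbl a - dbl b = (a * (a - 2) ^ 3 * D - N * (1 + 4 * a) ^ 3) / ((1 + 4 * a) ^ 3 * (1 + 4 * b) ^ 3)"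
      unfolding dbl_def N_def D_def using ua(1) ub(1) by (simp add: diff_frac_eq)
    then show ?thesis unfolding e i_def by (simp add: divide_inverse power_inverse mult.assoc)
  qed
  ultimately show thesis using that by blast
qed

text \<open>The pole is the identity of the curve. With \<open>s = inverse t\<close>, doubling
  becomes \<open>s * (s + 4) ^ 3 / (1 - 2 * s) ^ 3\<close>, so near the pole every step multiplies
  \<open>s\<close> by an element of \<open>I\<close>, and a return to the start would put 1 into
  \<open>I\<close>.\<close>

lemma no_pole_on_periodic_orbit:
  assumes orbit: "\<And>j. t (Suc j) = dbl (t j)" and period: "n > 0" "t n = t 0"
    and t0: "t 0 \<noteq> 0" and pole: "inverse (t 0) \<in> I"
  shows False
proof -
  \<comment> \<open>The convention \<open>inverse 0 = 0\<close> keeps this true at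
    \<open>x = 0\<close> and where \<open>1 + 4 * x = 0\<close>.\<close>
  have step: "\<exists>i\<in>I. inverse (dbl x) = inverse x * i" if "inverse x \<in> I" for x
  proof (cases "x = 0")
    case True
    then show ?thesis using zero_I by (auto simp: dbl_def)
  next
    case False
    define s where "s = inverse x"
    have s: "s \<in> I" using that by (simp add: s_def)
    have "cg (1 - 2 * s) (1 - 0)"
      using cg_double[OF I_V[OF s]] by (intro cg_diff cg_refl)
    then have u: "inverse (1 - 2 * s) \<in> V" using cg_unit by simp
    have "2 * 2 \<in> I" by (intro mult_I two_I V_intros)
    then have "s + 4 \<in> I" using add_I[OF s] by simp
    then have i: "(s + 4) * ((s + 4) ^ 2 * inverse (1 - 2 * s) ^ 3) \<in> I"
      using u I_V[OF s] by (intro mult_I V_intros)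
    have xs: "x * s = 1" using False by (simp add: s_def)
    have "1 + 4 * x = x * (s + 4)" "x - 2 = x * (1 - 2 * s)"
      using xs by (simp_all add: distrib_left right_diff_distrib mult.left_commute)
    then have "dbl x = x * (1 - 2 * s) ^ 3 / (s + 4) ^ 3"
      unfolding dbl_def using False by (simp add: power_mult_distrib)
    then have "inverse (dbl x) = inverse x * ((s + 4) * ((s + 4) ^ 2 * inverse (1 - 2 * s) ^ 3))"
      by (simp add: divide_inverse power_inverse power2_eq_square power3_eq_cube mult_ac)
    with i show ?thesis by blast
  qed
  have "\<exists>i\<in>I. inverse (t (Suc j)) = inverse (t 0) * i" for j
  proof (induction j)
    case 0
    show ?case using step[OF pole] by (simp add: orbit)
  next
    case (Suc j)
    then obtain i where i: "i \<in> I" "inverse (t (Suc j)) = inverse (t 0) * i" by blast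
    then have "inverse (t (Suc j)) \<in> I" using mult_I[OF pole I_V] by simp
    from step[OF this] obtain i' where i': "i' \<in> I" "inverse (t (Suc (Suc j))) = inverse (t (Suc j)) * i'"
      by (auto simp: orbit)
    have "i * i' \<in> I" using i i' by (intro mult_I I_V)
    then show ?case using i i' by (auto simp: mult.assoc)
  qed
  from this[of "n - 1"] period obtain i where "i \<in> I" "inverse (t 0) = inverse (t 0) * i" by auto
  with t0 one_I show False by simp
qed

text \<open>Modulo \<open>I\<close> three doublings raise \<open>t\<close> to the power 64, which is
  the identity where \<open>t ^ 8 = t\<close>, so \<open>t 3\<close> and \<open>t 0\<close> are
  periodic points of one class and coincide. Three factors of \<open>y\<close> with product 1 would
  give \<open>e 0 + e 1 + e 2\<close> the residue 1; but this sum is the trace of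
  \<open>t + t ^ 2\<close> from the field of eight elements, which vanishes.\<close>

lemma periodic_orbit:
  fixes t y :: "nat \<Rightarrow> complex"
  assumes t: "\<And>j. t (Suc j) = dbl (t j)" and period: "n > 0" "t n = t 0"
    and y: "\<And>j. y (Suc j) = y j * (18 * t j * (1 + t j) / (1 + 4 * t j) ^ 2 - 1)" "y 0 \<noteq> 0"
    and t0: "t 0 \<in> V" "t 0 ^ 8 - t 0 \<in> I"
  shows "t 3 = t 0" "y 3 \<noteq> y 0"
proof -
  have tV: "t j \<in> V" for j by (induction j) (auto simp: t t0 intro: cg_dbl)
  have t8: "cg (t 0 ^ 8) (t 0)" using t0 by (simp add: cg_def)
  have t1: "cg (t 1) (t 0 ^ 4)" using cg_dbl(1)[OF tV[of 0]] by (simp add: t)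
  have "cg (t 2) (t 1 ^ 4)" using cg_dbl(1)[OF tV[of 1]] by (simp add: t numeral_2_eq_2)
  also have "cg (t 1 ^ 4) ((t 0 ^ 4) ^ 4)" by (intro cg_power t1 V_intros tV)
  also have "(t 0 ^ 4) ^ 4 = (t 0 ^ 8) ^ 2" by simp
  also have "cg \<dots> (t 0 ^ 2)" by (intro cg_power t8 tV)
  finally have t2: "cg (t 2) (t 0 ^ 2)" .
  have "cg (t 3) (t 2 ^ 4)" using cg_dbl(1)[OF tV[of 2]] by (simp add: t numeral_3_eq_3 numeral_2_eq_2)
  also have "cg (t 2 ^ 4) ((t 0 ^ 2) ^ 4)" by (intro cg_power t2 V_intros tV)
  also have "(t 0 ^ 2) ^ 4 = t 0 ^ 8" by simp
  also note t8
  finally have t3: "cg (t 3) (t 0)" .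
  \<comment> \<open>Starting at \<open>Suc j\<close> guarantees at least one contraction. After a
    full period the difference reproduces itself times some \<open>i\<close> in \<open>I\<close>,
    and so it is zero.\<close>
  have "\<exists>i\<in>I. t (Suc j + 3) - t (Suc j) = (t 3 - t 0) * i" for j
  proof (induction j)
    case 0
    from t3 obtain i where "i \<in> I" "dbl (t 3) - dbl (t 0) = (t 3 - t 0) * i"
      using dbl_contracts[OF tV tV] by (metis cg_def)
    moreover have "t (Suc 0 + 3) = dbl (t 3)" using t[of 3] by simp
    ultimately show ?case by (auto simp: t[of 0])
  next
    case (Suc j)
    then obtain i where i: "i \<in> I" "t (Suc j + 3) - t (Suc j) = (t 3 - t 0) * i" by blast
    then have "t (Suc j + 3) - t (Suc j) \<in> I" using tV by (simp add: mult_I' diff_V)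
    from dbl_contracts[OF tV tV this] obtain i' where i': "i' \<in> I"
      "dbl (t (Suc j + 3)) - dbl (t (Suc j)) = (t (Suc j + 3) - t (Suc j)) * i'" .
    have "t (Suc (Suc j) + 3) - t (Suc (Suc j)) = (t 3 - t 0) * (i * i')"
      using i'(2) unfolding i(2) t[symmetric] by (simp add: mult.assoc)
    moreover have "i * i' \<in> I" using i i' by (intro mult_I I_V)
    ultimately show ?case by blast
  qed
  from this[of "n - 1"] period(1) obtain i where i: "i \<in> I" "t (n + 3) - t n = (t 3 - t 0) * i" by auto
  have "t (n + k) = t k" for k by (induction k) (simp_all add: period t)
  then have "(t 3 - t 0) * (1 - i) = 0" using i(2) period(2) by (simp add: right_diff_distrib)
  moreover have "1 - i \<noteq> 0" using i(1) one_I by auto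
  ultimately show "t 3 = t 0" by simp

  show "y 3 \<noteq> y 0"
  proof
    assume y30: "y 3 = y 0"
    define e where "e = (\<lambda>j. 9 * t j * (1 + t j) * inverse (1 + 4 * t j) ^ 2)"
    have ye: "y (Suc j) = y j * (2 * e j - 1)" for j
      by (simp add: y e_def divide_inverse power_inverse mult.assoc)
    have e: "cg (e j) (t j + t j ^ 2)" "e j \<in> V" for j
    proof -
      note u = cg_unit[OF cg_one_plus_double[OF tV[of j]]]
      have "cg 9 1" using mult_I[OF two_I numeral_V[of "num.Bit0 (num.Bit0 num.One)"]] by (simp add: cg_def)
      then have k1: "cg (9 * (t j * (1 + t j))) (1 * (t j * (1 + t j)))"
        by (intro cg_mult cg_refl V_intros tV)
      have k2: "cg (inverse (1 + 4 * t j) ^ 2) (1 ^ 2)" by (intro cg_power u one_V)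
      have "cg (9 * (t j * (1 + t j)) * inverse (1 + 4 * t j) ^ 2) (1 * (t j * (1 + t j)) * 1 ^ 2)"
        by (intro cg_mult[OF k1 k2] V_intros tV u)
      then show *: "cg (e j) (t j + t j ^ 2)"
        by (simp add: e_def mult.assoc distrib_left power2_eq_square)
      show "e j \<in> V" by (rule cg_V[OF *]) (intro V_intros tV)
    qed
    have "y 3 = y 0 * ((2 * e 0 - 1) * (2 * e 1 - 1) * (2 * e 2 - 1))"
      using ye[of 0] ye[of 1] ye[of 2] by (simp add: numeral_3_eq_3 numeral_2_eq_2 mult.assoc)
    then have "(2 * e 0 - 1) * (2 * e 1 - 1) * (2 * e 2 - 1) = 1"
      using y30 y(2) by (metis mult_cancel_left1 mult_cancel_left mult.right_neutral)
    \<comment> \<open>Modulo 2 the product is -1 = 1 and says nothing; the exact equality is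
      therefore halved first and reduced afterwards.\<close>
    moreover have "(2 * e 0 - 1) * (2 * e 1 - 1) * (2 * e 2 - 1) = 2 * (e 0 + e 1 + e 2)
        - 2 * (2 * (e 0 * e 1 + e 0 * e 2 + e 1 * e 2 - 2 * e 0 * e 1 * e 2)) - 1"
      by (simp add: algebra_simps)
    ultimately have "2 * (e 0 + e 1 + e 2)
        - 2 * (2 * (e 0 * e 1 + e 0 * e 2 + e 1 * e 2 - 2 * e 0 * e 1 * e 2)) = 2 * 1"
      by (simp only: diff_eq_eq one_add_one mult_1_right)
    then have *: "e 0 + e 1 + e 2 - 2 * (e 0 * e 1 + e 0 * e 2 + e 1 * e 2 - 2 * e 0 * e 1 * e 2) = 1"
      by (simp only: right_diff_distrib [symmetric] mult_cancel_left) simp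
    have "2 * (e 0 * e 1 + e 0 * e 2 + e 1 * e 2 - 2 * e 0 * e 1 * e 2) \<in> I"
      by (intro mult_I two_I V_intros e)
    moreover have "e 0 + e 1 + e 2 - 1 = 2 * (e 0 * e 1 + e 0 * e 2 + e 1 * e 2 - 2 * e 0 * e 1 * e 2)"
      unfolding * [symmetric] by (simp only: diff_diff_eq2 add_diff_cancel_left')
    ultimately have "cg (e 0 + e 1 + e 2) 1" by (simp only: cg_def)
    then have "cg 1 (e 0 + e 1 + e 2)" by (rule cg_sym)
    also have "cg (e 0 + e 1 + e 2) ((t 0 + t 0 ^ 2) + (t 1 + t 1 ^ 2) + (t 2 + t 2 ^ 2))"
      by (intro cg_add e)
    also have "cg \<dots> ((t 0 + t 0 ^ 2) + (t 0 ^ 4 + t 0) + (t 0 ^ 2 + t 0 ^ 4))"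
    proof (intro cg_add cg_refl t1 t2)
      have "cg (t 1 ^ 2) ((t 0 ^ 4) ^ 2)" by (intro cg_power t1 V_intros tV)
      then show "cg (t 1 ^ 2) (t 0)" using t8 by (simp add: power_mult [symmetric]) (rule cg_trans)
      have "cg (t 2 ^ 2) ((t 0 ^ 2) ^ 2)" by (intro cg_power t2 V_intros tV)
      then show "cg (t 2 ^ 2) (t 0 ^ 4)" by simp
    qed
    also have "(t 0 + t 0 ^ 2) + (t 0 ^ 4 + t 0) + (t 0 ^ 2 + t 0 ^ 4) = 2 * (t 0 + t 0 ^ 2 + t 0 ^ 4)"
      by simp
    also have "cg \<dots> 0" by (intro cg_double V_intros tV)
    finally show False using not_cg_one_zero by simp
  qed
qed

end

section \<open>Irrationality by integrality\<close>

lemma rational_root_integer: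
  assumes "ieval h q = 0" "lead_coeff h = 1" "q \<in> \<rat>"
  obtains m where "q = of_int m" "poly h m = 0"
proof -
  have "algebraic_int q"
    unfolding algebraic_int_altdef_ipoly using assms(1,2) by (auto simp: ieval_def)
  then have "q \<in> \<int>" using assms(3) by (rule rational_algebraic_int_is_int)
  then obtain m where m: "q = of_int m" by (auto elim: Ints_cases)
  have "ieval h (of_int m) = of_int (poly h m)" by (induction h) simp_all
  then show thesis using that[OF m] assms(1) m by simp
qed

lemma Rats_cube_ne_4:
  assumes "(q::complex) \<in> \<rat>" shows "q ^ 3 \<noteq> 4"
proof
  assume q: "q ^ 3 = 4"
  obtain m where "poly [:-4, 0, 0, 1:] m = (0::int)"
    by (rule rational_root_integer[of "[:-4, 0, 0, 1:]" q])
      (use assms q in \<open>auto simp: power3_eq_cube mult.assoc\<close>)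
  then have m: "m ^ 3 = 4" by (simp add: power3_eq_cube mult.assoc)
  then have "m > 0" by (metis not_le power_le_zero_eq odd_numeral zero_less_numeral not_less)
  moreover have "m < 2" using m power_mono[of 2 m 3] by (cases "m < 2") auto
  ultimately have "m = 1" by simp
  with m show False by simp
qed

lemma Rats_square_ne_27:
  assumes "(q::complex) \<in> \<rat>" shows "q ^ 2 \<noteq> 27"
proof
  assume q: "q ^ 2 = 27"
  obtain m where "poly [:-27, 0, 1:] m = (0::int)"
    by (rule rational_root_integer[of "[:-27, 0, 1:]" q])
      (use assms q in \<open>auto simp: power2_eq_square\<close>)
  then have m: "\<bar>m\<bar> ^ 2 = 27" by (simp add: power2_eq_square)
  then have "\<bar>m\<bar> < 6" using power_mono[of 6 "\<bar>m\<bar>" 2] by (cases "\<bar>m\<bar> < 6") auto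
  moreover have "\<bar>m\<bar> > 5" using m power_mono[of "\<bar>m\<bar>" 5 2] by (cases "\<bar>m\<bar> > 5") auto
  ultimately show False by simp
qed

text \<open>A rational root would be an integer dividing 1. The name refers to \<open>r - 1\<close>,
  a root of u^3 - 3 u - 1, that is 2 cos(pi/9) or a conjugate: \<open>r\<close> generates the
  maximal real subfield of the field of ninth roots of unity.\<close>

lemma nonagonal_irrational:
  assumes r: "(r::complex) ^ 3 - 3 * r ^ 2 + 1 = 0"
  shows "r \<notin> \<rat>"
proof
  assume "r \<in> \<rat>"
  have "ieval [:1, 0, -3, 1:] r = 0"
    using r by (simp add: power2_eq_square power3_eq_cube algebra_simps)
  from rational_root_integer[OF this _ \<open>r \<in> \<rat>\<close>] obtain m where "poly [:1, 0, -3, 1:] m = (0::int)"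
    by auto
  then have "m * (m * (m - 3)) = - 1" by (simp add: algebra_simps)
  then have "m dvd 1" by (metis dvd_minus_iff dvd_triv_left)
  then have "m = 1 \<or> m = - 1" by auto
  with \<open>m * (m * (m - 3)) = - 1\<close> show False by auto
qed

lemma Rats_ne_root_minus_3_minus_1:
  assumes "(q::complex) \<in> \<rat>" shows "q ^ 3 - 3 * q - 1 \<noteq> 0"
proof
  assume q: "q ^ 3 - 3 * q - 1 = 0"
  have "(q + 1) ^ 3 - 3 * (q + 1) ^ 2 + 1 = q ^ 3 - 3 * q - 1"
    by (simp add: power2_eq_square power3_eq_cube algebra_simps)
  with q have "q + 1 \<notin> \<rat>" by (intro nonagonal_irrational) simp
  with assms show False by auto
qed

context cubic_field
begin

lemma irrational_independent:
  assumes t: "t \<in> K" "t \<notin> \<rat>" and q: "a \<in> \<rat>" "b \<in> \<rat>" "d \<in> \<rat>" "a + b * t + d * t ^ 2 = 0"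
  shows "a = 0" "b = 0" "d = 0"
proof -
  show d: "d = 0" using no_quadratic[OF t(1) q(1-3) _ q(4)] t(2) by blast
  show b: "b = 0"
  proof (rule ccontr)
    assume "b \<noteq> 0"
    then have "t = ((a + b * t + d * t ^ 2) - a) / b" by (simp add: d)
    then have "t = - a / b" unfolding q(4) by simp
    moreover have "- a / b \<in> \<rat>" using q by simp
    ultimately show False using t(2) by simp
  qed
  show "a = 0" using q(4) by (simp add: b d)
qed

text \<open>The field of \<open>r\<close> contains no cube root of 4: writing \<open>r - 1\<close> in the basis \<open>1, s, s^2\<close> with
  \<open>s^3 = 4\<close> and comparing coefficients in \<open>(r - 1)^3 - 3 (r - 1) - 1 = 0\<close> leads to a rational
  number with negative square.\<close>

lemma four_not_cube:
  assumes r: "r \<in> K" "r ^ 3 - 3 * r ^ 2 + 1 = 0"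
  shows "\<not> is_cube_in K 4"
proof
  assume "is_cube_in K 4"
  then obtain s where s: "s \<in> K" "s ^ 3 = 4" by (auto simp: is_cube_in_def)
  have irr: "s \<notin> \<rat>" using Rats_cube_ne_4 s(2) by blast
  define u where "u = r - 1"
  have "u ^ 3 - 3 * u - 1 = r ^ 3 - 3 * r ^ 2 + 1"
    unfolding u_def by (simp add: power2_eq_square power3_eq_cube algebra_simps)
  then have u: "u ^ 3 - 3 * u - 1 = 0" by (simp only: r(2))
  have "u \<in> K" using r by (auto simp: u_def)
  then obtain a b d where q: "a \<in> \<rat>" "b \<in> \<rat>" "d \<in> \<rat>" and u_eq: "u = a + b * s + d * s ^ 2"
    using irrational_generates[OF s(1) irr] by blast
  \<comment> \<open>Coefficients of \<open>u ^ 3 - 3 * u - 1\<close> in the basis 1,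
    \<open>s\<close>, \<open>s ^ 2\<close> after reduction by \<open>s ^ 3 = 4\<close>.\<close>
  define C0 where "C0 = a ^ 3 + 24 * a * b * d + 4 * b ^ 3 + 16 * d ^ 3 - 3 * a - 1"
  define C1 where "C1 = 3 * a ^ 2 * b + 12 * a * d ^ 2 + 12 * b ^ 2 * d - 3 * b"
  define C2 where "C2 = 3 * a ^ 2 * d + 3 * a * b ^ 2 + 12 * b * d ^ 2 - 3 * d"
  have CQ: "C0 \<in> \<rat>" "C1 \<in> \<rat>" "C2 \<in> \<rat>"
    unfolding C0_def C1_def C2_def
    by (intro Rats_add Rats_diff Rats_mult Rats_power Rats_number_of Rats_1 q)+
  have "u ^ 3 - 3 * u - 1 = C0 + C1 * s + C2 * s ^ 2 + (s ^ 3 - 4) *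
      (b ^ 3 + 6 * a * b * d + d ^ 3 * (s ^ 3 + 4) + (3 * b ^ 2 * d + 3 * a * d ^ 2) * s + 3 * b * d ^ 2 * s ^ 2)"
    unfolding u_eq C0_def C1_def C2_def by (simp add: power2_eq_square power3_eq_cube algebra_simps)
  then have "C0 + C1 * s + C2 * s ^ 2 = 0" unfolding u s(2) by simp
  note C = irrational_independent[OF s(1) irr CQ this]
  have cube_ratio: "b = 0 \<and> d = 0" if "b ^ 3 = 4 * d ^ 3"
  proof (cases "d = 0")
    case False
    then have "(b / d) ^ 3 = 4" using that by (simp add: power_divide)
    moreover have "b / d \<in> \<rat>" using q by simp
    ultimately show ?thesis using Rats_cube_ne_4 by blast
  qed (use that in simp)
  have nz: "\<not> (b = 0 \<and> d = 0)"
  proof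
    assume "b = 0 \<and> d = 0"
    then have "a ^ 3 - 3 * a - 1 = 0" using C(1) by (simp add: C0_def)
    with Rats_ne_root_minus_3_minus_1[OF q(1)] show False by simp
  qed
  \<comment> \<open>In this combination every term without the factor \<open>a\<close> cancels. As 4
    is no rational cube, \<open>b ^ 3 = 4 * d ^ 3\<close> is impossible here, so
    \<open>a = 0\<close>.\<close>
  have "3 * a * (4 * d ^ 3 - b ^ 3) = d * C1 - b * C2"
    unfolding C1_def C2_def by (simp add: power2_eq_square power3_eq_cube algebra_simps)
  then have "a = 0 \<or> b ^ 3 = 4 * d ^ 3" using C by auto
  with cube_ratio nz have a: "a = 0" by blast
  have "3 * b * (4 * b * d - 1) = C1" "3 * d * (4 * b * d - 1) = C2"
    unfolding C1_def C2_def a by (simp_all add: power2_eq_square power3_eq_cube algebra_simps)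
  then have bd: "4 * b * d = 1" using C nz by auto
  have "4 * b ^ 3 + 16 * d ^ 3 = 1" using C(1) unfolding C0_def a by simp
  \<comment> \<open>With \<open>4 * b * d = 1\<close> the relation
    \<open>4 * b ^ 3 + 16 * d ^ 3 = 1\<close> becomes a quadratic equation for \<open>b ^ 3\<close>;
    completing the square leaves -3.\<close>
  moreover have "(8 * b ^ 3 - 1) ^ 2 = 16 * b ^ 3 * (4 * b ^ 3 + 16 * d ^ 3) - 4 * (4 * b * d) ^ 3 - 16 * b ^ 3 + 1"
    by (simp add: power2_eq_square power3_eq_cube algebra_simps)
  ultimately have "(8 * b ^ 3 - 1) ^ 2 = of_real (- 3)" unfolding bd by simp
  moreover have "8 * b ^ 3 - 1 \<in> \<rat>" using q by simp
  ultimately show False using Rats_square_ne_negative[of "8 * b ^ 3 - 1" "- 3"] by simp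
qed

text \<open>Supplies a prime above 2 to the local argument. The leading coefficient of the minimal
  polynomial \<open>f\<close> is shown to be odd, which is 2-integrality of \<open>t 0\<close>; then
  \<open>f\<close> modulo 2 decides at which ideal (2, g) to localise.\<close>

lemma periodic_orbit:
  fixes t y :: "nat \<Rightarrow> complex"
  assumes K: "t 0 \<in> K"
    and t: "\<And>j. t (Suc j) = dbl (t j)" and period: "n > 0" "t n = t 0"
    and y: "\<And>j. y (Suc j) = y j * (18 * t j * (1 + t j) / (1 + 4 * t j) ^ 2 - 1)" "y 0 \<noteq> 0"
  shows "t 3 = t 0 \<and> y 3 \<noteq> y 0"
proof -
  obtain f where deg: "degree f = 1 \<or> degree f = 3" and root: "ieval f (t 0) = 0"
    and min: "\<And>h. ieval h (t 0) = 0 \<Longrightarrow> f dvd h"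
    using ex_minimal_int_poly[OF K] by blast
  have "\<exists>h. odd (lead_coeff h) \<and> ieval h (t 0) = 0"
  proof (cases "t 0 = 0")
    case True
    then show ?thesis by (intro exI[of _ "[:0, 1:]"]) simp
  next
    case False
    have "inverse (t 0) \<in> K" using K by auto
    from ex_minimal_int_poly[OF this] obtain p where degp: "degree p = 1 \<or> degree p = 3"
      and rootp: "ieval p (inverse (t 0)) = 0"
      and minp: "\<And>h. ieval h (inverse (t 0)) = 0 \<Longrightarrow> p dvd h" by blast
    \<comment> \<open>An even constant term would allow localising at (2, X), with
      \<open>inverse (t 0)\<close> in \<open>I\<close>: a pole on a periodic orbit.\<close>
    have "odd (coeff p 0)"
    proof
      assume "even (coeff p 0)"
      then obtain m where m: "coeff p 0 = 2 * m" by blast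
      obtain p0 p' where "p = pCons p0 p'" by (cases p)
      then have "p = smult 2 [:m:] + [:0, 1:] * p'" using m by simp
      then have "p \<in> poly_ideal_2 [:0, 1:]" unfolding poly_ideal_2_def by blast
      moreover have "odd (lead_coeff [:0, 1 :: int:])" "degree [:0, 1 :: int:] > 0" by simp_all
      ultimately obtain V I where VI: "two_adic V I"
        "\<And>h. h \<in> poly_ideal_2 [:0, 1:] \<Longrightarrow> ieval h (inverse (t 0)) \<in> I"
        using ex_two_adic[of "inverse (t 0)" p "[:0, 1:]", OF minp] by metis
      interpret two_adic V I by fact
      have "inverse (t 0) \<in> I" using VI(2)[OF poly_ideal_2_generators(3)] by simp
      from no_pole_on_periodic_orbit[OF t period False this] show False .
    qed
    \<comment> \<open>Reversing the coefficients passes from \<open>inverse (t 0)\<close> to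
      \<open>t 0\<close>.\<close>
    moreover have "\<exists>h. lead_coeff h = coeff p 0 \<and> ieval h (t 0) = 0"
    proof (cases "degree p = 1")
      case True
      obtain a0 a1 where p: "p = [:a0, a1:]" using poly_degree_1_explicit[OF True] by blast
      have "ieval [:a1, a0:] (t 0) = t 0 * ieval p (inverse (t 0))"
        using False by (simp add: p algebra_simps)
      moreover have "a0 \<noteq> 0" using \<open>odd (coeff p 0)\<close> by (auto simp: p)
      ultimately show ?thesis using rootp by (intro exI[of _ "[:a1, a0:]"]) (simp add: p)
    next
      case d3: False
      then obtain a0 a1 a2 a3 where p: "p = [:a0, a1, a2, a3:]"
        using poly_degree_3_explicit degp by blast
      have "ieval [:a3, a2, a1, a0:] (t 0) = t 0 ^ 3 * ieval p (inverse (t 0))"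
        using False by (simp add: p algebra_simps power3_eq_cube)
      moreover have "a0 \<noteq> 0" using \<open>odd (coeff p 0)\<close> by (auto simp: p)
      ultimately show ?thesis using rootp by (intro exI[of _ "[:a3, a2, a1, a0:]"]) (simp add: p)
    qed
    ultimately show ?thesis by metis
  qed
  then obtain h where h: "odd (lead_coeff h)" "ieval h (t 0) = 0" by blast
  obtain q where "h = f * q" using min[OF h(2)] by (elim dvdE)
  then have oddf: "odd (lead_coeff f)" using h(1) by (simp add: lead_coeff_mult)
  define F where "F = ([:0, -1, 0, 0, 0, 0, 0, 0, 1:] :: int poly)"
  have F: "ieval F z = z ^ 8 - z" for z by (simp add: F_def algebra_simps numeral_eq_Suc)
  \<comment> \<open>If \<open>f\<close> has a root \<open>k\<close> modulo 2, take g = X - k, with a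
    residue field of two elements. Otherwise \<open>f\<close> is an irreducible cubic modulo 2 and
    serves as \<open>g\<close> itself, with a residue field of eight elements.\<close>
  have "\<exists>g. odd (lead_coeff g) \<and> degree g > 0 \<and> f \<in> poly_ideal_2 g \<and> F \<in> poly_ideal_2 g"
  proof (cases "\<exists>k\<in>{0, 1}. even (poly f k)")
    case True
    then obtain k m where k: "k \<in> {0, 1}" "poly f k = 2 * m" by (auto elim!: evenE)
    have "f = smult 2 [:m:] + [:- k, 1:] * synthetic_div f k"
      using synthetic_div_correct'[of k f] k by (simp add: add.commute)
    then have "f \<in> poly_ideal_2 [:- k, 1:]" unfolding poly_ideal_2_def by blast
    moreover have "poly F k = 0" using k by (auto simp: F_def)
    then have "F = smult 2 0 + [:- k, 1:] * synthetic_div F k"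
      using synthetic_div_correct'[of k F] by simp
    then have "F \<in> poly_ideal_2 [:- k, 1:]" unfolding poly_ideal_2_def by blast
    ultimately show ?thesis by (intro exI[of _ "[:- k, 1:]"]) simp
  next
    case False
    then have o: "odd (poly f 0)" "odd (poly f 1)" by auto
    have "degree f \<noteq> 1"
    proof
      assume "degree f = 1"
      from poly_degree_1_explicit[OF this] obtain a0 a1 where "f = [:a0, a1:]" by blast
      with o oddf \<open>degree f = 1\<close> show False by (auto split: if_splits)
    qed
    with deg have d3: "degree f = 3" by simp
    then obtain a b c d where f: "f = [:a, b, c, d:]" using poly_degree_3_explicit by blast
    with d3 have "d \<noteq> 0" by (auto split: if_splits)
    then have odds: "odd a" "odd d" "odd (b + c)" using o oddf f by auto
    \<comment> \<open>Modulo 2, \<open>f\<close> is X^3 + X + 1 or X^3 + X^2 + 1, both factors of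
      X^8 - X; \<open>B\<close> is the cofactor, and \<open>A\<close> collects what is divisible by
      2.\<close>
    have "\<exists>A B. F = smult 2 A + f * B"
    proof (cases "odd b")
      case True
      obtain a' b' c' d' where e: "a = 2 * a' + 1" "b = 2 * b' + 1" "c = 2 * c'" "d = 2 * d' + 1"
        using odds True by (metis evenE oddE even_add)
      have "f = [:1, 1, 0, 1:] + smult 2 [:a', b', c', d':]" by (simp add: f e)
      then have "F = smult 2 ([:0, -1, -1, -1, -1, -1, -1:] - [:a', b', c', d':] * [:0, 1, 1, 1, 0, 1:])
          + f * [:0, 1, 1, 1, 0, 1:]"
        by (simp add: F_def algebra_simps)
      then show ?thesis by blast
    next
      case False
      obtain a' b' c' d' where e: "a = 2 * a' + 1" "b = 2 * b'" "c = 2 * c' + 1" "d = 2 * d' + 1"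
        using odds False by (metis evenE oddE even_add)
      have "f = [:1, 0, 1, 1:] + smult 2 [:a', b', c', d':]" by (simp add: f e)
      then have "F = smult 2 ([:0, -1, 0, -1, -1, -1, -1, -1:] - [:a', b', c', d':] * [:0, 1, 0, 1, 1, 1:])
          + f * [:0, 1, 0, 1, 1, 1:]"
        by (simp add: F_def algebra_simps)
      then show ?thesis by blast
    qed
    then have "F \<in> poly_ideal_2 f" by (auto simp: poly_ideal_2_def)
    then show ?thesis using oddf d3 poly_ideal_2_generators(3)[of f] by (intro exI[of _ f]) simp
  qed
  then obtain g where g: "odd (lead_coeff g)" "degree g > 0" "f \<in> poly_ideal_2 g" "F \<in> poly_ideal_2 g" by blast
  obtain V I where VI: "two_adic V I" "t 0 \<in> V" "\<And>h. h \<in> poly_ideal_2 g \<Longrightarrow> ieval h (t 0) \<in> I"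
    using ex_two_adic[of "t 0" f g, OF min g(1-3)] by blast
  interpret two_adic V I by fact
  have "t 0 ^ 8 - t 0 \<in> I" using VI(3)[OF g(4)] by (simp add: F)
  then show ?thesis using periodic_orbit[OF t period y VI(2)] by simp
qed

end

section \<open>Torsion points\<close>

text \<open>Comparing coefficients from the top determines the quotient and leaves three equations
  in \<open>a\<close>, \<open>b\<close>, \<open>d\<close>. They have no solution modulo 5:
  \<open>e5\<close> to \<open>e0\<close> run the same recursion on residues, so only 25 residue
  pairs and two signs remain to be checked.\<close>

lemma nonic_no_cubic_factor:
  fixes a b d :: int
  assumes d: "d = 1 \<or> d = - 1"
  shows "\<not> [:d, b, a, 1:] dvd [:1, 0, 9, 3, 0, 18, -24, 0, 9, 1:]"
proof
  let ?f = "[:d, b, a, 1:]" and ?g = "[:1, 0, 9, 3, 0, 18, -24, 0, 9, 1:] :: int poly"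
  assume "?f dvd ?g"
  then obtain q where q: "?g = ?f * q" by (elim dvdE)
  have "degree (?f * q) = 3 + degree q"
    by (subst degree_mult_eq) (use q in auto)
  moreover have "degree (?f * q) = 9" unfolding q [symmetric] by simp
  ultimately have "degree q = 6" by simp
  then have "q = [:coeff q 0, coeff q 1, coeff q 2, coeff q 3, coeff q 4, coeff q 5, coeff q 6:]"
    by (intro poly_eqI) (auto simp: coeff_pCons coeff_eq_0 numeral_eq_Suc split: nat.splits)
  then obtain c0 c1 c2 c3 c4 c5 c6 where q': "q = [:c0, c1, c2, c3, c4, c5, c6:]" by blast
  have raw: "c6 = 1" "c5 + a * c6 = 9" "c4 + a * c5 + b * c6 = 0" "c3 + a * c4 + b * c5 + d * c6 = - 24"
    "c2 + a * c3 + b * c4 + d * c5 = 18" "c1 + a * c2 + b * c3 + d * c4 = 0" "c0 + a * c1 + b * c2 + d * c3 = 3"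
    "a * c0 + b * c1 + d * c2 = 9" "b * c0 + d * c1 = 0" "d * c0 = 1"
    using q unfolding q' by (auto simp: algebra_simps)
  have eqs: "c6 = 1" "c5 = 9 - a * c6" "c4 = - a * c5 - b * c6" "c3 = - 24 - a * c4 - b * c5 - d * c6"
    "c2 = 18 - a * c3 - b * c4 - d * c5" "c1 = - a * c2 - b * c3 - d * c4" "c0 = 3 - a * c1 - b * c2 - d * c3"
    "9 - a * c0 - b * c1 - d * c2 = 0" "- b * c0 - d * c1 = 0" "1 - d * c0 = 0"
    using raw by linarith+
  define a' b' where "a' = a mod 5" and "b' = b mod 5"
  have ab: "[a = a'] (mod 5)" "[b = b'] (mod 5)" by (simp_all add: a'_def b'_def cong_def)
  define e5 where "e5 = 9 - a'"
  define e4 where "e4 = - a' * e5 - b'"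
  define e3 where "e3 = - 24 - a' * e4 - b' * e5 - d"
  define e2 where "e2 = 18 - a' * e3 - b' * e4 - d * e5"
  define e1 where "e1 = - a' * e2 - b' * e3 - d * e4"
  define e0 where "e0 = 3 - a' * e1 - b' * e2 - d * e3"
  note e_defs = e0_def e1_def e2_def e3_def e4_def e5_def
  have uminus: "[- x = - y] (mod 5)" if "[x = y] (mod 5)" for x y :: int
    using that by (simp add: cong_minus_minus_iff)
  have k5: "[c5 = e5] (mod 5)" unfolding eqs(2) eqs(1) e5_def
    by (simp, intro cong_diff cong_refl ab)
  have k4: "[c4 = e4] (mod 5)" unfolding eqs(3) eqs(1) e4_def
    by (simp only: mult_1_right, intro cong_diff cong_mult uminus cong_refl ab k5)
  have k3: "[c3 = e3] (mod 5)" unfolding eqs(4) eqs(1) e3_def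
    by (simp only: mult_1_right, intro cong_diff cong_mult uminus cong_refl ab k5 k4)
  have k2: "[c2 = e2] (mod 5)" unfolding eqs(5) e2_def
    by (intro cong_diff cong_mult uminus cong_refl ab k5 k4 k3)
  have k1: "[c1 = e1] (mod 5)" unfolding eqs(6) e1_def
    by (intro cong_diff cong_mult uminus cong_refl ab k5 k4 k3 k2)
  have k0: "[c0 = e0] (mod 5)" unfolding eqs(7) e0_def
    by (intro cong_diff cong_mult uminus cong_refl ab k5 k4 k3 k2 k1)
  have "[9 - a * c0 - b * c1 - d * c2 = 9 - a' * e0 - b' * e1 - d * e2] (mod 5)"
    by (intro cong_diff cong_mult uminus cong_refl ab k2 k1 k0)
  then have r2: "(9 - a' * e0 - b' * e1 - d * e2) mod 5 = 0" unfolding eqs(8) by (simp add: cong_def)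
  have "[- b * c0 - d * c1 = - b' * e0 - d * e1] (mod 5)"
    by (intro cong_diff cong_mult uminus cong_refl ab k1 k0)
  then have r1: "(- b' * e0 - d * e1) mod 5 = 0" unfolding eqs(9) by (simp add: cong_def)
  have "[1 - d * c0 = 1 - d * e0] (mod 5)"
    by (intro cong_diff cong_mult cong_refl k0)
  then have r0: "(1 - d * e0) mod 5 = 0" unfolding eqs(10) by (simp add: cong_def)
  have "a' \<in> {0, 1, 2, 3, 4}" "b' \<in> {0, 1, 2, 3, 4}"
    unfolding a'_def b'_def by auto
  then show False
    using d r0 r1 r2 unfolding e_defs by (elim insertE emptyE disjE) simp_all
qed

text \<open>A root in \<open>K\<close> has a minimal polynomial of degree 1 or 3 dividing the nonic,
  whose outer coefficients 1 make this factor monic with constant term 1 or -1, up to sign.\<close>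

lemma (in cubic_field) nonic_no_root:
  assumes t: "t \<in> K"
  shows "t ^ 9 + 9 * t ^ 8 - 24 * t ^ 6 + 18 * t ^ 5 + 3 * t ^ 3 + 9 * t ^ 2 + 1 \<noteq> 0"
proof
  assume eq: "t ^ 9 + 9 * t ^ 8 - 24 * t ^ 6 + 18 * t ^ 5 + 3 * t ^ 3 + 9 * t ^ 2 + 1 = 0"
  define g where "g = ([:1, 0, 9, 3, 0, 18, -24, 0, 9, 1:] :: int poly)"
  have "ieval g t = t ^ 9 + 9 * t ^ 8 - 24 * t ^ 6 + 18 * t ^ 5 + 3 * t ^ 3 + 9 * t ^ 2 + 1"
    by (simp add: g_def algebra_simps numeral_eq_Suc)
  then have root: "ieval g t = 0" by (simp only: eq)
  obtain f where deg: "degree f = 1 \<or> degree f = 3" and min: "\<And>h. ieval h t = 0 \<Longrightarrow> f dvd h"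
    using ex_minimal_int_poly[OF t] by blast
  obtain q where q: "g = f * q" using min[OF root] by (elim dvdE)
  have "lead_coeff f * lead_coeff q = lead_coeff g" by (simp add: q lead_coeff_mult)
  then have "lead_coeff f * lead_coeff q = 1" by (simp add: g_def)
  then have lead: "lead_coeff f = 1 \<or> lead_coeff f = - 1" using zmult_eq_1_iff by blast
  define F where "F = smult (lead_coeff f) f"
  have F_dvd: "F dvd g" using lead q by (auto simp: F_def)
  have F_lead: "lead_coeff F = 1" using lead by (auto simp: F_def)
  have F_deg: "degree F = 1 \<or> degree F = 3" using deg lead by (auto simp: F_def)
  obtain q' where q': "g = F * q'" using F_dvd by (elim dvdE)
  have "coeff F 0 * coeff q' 0 = 1"
    using arg_cong[OF q', of "\<lambda>p. coeff p 0"] by (simp add: coeff_mult g_def)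
  then have F_0: "coeff F 0 = 1 \<or> coeff F 0 = - 1" using zmult_eq_1_iff by blast
  from F_deg show False
  proof
    assume d: "degree F = 1"
    then have "F = [:coeff F 0, 1:]" using poly_degree_1_explicit[OF d] F_lead by (simp only: d)
    then have "[:- (- coeff F 0), 1:] dvd g" using F_dvd by simp
    then have "poly g (- coeff F 0) = 0" by (simp only: poly_eq_0_iff_dvd)
    with F_0 show False by (auto simp: g_def)
  next
    assume d: "degree F = 3"
    then have "F = [:coeff F 0, coeff F 1, coeff F 2, 1:]" using poly_degree_3_explicit[OF d] F_lead by (simp only: d)
    with nonic_no_cubic_factor[OF F_0] F_dvd show False unfolding g_def by metis
  qed
qed

lemma (in group) pow_mod:
  assumes "x \<in> carrier G" "x [^] (n::nat) = \<one>"
  shows "x [^] (k mod n) = x [^] k"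
proof -
  have "x [^] k = x [^] (n * (k div n) + k mod n)" by simp
  also have "\<dots> = (x [^] n) [^] (k div n) \<otimes> x [^] (k mod n)"
    using assms(1) by (simp only: nat_pow_mult [symmetric] nat_pow_pow [symmetric] nat_pow_closed)
  finally show ?thesis using assms by simp
qed

lemma (in group) torsion_cyclic_iso:
  assumes g: "g \<in> carrier G" "ord g = n" "n > 0"
    and gen: "\<And>x. x \<in> carrier (torsion_subgroup G) \<Longrightarrow> \<exists>k::nat. x = g [^] k"
  shows "torsion_subgroup G \<cong> integer_mod_group n"
proof -
  let ?T = "torsion_subgroup G"
  have gn: "g [^] n = \<one>" using g pow_ord_eq_1 by blast
  have pow_T: "g [^] k \<in> carrier ?T" for k :: nat
  proof -
    have "(g [^] k) [^] n = (g [^] n) [^] k" using g(1) by (simp add: nat_pow_pow mult.commute)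
    then have "(g [^] k) [^] n = \<one>" by (simp add: gn)
    then show ?thesis using g by (auto simp: torsion_subgroup_def)
  qed
  have "(\<lambda>i. g [^] nat i) \<in> iso (integer_mod_group n) ?T"
    unfolding iso_def
  proof (intro CollectI conjI homI)
    show "g [^] nat i \<in> carrier ?T" for i by (rule pow_T)
    show "g [^] nat (i \<otimes>\<^bsub>integer_mod_group n\<^esub> j) = g [^] nat i \<otimes>\<^bsub>?T\<^esub> g [^] nat j"
      if "i \<in> carrier (integer_mod_group n)" "j \<in> carrier (integer_mod_group n)" for i j
    proof -
      have ij: "i \<ge> 0" "j \<ge> 0" using that g(3) by (auto simp: carrier_integer_mod_group)
      have "nat ((i + j) mod int n) = (nat i + nat j) mod n"
        using ij by (simp add: nat_mod_distrib nat_add_distrib)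
      then show ?thesis
        using g(1) by (simp add: pow_mod[OF g(1) gn] torsion_subgroup_def nat_pow_mult)
    qed
    show "bij_betw (\<lambda>i. g [^] nat i) (carrier (integer_mod_group n)) (carrier ?T)"
      unfolding bij_betw_def
    proof
      show "inj_on (\<lambda>i. g [^] nat i) (carrier (integer_mod_group n))"
      proof (rule linorder_inj_onI')
        fix i j :: int
        assume ij: "i \<in> carrier (integer_mod_group n)" "j \<in> carrier (integer_mod_group n)" "i < j"
        then have b: "0 \<le> i" "j < int n" using g(3) by (auto simp: carrier_integer_mod_group)
        show "g [^] nat i \<noteq> g [^] nat j"
        proof
          assume "g [^] nat i = g [^] nat j"
          then have "g [^] (nat j - nat i) = \<one>" using g(1) pow_eq_div2[of g "nat j" "nat i"] by simp
          then have "n dvd nat j - nat i" using g pow_eq_id by blast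
          then show False using b ij(3) by (auto dest: dvd_imp_le)
        qed
      qed
      show "(\<lambda>i. g [^] nat i) ` carrier (integer_mod_group n) = carrier ?T"
      proof
        show "carrier ?T \<subseteq> (\<lambda>i. g [^] nat i) ` carrier (integer_mod_group n)"
        proof
          fix x assume "x \<in> carrier ?T"
          then obtain k :: nat where "x = g [^] k" using gen by blast
          then have "x = g [^] nat (int (k mod n))" by (simp add: pow_mod[OF g(1) gn])
          moreover have "int (k mod n) \<in> carrier (integer_mod_group n)"
            using g(3) by (simp add: carrier_integer_mod_group)
          ultimately show "x \<in> (\<lambda>i. g [^] nat i) ` carrier (integer_mod_group n)" by blast
        qed
      qed (use pow_T in auto)
    qed
  qed
  then have "integer_mod_group n \<cong> ?T" by (rule is_isoI)
  then show ?thesis by (rule group.iso_sym[OF group_integer_mod_group])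
qed

lemma ex_odd_part:
  fixes n :: nat
  assumes "n > 0"
  shows "\<exists>a m. n = 2 ^ a * m \<and> odd m"
  using assms
proof (induction n rule: less_induct)
  case (less n)
  show ?case
  proof (cases "odd n")
    case False
    then obtain k where k: "n = 2 * k" by blast
    with less obtain a m where "k = 2 ^ a * m" "odd m" by (metis mult_2 nat_0_less_mult_iff less_add_same_cancel1)
    then show ?thesis using k by (intro exI[of _ "Suc a"] exI[of _ m]) simp
  qed (use less in \<open>intro exI[of _ 0] exI[of _ n], simp\<close>)
qed

locale mordell_cubic = cubic_field K + mordell K c G
  for K :: "complex set" and c :: complex and G (structure)
begin

lemma double_Affine:
  assumes "Affine x y \<in> carrier G" "y \<noteq> 0"
  shows "Affine x y [^] (2::nat) =
    Affine (x * (x ^ 3 / (4 * c) - 2) / (1 + 4 * (x ^ 3 / (4 * c))))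
      (y * (18 * (x ^ 3 / (4 * c)) * (1 + x ^ 3 / (4 * c)) / (1 + 4 * (x ^ 3 / (4 * c))) ^ 2 - 1))"
  using assms mordell_double[of c y x] c_nonzero by (simp add: pow_2 Affine_mem del: ec_add.simps)

lemma double_eq_one_iff:
  assumes "P \<in> carrier G"
  shows "P [^] (2::nat) = \<one> \<longleftrightarrow> P = \<one> \<or> (\<exists>x. P = Affine x 0)"
proof (cases P)
  case (Affine x y)
  show ?thesis
  proof (cases "y = 0")
    case True
    then show ?thesis using assms by (simp add: Affine pow_2 one_eq)
  next
    case False
    then show ?thesis using double_Affine[of x y] assms by (simp add: Affine one_eq)
  qed
qed (use assms in \<open>simp add: pow_2 one_eq\<close>)

lemma odd_torsion:
  assumes P: "P \<in> carrier G" and n: "P [^] (n::nat) = \<one>" "odd n"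
  shows "P [^] (9::nat) = \<one>"
proof (cases "P = \<one>")
  case False
  define Q where "Q = (\<lambda>j::nat. P [^] ((2::nat) ^ j))"
  have QG: "Q j \<in> carrier G" for j using P by (simp add: Q_def)
  have Q_Suc: "Q (Suc j) = Q j [^] (2::nat)" for j
    using P by (simp add: Q_def group.nat_pow_pow mult.commute)
  have Q_nz: "Q j \<noteq> \<one>" for j
  proof
    assume "Q j = \<one>"
    then have "group.ord P dvd 2 ^ j" "group.ord P dvd n"
      using P n group.pow_eq_id by (auto simp: Q_def)
    moreover have "coprime (2 ^ j) n" using n(2) by simp
    ultimately have "group.ord P dvd 1" by (metis coprime_common_divisor)
    then have "P [^] (1::nat) = \<one>" using P group.pow_eq_id by blast
    with False P show False by simp
  qed
  define x where "x = (\<lambda>j. case Q j of Affine u v \<Rightarrow> u | Infinity \<Rightarrow> 0)"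
  define y where "y = (\<lambda>j. case Q j of Affine u v \<Rightarrow> v | Infinity \<Rightarrow> 0)"
  have Q: "Q j = Affine (x j) (y j)" for j
    using Q_nz[of j] by (cases "Q j") (auto simp: x_def y_def one_eq)
  have mem: "Affine (x j) (y j) \<in> carrier G" for j using QG[of j] by (simp add: Q)
  have y_nz: "y j \<noteq> 0" for j
  proof
    assume "y j = 0"
    then have "\<exists>x. Q j = Affine x 0" using Q[of j] by auto
    then have "Q (Suc j) = \<one>" unfolding Q_Suc double_eq_one_iff[OF QG] by blast
    then show False using Q_nz by blast
  qed
  define t where "t = (\<lambda>j. x j ^ 3 / (4 * c))"
  have "Affine (x (Suc j)) (y (Suc j)) =
    Affine (x j * (t j - 2) / (1 + 4 * t j)) (y j * (18 * t j * (1 + t j) / (1 + 4 * t j) ^ 2 - 1))" for j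
    using double_Affine[OF mem y_nz, of j] unfolding Q [symmetric] Q_Suc [symmetric] t_def .
  then have x_Suc: "x (Suc j) = x j * (t j - 2) / (1 + 4 * t j)"
    and y_Suc: "y (Suc j) = y j * (18 * t j * (1 + t j) / (1 + 4 * t j) ^ 2 - 1)" for j
    by auto
  have t_Suc: "t (Suc j) = dbl (t j)" for j
    unfolding dbl_def by (simp add: t_def x_Suc power_divide power_mult_distrib)
  have "n > 0" using n(2) by (auto intro: Nat.gr0I)
  then have "totient n > 0" by simp
  have "coprime 2 n" using n(2) by simp
  \<comment> \<open>Euler's theorem makes doubling periodic on points of odd order, with period
    \<open>totient n\<close>.\<close>
  then have "[2 ^ totient n = 1] (mod n)" by (rule euler_theorem)
  then have "Q (totient n) = P [^] (1::nat)"
    unfolding Q_def using group.pow_mod[OF P n(1)] by (metis cong_def)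
  then have "Q (totient n) = Q 0" using P by (simp add: Q_def)
  then have "t (totient n) = t 0" by (simp add: t_def Q)
  have x0: "x 0 \<in> K" and x3: "x 3 \<in> K" using mem Affine_mem by blast+
  then have "t 0 \<in> K" by (simp add: t_def)
  from periodic_orbit[of t, OF this t_Suc \<open>totient n > 0\<close> \<open>t (totient n) = t 0\<close> y_Suc y_nz]
  have "t 3 = t 0" "y 3 \<noteq> y 0" by auto
  then have "x 3 ^ 3 = x 0 ^ 3" using c_nonzero by (simp add: t_def)
  \<comment> \<open>Injectivity of cubing lifts \<open>t 3 = t 0\<close> to the abscissae, so 8 P is
    P or -P, and the ordinates decide.\<close>
  then have "x 3 = x 0" by (rule cube_inj[OF x3 x0])
  moreover have "y 3 ^ 2 = y 0 ^ 2"
    using mem[of 3] mem[of 0] \<open>x 3 ^ 3 = x 0 ^ 3\<close> by (simp add: Affine_mem)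
  then have "y 3 = - y 0" using \<open>y 3 \<noteq> y 0\<close> by (simp add: power2_eq_iff)
  ultimately have "Q 3 = inv (Q 0)" using QG[of 0] by (simp add: inv_eq Q)
  then have "P [^] (8::nat) = inv P" using P by (simp add: Q_def)
  then have "P [^] (8::nat) \<otimes> P [^] (1::nat) = \<one>" using P by simp
  then show ?thesis using P by (simp only: group.nat_pow_mult) simp
qed simp

lemma four_torsion:
  assumes P: "P \<in> carrier G" and P4: "P [^] (4::nat) = \<one>"
  shows "P [^] (2::nat) = \<one>"
proof (rule ccontr)
  assume ne: "P [^] (2::nat) \<noteq> \<one>"
  then obtain x y where xy: "P = Affine x y" "y \<noteq> 0"
    using double_eq_one_iff[OF P] by (cases P) (auto simp: one_eq)
  define t where "t = x ^ 3 / (4 * c)"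
  have mem: "Affine x y \<in> carrier G" using P xy by simp
  have t: "1 + 4 * t \<noteq> 0" using mordell_double(2)[of c y x] xy mem c_nonzero by (simp add: t_def Affine_mem)
  have "(P [^] (2::nat)) [^] (2::nat) = \<one>" using P P4 by (simp add: group.nat_pow_pow)
  then obtain x' where "P [^] (2::nat) = Affine x' 0"
    using double_eq_one_iff[of "P [^] (2::nat)"] P ne by auto
  then have "y * (18 * t * (1 + t) / (1 + 4 * t) ^ 2 - 1) = 0"
    using double_Affine[OF mem xy(2)] by (simp add: xy(1) t_def)
  then have "18 * t * (1 + t) = (1 + 4 * t) ^ 2" using xy(2) t by simp
  \<comment> \<open>A vanishing ordinate of 2 P amounts to
    \<open>2 * t ^ 2 + 10 * t - 1 = 0\<close>; completing the square produces 27.\<close>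
  moreover have "(2 * t + 5) ^ 2 - 27 = 2 * (18 * t * (1 + t) - (1 + 4 * t) ^ 2)"
    by (simp add: power2_eq_square algebra_simps)
  ultimately have "(2 * t + 5) ^ 2 = 27" by simp
  moreover have "2 * t + 5 \<in> K" using mem by (auto simp: t_def Affine_mem)
  ultimately show False using square_rational[of "2 * t + 5"] Rats_square_ne_27[of "2 * t + 5"] by simp
qed

lemma two_power_torsion:
  assumes P: "P \<in> carrier G" and "P [^] ((2::nat) ^ Suc a) = \<one>"
  shows "P [^] (2::nat) = \<one>"
  using assms(2)
proof (induction a)
  case (Suc a)
  have "(P [^] ((2::nat) ^ a)) [^] (4::nat) = \<one>"
    using Suc.prems P by (simp add: group.nat_pow_pow mult.commute)
  then have "(P [^] ((2::nat) ^ a)) [^] (2::nat) = \<one>" using P by (intro four_torsion) auto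
  then show ?case using Suc.IH P by (simp add: group.nat_pow_pow mult.commute)
qed simp

lemma torsion_18:
  assumes P: "P \<in> carrier G" and n: "P [^] (n::nat) = \<one>" "n > 0"
  shows "P [^] (18::nat) = \<one>"
proof -
  obtain a m where am: "n = 2 ^ a * m" "odd m"
    using ex_odd_part[OF n(2)] by blast
  have "(P [^] ((2::nat) ^ a)) [^] m = \<one>" using n P by (simp add: am group.nat_pow_pow)
  then have "(P [^] ((2::nat) ^ a)) [^] (9::nat) = \<one>" using P am by (intro odd_torsion) auto
  then have "(P [^] (9::nat)) [^] ((2::nat) ^ a) = \<one>" using P by (simp add: group.nat_pow_pow mult.commute)
  then have "((P [^] (9::nat)) [^] ((2::nat) ^ a)) [^] (2::nat) = \<one>" by simp
  then have "(P [^] (9::nat)) [^] ((2::nat) ^ Suc a) = \<one>" using P by (simp add: group.nat_pow_pow mult.commute)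
  then have "(P [^] (9::nat)) [^] (2::nat) = \<one>" using P by (intro two_power_torsion) auto
  then show ?thesis using P by (simp add: group.nat_pow_pow)
qed

end

section \<open>Points of order nine\<close>

lemma adjoin_rat_subset:
  assumes "subfield K complex_ring" "r \<in> K"
  shows "adjoin_rat r \<subseteq> K"
proof -
  interpret complex_subfield K by (rule complex_subfield.intro) fact
  show ?thesis unfolding adjoin_rat_def
    by (rule field.generate_field_min_subfield1[OF field_complex_ring]) (use assms in auto)
qed

lemma subfield_adjoin_rat: "subfield (adjoin_rat r) complex_ring"
  unfolding adjoin_rat_def by (rule field.generate_field_is_subfield[OF field_complex_ring]) simp

lemma mem_adjoin_rat: "r \<in> adjoin_rat r"
  unfolding adjoin_rat_def by (rule generate_field.incl) simp

lemma (in cubic_field) eq_adjoin_rat: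
  assumes "r \<in> K" "r \<notin> \<rat>"
  shows "K = adjoin_rat r"
proof
  interpret A: complex_subfield "adjoin_rat r"
    by (rule complex_subfield.intro) (rule subfield_adjoin_rat)
  show "K \<subseteq> adjoin_rat r"
  proof
    fix u assume "u \<in> K"
    then obtain a b d where "a \<in> \<rat>" "b \<in> \<rat>" "d \<in> \<rat>" "u = a + b * r + d * r ^ 2"
      using irrational_generates[OF assms] by blast
    then show "u \<in> adjoin_rat r" using mem_adjoin_rat[of r] by auto
  qed
qed (rule adjoin_rat_subset[OF subfield assms(1)])

context mordell_cubic
begin

text \<open>3 P = O means 2 P = - P. Comparing abscissae gives
  \<open>x * (t - 2) = x * (1 + 4 * t)\<close>, so \<open>x = 0\<close> or \<open>t = - 1\<close>,
  and for these values doubling multiplies \<open>y\<close> by -1.\<close>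

lemma triple_eq_one_iff:
  assumes "P \<in> carrier G"
  shows "P [^] (3::nat) = \<one> \<longleftrightarrow> P = \<one> \<or> (\<exists>x y. P = Affine x y \<and> (x = 0 \<or> x ^ 3 = - 4 * c))"
proof (cases P)
  case (Affine x y)
  have mem: "Affine x y \<in> carrier G" using assms Affine by simp
  have "P [^] (3::nat) = P [^] (2::nat) \<otimes> P" by (simp add: numeral_3_eq_3 numeral_2_eq_2)
  then have "P [^] (3::nat) = \<one> \<longleftrightarrow> P [^] (2::nat) = inv P"
    using assms by (metis group.inv_equality group.l_inv group.nat_pow_closed)
  also have "\<dots> \<longleftrightarrow> P [^] (2::nat) = Affine x (- y)"
    using inv_eq[OF assms] by (simp add: Affine)
  also have "\<dots> \<longleftrightarrow> x = 0 \<or> x ^ 3 = - 4 * c"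
  proof (cases "y = 0")
    case True
    then have "x ^ 3 = - c" using mem by (simp add: Affine_mem eq_neg_iff_add_eq_0)
    then have "x \<noteq> 0" "x ^ 3 \<noteq> - 4 * c" using c_nonzero by auto
    moreover have "P [^] (2::nat) = \<one>" using double_eq_one_iff[OF assms] True Affine by simp
    ultimately show ?thesis by (simp add: one_eq)
  next
    case False
    define t where "t = x ^ 3 / (4 * c)"
    have w: "1 + 4 * t \<noteq> 0"
      using mordell_double(2)[of c y x] False mem c_nonzero by (simp add: t_def Affine_mem)
    have tm: "t = - 1 \<longleftrightarrow> x ^ 3 = - 4 * c" using c_nonzero by (auto simp: t_def field_simps)
    have double: "P [^] (2::nat) = Affine (x * (t - 2) / (1 + 4 * t)) (y * (18 * t * (1 + t) / (1 + 4 * t) ^ 2 - 1))"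
      using double_Affine[OF mem False] by (simp add: t_def Affine)
    have "x * (t - 2) / (1 + 4 * t) = x \<longleftrightarrow> x * (t - 2) = x * (1 + 4 * t)"
      using w by (rule nonzero_divide_eq_eq)
    also have "\<dots> \<longleftrightarrow> x = 0 \<or> t - 2 = 1 + 4 * t" by simp
    also have "t - 2 = 1 + 4 * t \<longleftrightarrow> 3 * (t + 1) = 0" by (auto simp: algebra_simps)
    also have "\<dots> \<longleftrightarrow> t = - 1" by (auto simp: add_eq_0_iff2)
    finally have x_iff: "x * (t - 2) / (1 + 4 * t) = x \<longleftrightarrow> x = 0 \<or> t = - 1" .
    have "y * (18 * t * (1 + t) / (1 + 4 * t) ^ 2 - 1) = - y" if "x = 0 \<or> t = - 1"
      using that by (auto simp: t_def)
    then show ?thesis unfolding double using x_iff tm by auto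
  qed
  finally show ?thesis by (simp add: Affine one_eq)
qed (use assms in \<open>simp add: one_eq [symmetric]\<close>)

text \<open>Points with \<open>x = 0\<close> have \<open>y ^ 2 = c\<close>, those with
  \<open>x ^ 3 = - 4 * c\<close> have \<open>y ^ 2 = - 3 * c\<close>; both kinds together would make
  -3 a square in \<open>K\<close>. Within one kind the abscissa is unique because cubing is
  injective.\<close>

lemma three_torsion_cyclic:
  assumes h: "h \<in> carrier G" "h \<noteq> \<one>" "h [^] (3::nat) = \<one>"
    and P: "P \<in> carrier G" "P [^] (3::nat) = \<one>"
  shows "P = \<one> \<or> P = h \<or> P = inv h"
proof (cases "P = \<one>")
  case False
  obtain x y where xy: "P = Affine x y" "x = 0 \<or> x ^ 3 = - 4 * c"
    using triple_eq_one_iff[OF P(1)] P(2) False by blast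
  obtain x' y' where xy': "h = Affine x' y'" "x' = 0 \<or> x' ^ 3 = - 4 * c"
    using triple_eq_one_iff[OF h(1)] h by blast
  have mem: "x \<in> K" "y \<in> K" "y ^ 2 = x ^ 3 + c" "x' \<in> K" "y' \<in> K" "y' ^ 2 = x' ^ 3 + c"
    using P h by (simp_all add: xy xy' Affine_mem)
  have mixed: False
    if "y1 \<in> K" "y2 \<in> K" "y1 ^ 2 = c" "y2 ^ 2 = - 3 * c" for y1 y2
  proof -
    have "(y2 / y1) ^ 2 = - 3" unfolding power_divide that(3,4) using c_nonzero by simp
    moreover have "y2 / y1 \<in> K" using that(1,2) by (rule divide_mem[rotated])
    ultimately show False using not_square_minus3 by blast
  qed
  have A: "y1 ^ 2 = c" if "x1 = 0" "y1 ^ 2 = x1 ^ 3 + c" for x1 y1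
    using that by simp
  have B: "y1 ^ 2 = - 3 * c" if "x1 = 0 \<or> x1 ^ 3 = - 4 * c" "x1 \<noteq> 0" "y1 ^ 2 = x1 ^ 3 + c" for x1 y1
  proof -
    have "x1 ^ 3 = - 4 * c" using that(1,2) by blast
    then show ?thesis using that(3) by simp
  qed
  have "x = x'"
  proof (cases "x = 0"; cases "x' = 0")
    assume "x \<noteq> 0" "x' \<noteq> 0"
    then have "x ^ 3 = - 4 * c" "x' ^ 3 = - 4 * c" using xy(2) xy'(2) by blast+
    then have "x ^ 3 = x' ^ 3" by simp
    then show ?thesis by (rule cube_inj[OF mem(1,4)])
  next
    assume "x = 0" "x' \<noteq> 0"
    then show ?thesis using mixed[OF mem(2,5) A[OF _ mem(3)] B[OF xy'(2) _ mem(6)]] by blast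
  next
    assume "x \<noteq> 0" "x' = 0"
    then show ?thesis using mixed[OF mem(5,2) A[OF _ mem(6)] B[OF xy(2) _ mem(3)]] by blast
  qed simp
  then have "y ^ 2 = y' ^ 2" using mem(3,6) by simp
  then have "y = y' \<or> y = - y'" by (simp add: power2_eq_iff)
  then have "P = h \<or> P = ec_neg h" using \<open>x = x'\<close> by (auto simp: xy(1) xy'(1))
  then show ?thesis using inv_eq[OF h(1)] by simp
qed simp

text \<open>The case 3 P = (q, s) with q nonzero, where \<open>v = y / s\<close> and
  \<open>s ^ 2 = 3 / 4 * q ^ 3\<close>; \<open>eq\<close> compares the abscissae of 2 P and 3 P - P.
  The variable \<open>u = - x / q\<close> turns \<open>t\<close> into \<open>u ^ 3\<close>, so
  \<open>c\<close> disappears and a polynomial equation for \<open>u\<close> remains.\<close>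

lemma no_type_B_nine_torsion:
  assumes K: "x \<in> K" "q \<in> K" "v \<in> K" "x \<noteq> q" "q \<noteq> 0"
    and t: "t = x ^ 3 / (4 * c)" "1 + 4 * t \<noteq> 0" and q: "q ^ 3 = - 4 * c"
    and v: "3 * v ^ 2 = - (1 + 4 * t)"
    and eq: "3 / 4 * q ^ 3 * (v + 1) ^ 2 / (x - q) ^ 2 - q - x = x * (t - 2) / (1 + 4 * t)"
  shows False
proof -
  define u where "u = - x / q"
  have x: "x = - (u * q)" using K by (simp add: u_def)
  have t': "t = u ^ 3" unfolding t(1) x using q c_nonzero K(5) by (simp add: power_mult_distrib)
  have "u \<in> K" using K by (simp add: u_def)
  have u1: "u + 1 \<noteq> 0"
  proof
    assume "u + 1 = 0"
    then have "u = - 1" by (simp add: add_eq_0_iff2)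
    then show False using K(4) x by simp
  qed
  define w where "w = 1 + 4 * u ^ 3"
  have w: "w \<noteq> 0" using t(2) by (simp add: w_def t')
  have xq: "(x - q) ^ 2 = q ^ 2 * (u + 1) ^ 2"
    unfolding x by (simp add: power2_eq_square algebra_simps)
  have "q * (3 / 4 * (v + 1) ^ 2 / (u + 1) ^ 2 + u - 1) = q * (- u * (u ^ 3 - 2) / w)"
  proof -
    have "3 / 4 * q ^ 3 * (v + 1) ^ 2 / (x - q) ^ 2 = q * (3 / 4 * (v + 1) ^ 2 / (u + 1) ^ 2)"
      unfolding xq using K(5) by (simp add: power2_eq_square power3_eq_cube)
    then show ?thesis using eq unfolding x t' w_def by (simp add: algebra_simps)
  qed
  then have "3 / 4 * (v + 1) ^ 2 / (u + 1) ^ 2 + u - 1 = - u * (u ^ 3 - 2) / w"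
    using K(5) by (simp only: mult_cancel_left) simp
  then have "(3 / 4 * (v + 1) ^ 2 / (u + 1) ^ 2 + u - 1) * (4 * w * (u + 1) ^ 2)
      = - u * (u ^ 3 - 2) / w * (4 * w * (u + 1) ^ 2)" by simp
  then have "3 * (v + 1) ^ 2 * w + 4 * (u - 1) * (u + 1) ^ 2 * w = - 4 * u * (u ^ 3 - 2) * (u + 1) ^ 2"
    using w u1 by (simp add: ring_distribs) (simp add: algebra_simps)
  moreover have "3 * (v + 1) ^ 2 = 3 * v ^ 2 + 6 * v + 3" by (simp add: power2_eq_square algebra_simps)
  ultimately have *: "(- w + 6 * v + 3) * w + 4 * (u - 1) * (u + 1) ^ 2 * w = - 4 * u * (u ^ 3 - 2) * (u + 1) ^ 2"
    by (simp add: v t' w_def)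
  \<comment> \<open>Thanks to \<open>3 * v ^ 2 = - w\<close> the equation is linear in
    \<open>v\<close>, namely \<open>6 * v * w = N\<close>. Squaring eliminates \<open>v\<close> and
    produces the nonic, times a power of \<open>u + 1\<close>, whose zero stands for
    \<open>x = q\<close>.\<close>
  define N where "N = - 4 * u * (u ^ 3 - 2) * (u + 1) ^ 2 - 4 * (u - 1) * (u + 1) ^ 2 * w - (3 - w) * w"
  have "6 * v * w = N" unfolding N_def * [symmetric] by (simp add: algebra_simps)
  then have "N ^ 2 = 12 * (3 * v ^ 2) * w ^ 2" by (auto simp: power_mult_distrib)
  also have "3 * v ^ 2 = - w" using v by (simp add: t' w_def)
  also have "12 * - w * w ^ 2 = - 12 * w ^ 3" by (simp add: power2_eq_square power3_eq_cube)
  finally have "N ^ 2 + 12 * w ^ 3 = 0" by simp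
  moreover have "N ^ 2 + 12 * w ^ 3 = 16 * (u + 1) ^ 3 *
      (u ^ 9 + 9 * u ^ 8 - 24 * u ^ 6 + 18 * u ^ 5 + 3 * u ^ 3 + 9 * u ^ 2 + 1)"
    unfolding N_def w_def by (simp add: algebra_simps numeral_eq_Suc)
  ultimately show False using nonic_no_root[OF \<open>u \<in> K\<close>] u1 by simp
qed

lemma nine_torsion_imp_cond_Z9:
  assumes P: "P \<in> carrier G" "P [^] (9::nat) = \<one>" "P [^] (3::nat) \<noteq> \<one>"
  shows "cond_Z9 K c"
proof -
  define Q where "Q = P [^] (3::nat)"
  have QG: "Q \<in> carrier G" using P by (simp add: Q_def)
  have "Q [^] (3::nat) = \<one>" using P by (simp add: Q_def group.nat_pow_pow)
  then obtain q s where Q: "Q = Affine q s" "q = 0 \<or> q ^ 3 = - 4 * c"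
    using triple_eq_one_iff[OF QG] P(3) by (auto simp: Q_def)
  have "P \<noteq> \<one>" using P by auto
  then obtain x y where xy: "P = Affine x y" by (cases P) (auto simp: one_eq)
  have y: "y \<noteq> 0"
  proof
    assume "y = 0"
    then have P2: "P [^] (2::nat) = \<one>" using double_eq_one_iff[OF P(1)] xy by simp
    have "P [^] (9::nat) = P [^] (9 mod 2 :: nat)" by (rule group.pow_mod[OF P(1) P2, symmetric])
    then show False using P \<open>P \<noteq> \<one>\<close> by simp
  qed
  have mem: "x \<in> K" "y \<in> K" "y ^ 2 = x ^ 3 + c" "q \<in> K" "s \<in> K" "s ^ 2 = q ^ 3 + c"
    using P QG by (simp_all add: xy Q Affine_mem)
  have xq: "x \<noteq> q" using triple_eq_one_iff[OF P(1)] P(3) xy Q(2) by auto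
  define t where "t = x ^ 3 / (4 * c)"
  have w: "1 + 4 * t \<noteq> 0" and yy: "y ^ 2 = c * (1 + 4 * t)"
    using mordell_double(1,2)[of c y x] y mem c_nonzero by (simp_all add: t_def)
  have x3: "x ^ 3 = 4 * c * t" using c_nonzero by (simp add: t_def)
  have "Q = P [^] (2::nat) \<otimes> P" by (simp add: Q_def numeral_3_eq_3 numeral_2_eq_2)
  then have "P [^] (2::nat) = Q \<otimes> inv P" using P by (simp add: group.m_assoc)
  also have "\<dots> = ec_add 0 (Affine q s) (Affine x (- y))" using P by (simp add: inv_eq xy Q mult_eq)
  finally have eq: "x * (t - 2) / (1 + 4 * t) = ((- y - s) / (x - q)) ^ 2 - q - x"
    using double_Affine[of x y] P(1) y xq by (simp add: xy t_def Let_def)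
  have s: "s \<noteq> 0"
  proof
    assume "s = 0"
    then have "q ^ 3 = - c" using mem by (simp add: eq_neg_iff_add_eq_0)
    then show False using Q(2) c_nonzero by auto
  qed
  define v where "v = y / s"
  have vK: "v \<in> K" using mem by (simp add: v_def)
  have yv: "y = v * s" using s by (simp add: v_def)
  have ys: "(- y - s) ^ 2 = s ^ 2 * (v + 1) ^ 2"
    unfolding yv by (simp add: power2_eq_square algebra_simps)
  show ?thesis
  proof (cases "q = 0")
    case False
    then have q3: "q ^ 3 = - 4 * c" using Q(2) by simp
    then have s2: "s ^ 2 = - 3 * c" using mem by simp
    have "3 * (c * k / (- 3 * c)) = - k" for k using c_nonzero by simp
    then have v2: "3 * v ^ 2 = - (1 + 4 * t)"
      unfolding v_def power_divide yy s2 .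
    have "3 / 4 * q ^ 3 = s ^ 2" unfolding s2 q3 by simp
    then have "3 / 4 * q ^ 3 * (v + 1) ^ 2 / (x - q) ^ 2 - q - x = x * (t - 2) / (1 + 4 * t)"
      by (simp only: eq power_divide ys)
    from no_type_B_nine_torsion[OF mem(1,4) vK xq False t_def w q3 v2 this] show ?thesis ..
  next
    case True
    then have s2: "s ^ 2 = c" using mem by simp
    have v2: "v ^ 2 = 1 + 4 * t" unfolding v_def power_divide yy s2 using c_nonzero by simp
    have x0: "x \<noteq> 0" using xq True by simp
    have "x * (t - 2) / (1 + 4 * t) = c * (v + 1) ^ 2 / x ^ 2 - x"
      using eq unfolding power_divide ys s2 True by simp
    then have r0: "x * (t - 2) / (1 + 4 * t) * (x ^ 2 * (1 + 4 * t)) = (c * (v + 1) ^ 2 / x ^ 2 - x) * (x ^ 2 * (1 + 4 * t))"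
      by simp
    have r1: "x * k / w * (x ^ 2 * w) = x ^ 3 * k" if "w \<noteq> 0" for k w
      using that by (simp add: power2_eq_square power3_eq_cube)
    have r2: "(k / x ^ 2 - x) * (x ^ 2 * w) = k * w - x ^ 3 * w" for k w
      using x0 by (simp add: left_diff_distrib power2_eq_square power3_eq_cube)
    have "x ^ 3 * (t - 2) = c * (v + 1) ^ 2 * (1 + 4 * t) - x ^ 3 * (1 + 4 * t)"
      using r0 unfolding r1[OF w] r2 .
    then have "c * (4 * t * (t - 2)) = c * ((v + 1) ^ 2 * v ^ 2 - 4 * t * v ^ 2)"
      unfolding x3 v2 [symmetric] by (simp add: right_diff_distrib mult_ac)
    then have e: "4 * t * (t - 2) = (v + 1) ^ 2 * v ^ 2 - 4 * t * v ^ 2"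
      using c_nonzero by (simp only: mult_cancel_left) simp
    have t4: "4 * t = v ^ 2 - 1" using v2 by simp
    have "4 * (4 * t * (t - 2)) = 4 * t * (4 * t - 8)" by (simp add: algebra_simps)
    then have "(v ^ 2 - 1) * (v ^ 2 - 1 - 8) = 4 * ((v + 1) ^ 2 * v ^ 2 - (v ^ 2 - 1) * v ^ 2)"
      unfolding e unfolding t4 by simp
    moreover have "(v ^ 2 - 1) * (v ^ 2 - 1 - 8) - 4 * ((v + 1) ^ 2 * v ^ 2 - (v ^ 2 - 1) * v ^ 2)
        = (v + 1) * (v ^ 3 - 9 * v ^ 2 - 9 * v + 9)"
      by (simp add: algebra_simps power2_eq_square power3_eq_cube)
    ultimately have prod0: "(v + 1) * (v ^ 3 - 9 * v ^ 2 - 9 * v + 9) = 0" by simp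
    \<comment> \<open>The extraneous root \<open>v = - 1\<close> belongs to \<open>t = 0\<close>,
      that is to \<open>x = 0\<close>.\<close>
    have "v + 1 \<noteq> 0"
    proof
      assume "v + 1 = 0"
      then have "v = - 1" by (simp add: add_eq_0_iff2)
      then have "t = 0" using t4 by simp
      then show False using x0 c_nonzero by (simp add: t_def)
    qed
    with prod0 have v3: "v ^ 3 - 9 * v ^ 2 - 9 * v + 9 = 0" by simp
    \<comment> \<open>On the roots of the two cubics this inverts
      \<open>v = 2 * r ^ 2 - 2 * r - 1\<close>, the formula of the converse direction. It satisfies
      \<open>r ^ 3 = t\<close>, so \<open>4 * c\<close> is the cube of \<open>x / r\<close>.\<close>
    define r where "r = (v ^ 2 - 6 * v - 3) / 12"
    have rK: "r \<in> K" unfolding r_def using vK by auto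
    have v12: "v ^ 2 - 6 * v - 3 = 12 * r" by (simp add: r_def)
    have "(12 * r) ^ 3 - 36 * (12 * r) ^ 2 + 1728 =
        (v ^ 3 - 9 * v ^ 2 - 9 * v + 9) * (v ^ 3 - 9 * v ^ 2 - 9 * v + 153)"
      unfolding v12 [symmetric] by (simp add: algebra_simps power2_eq_square power3_eq_cube)
    then have "1728 * (r ^ 3 - 3 * r ^ 2 + 1) = 0"
      unfolding v3 by (simp add: power2_eq_square power3_eq_cube algebra_simps)
    then have root: "r ^ 3 - 3 * r ^ 2 + 1 = 0" by (simp only: mult_eq_0_iff) simp
    have "(12 * r) ^ 3 - 432 * (v ^ 2 - 1) =
        (v ^ 3 - 9 * v ^ 2 - 9 * v + 9) * (v ^ 3 - 9 * v ^ 2 + 27 * v + 45)"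
      unfolding v12 [symmetric] by (simp add: algebra_simps power2_eq_square power3_eq_cube)
    then have "432 * (4 * r ^ 3 - (v ^ 2 - 1)) = 0"
      unfolding v3 by (simp add: power2_eq_square power3_eq_cube algebra_simps)
    then have "4 * r ^ 3 = 4 * t" unfolding t4 by (simp only: mult_eq_0_iff) simp
    then have r3: "r ^ 3 = t" by simp
    have "r \<noteq> 0" using root by auto
    then have "4 * c = (x / r) ^ 3" using x3 unfolding r3 [symmetric] by (simp add: power_divide)
    then have "is_cube_in K (4 * c)" unfolding is_cube_in_def using mem(1) rK by blast
    moreover have "is_square_in K c" unfolding is_square_in_def using s2 mem(5) by metis
    moreover have "K = adjoin_rat r" using rK nonagonal_irrational[OF root] by (rule eq_adjoin_rat)
    ultimately show ?thesis unfolding cond_Z9_def using root by blast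
  qed
qed

text \<open>With \<open>a ^ 3 = 4 * c\<close> and \<open>s ^ 2 = c\<close>, the point P =
  \<open>(a * r, s * v)\<close> is made so that 2 P and Q - P share their abscissa, where Q =
  \<open>(0, s)\<close>; then 3 P = Q unless the ordinates are opposite.\<close>

lemma cond_Z9_imp_nine_torsion:
  assumes "cond_Z9 K c"
  obtains P where "P \<in> carrier G" "P [^] (9::nat) = \<one>" "P [^] (3::nat) \<noteq> \<one>"
proof -
  obtain r s a where r: "r ^ 3 - 3 * r ^ 2 + 1 = 0" "r \<in> K" and s: "s \<in> K" "s ^ 2 = c"
    and a: "a \<in> K" "a ^ 3 = 4 * c"
    using assms mem_adjoin_rat unfolding cond_Z9_def is_square_in_def is_cube_in_def by metis
  have r3: "r ^ 3 = 3 * r ^ 2 - 1" using r(1) by (simp add: algebra_simps eq_neg_iff_add_eq_0 add_eq_0_iff2)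
  \<comment> \<open>The root of \<open>v ^ 3 - 9 * v ^ 2 - 9 * v + 9\<close> that belongs to
    \<open>r\<close>; it satisfies \<open>v ^ 2 = 1 + 4 * r ^ 3\<close>, which puts P on the
    curve.\<close>
  define v where "v = 2 * r ^ 2 - 2 * r - 1"
  define t where "t = r ^ 3"
  have vK: "v \<in> K" using r by (auto simp: v_def)
  have v2: "v ^ 2 = 1 + 4 * t"
  proof -
    have "v ^ 2 - (1 + 4 * t) = (r ^ 3 - 3 * r ^ 2 + 1) * (4 * r)"
      unfolding v_def t_def by (simp add: algebra_simps power2_eq_square power3_eq_cube)
    then show ?thesis unfolding r(1) by simp
  qed
  have v3: "v ^ 3 - 9 * v ^ 2 - 9 * v + 9 = 0"
  proof -
    have "v ^ 3 - 9 * v ^ 2 - 9 * v + 9 = (r ^ 3 - 3 * r ^ 2 + 1) * (8 * r ^ 3 - 24 * r + 8)"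
      unfolding v_def by (simp add: algebra_simps power2_eq_square power3_eq_cube)
    then show ?thesis unfolding r(1) by simp
  qed
  have nz: "s \<noteq> 0" "a \<noteq> 0" "r \<noteq> 0" "v \<noteq> 0"
    using s(2) a(2) r(1) v3 c_nonzero by auto
  define x where "x = a * r"
  define y where "y = s * v"
  have x0: "x \<noteq> 0" and y0: "y \<noteq> 0" using nz by (simp_all add: x_def y_def)
  have x3: "x ^ 3 = 4 * c * t" by (simp add: x_def t_def power_mult_distrib a(2))
  then have t_eq: "x ^ 3 / (4 * c) = t" using c_nonzero by simp
  have "y ^ 2 = c * (1 + 4 * t)" by (simp add: y_def power_mult_distrib s(2) v2)
  then have on: "y ^ 2 = x ^ 3 + c" by (simp add: x3 algebra_simps)
  define P where "P = Affine x y"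
  have P: "P \<in> carrier G"
    unfolding P_def Affine_mem using r s a vK on by (auto simp: x_def y_def)
  define Q where "Q = Affine 0 s"
  have Q: "Q \<in> carrier G" unfolding Q_def Affine_mem using s by simp
  have Q3: "Q [^] (3::nat) = \<one>" using triple_eq_one_iff[OF Q] by (simp add: Q_def)
  define u where "u = x * (t - 2) / (1 + 4 * t)"
  have "\<exists>z. P [^] (2::nat) = Affine u z"
    unfolding u_def P_def using double_Affine[of x y] P y0 by (simp add: P_def t_eq)
  then obtain z where z: "P [^] (2::nat) = Affine u z" by blast
  have u: "u = ((- y - s) / (x - 0)) ^ 2 - 0 - x"
  proof -
    have t4: "4 * t = v ^ 2 - 1" using v2 by simp
    have "4 * ((v + 1) ^ 2 * v ^ 2 - 4 * t * v ^ 2 - 4 * t * (t - 2)) =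
        4 * ((v + 1) ^ 2 * v ^ 2 - 4 * t * v ^ 2) - 4 * t * (4 * t - 8)" by (simp add: algebra_simps)
    also have "\<dots> = - (v + 1) * (v ^ 3 - 9 * v ^ 2 - 9 * v + 9)"
      unfolding t4 by (simp add: algebra_simps power2_eq_square power3_eq_cube)
    finally have "(v + 1) ^ 2 * v ^ 2 - 4 * t * v ^ 2 - 4 * t * (t - 2) = 0"
      unfolding v3 mult_zero_right mult_eq_0_iff by simp
    then have e: "4 * t * (t - 2) = (v + 1) ^ 2 * v ^ 2 - 4 * t * v ^ 2"
      by (simp only: right_minus_eq)
    have ys: "(- y - s) ^ 2 = c * (v + 1) ^ 2"
      by (simp add: y_def s(2) [symmetric] power2_eq_square algebra_simps)
    have "x ^ 3 * (t - 2) = c * (4 * t * (t - 2))" by (simp add: x3)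
    also have "\<dots> = c * (v + 1) ^ 2 * v ^ 2 - x ^ 3 * v ^ 2"
      unfolding e by (simp add: x3 right_diff_distrib)
    finally have f: "x ^ 3 * (t - 2) = (c * (v + 1) ^ 2 - x ^ 3) * v ^ 2" by (simp add: left_diff_distrib)
    have "u = x ^ 3 * (t - 2) / (x ^ 2 * v ^ 2)"
      unfolding u_def v2 [symmetric] using x0 by (simp add: power2_eq_square power3_eq_cube)
    also have "\<dots> = (c * (v + 1) ^ 2 - x ^ 3) / x ^ 2"
      unfolding f using nz(4) by simp
    also have "\<dots> = c * (v + 1) ^ 2 / x ^ 2 - x"
      using x0 by (simp add: diff_divide_distrib power2_eq_square power3_eq_cube)
    finally show ?thesis by (simp add: power_divide ys)
  qed
  define R where "R = Q \<otimes> inv P"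
  have R: "R \<in> carrier G" using P Q by (simp add: R_def)
  have "R = ec_add 0 (Affine 0 s) (Affine x (- y))"
    using P by (simp add: R_def Q_def mult_eq inv_eq) (simp add: P_def)
  then have "\<exists>z'. R = Affine u z'" unfolding u using x0 by (simp add: Let_def)
  then obtain z' where z': "R = Affine u z'" by blast
  have "P [^] (2::nat) \<in> carrier G" using P by simp
  then have "z ^ 2 = z' ^ 2" using R unfolding z z' Affine_mem by simp
  then have "z = z' \<or> z = - z'" by (simp add: power2_eq_iff)
  then have "P [^] (2::nat) = R \<or> P [^] (2::nat) = inv R"
    using inv_eq[OF R] by (auto simp: z z')
  then show thesis
  proof
    assume "P [^] (2::nat) = R"
    then have "P [^] (2::nat) \<otimes> P = Q" using P Q by (simp add: R_def group.m_assoc)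
    then have P3: "P [^] (3::nat) = Q" by (simp add: numeral_3_eq_3 numeral_2_eq_2)
    have "P [^] (9::nat) = (P [^] (3::nat)) [^] (3::nat)" using P by (simp add: group.nat_pow_pow)
    then have "P [^] (9::nat) = \<one>" by (simp only: P3 Q3)
    moreover have "Q \<noteq> \<one>" by (simp add: Q_def one_eq)
    ultimately show thesis using that P P3 by simp
  next
    \<comment> \<open>Opposite ordinates would mean 2 P = P - Q, hence P = - Q, but the abscissa of
      P is nonzero.\<close>
    assume "P [^] (2::nat) = inv R"
    also have "\<dots> = P \<otimes> inv Q" using P Q by (simp add: R_def group.inv_mult group.m_comm)
    finally have "P \<otimes> P = P \<otimes> inv Q" using P by (simp add: numeral_2_eq_2)
    then have "P = inv Q" using P Q by simp
    then have "P = Affine 0 (- s)" using inv_eq[OF Q] by (simp add: Q_def)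
    then show thesis using x0 by (simp add: P_def)
  qed
qed

end

section \<open>Classification of the torsion subgroups\<close>

context mordell_cubic
begin

abbreviation T where "T \<equiv> torsion_subgroup G"

text \<open>As 19 = 9 + 10 is 1 modulo 18, \<open>x\<close> is the product of its 9th power, which
  is killed by 2, and its 10th power, which is killed by 9 since 18 divides 90.\<close>

lemma torsion_decompose:
  assumes "x \<in> carrier T"
  obtains a b where "a \<in> carrier G" "a [^] (2::nat) = \<one>" "b \<in> carrier G" "b [^] (9::nat) = \<one>" "x = a \<otimes> b"
proof -
  obtain n :: nat where x: "x \<in> carrier G" and n: "n > 0" "x [^] n = \<one>"
    using assms by (auto simp: torsion_subgroup_def)
  have x18: "x [^] (18::nat) = \<one>" using torsion_18[OF x n(2,1)] .
  show thesis
  proof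
    show "(x [^] (9::nat)) [^] (2::nat) = \<one>" using x x18 by (simp add: group.nat_pow_pow)
    have "x [^] (90::nat) = x [^] (90 mod 18 :: nat)" by (rule group.pow_mod[OF x x18, symmetric])
    then show "(x [^] (10::nat)) [^] (9::nat) = \<one>" using x by (simp add: group.nat_pow_pow)
    have "x [^] (19::nat) = x [^] (19 mod 18 :: nat)" by (rule group.pow_mod[OF x x18, symmetric])
    then show "x = x [^] (9::nat) \<otimes> x [^] (10::nat)" using x by (simp add: group.nat_pow_mult)
  qed (use x in auto)
qed

lemma two_torsion_trivial:
  assumes "\<not> is_cube_in K c" "a \<in> carrier G" "a [^] (2::nat) = \<one>"
  shows "a = \<one>"
proof (rule ccontr)
  assume "a \<noteq> \<one>"
  then obtain x where a: "a = Affine x 0" using double_eq_one_iff assms by blast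
  then have x: "x \<in> K" "0 ^ 2 = x ^ 3 + c" using assms(2) by (simp_all only: Affine_mem)
  from x(2) have "x ^ 3 + c = 0" by (simp only: power_zero_numeral)
  then have "c = - (x ^ 3)" by (rule iffD1[OF add_eq_0_iff])
  also have "\<dots> = (- x) ^ 3" by simp
  finally have "c = (- x) ^ 3" .
  moreover have "- x \<in> K" using x(1) by simp
  ultimately have "is_cube_in K c" unfolding is_cube_in_def by blast
  then show False using assms(1) by blast
qed

lemma ex_two_torsion:
  assumes "is_cube_in K c"
  obtains e where "e \<in> carrier G" "e \<noteq> \<one>" "e [^] (2::nat) = \<one>"
    "\<And>a. a \<in> carrier G \<Longrightarrow> a [^] (2::nat) = \<one> \<Longrightarrow> a = \<one> \<or> a = e"
proof -
  obtain k where k: "k \<in> K" "c = k ^ 3" using assms by (auto simp: is_cube_in_def)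
  define e where "e = Affine (- k) (0::complex)"
  have e: "e \<in> carrier G" using k by (simp add: e_def Affine_mem)
  show thesis
  proof
    show "e [^] (2::nat) = \<one>" unfolding double_eq_one_iff[OF e] by (simp add: e_def)
    show "a = \<one> \<or> a = e" if a: "a \<in> carrier G" "a [^] (2::nat) = \<one>" for a
    proof (cases "a = \<one>")
      case False
      then obtain x where x: "a = Affine x 0" using double_eq_one_iff a by blast
      then have xK: "x \<in> K" "0 ^ 2 = x ^ 3 + c" using a(1) by (simp_all only: Affine_mem)
      from xK(2) have "x ^ 3 + k ^ 3 = 0" by (simp only: power_zero_numeral k(2))
      then have "x ^ 3 = - (k ^ 3)" by (rule iffD1[OF add_eq_0_iff2])
      also have "\<dots> = (- k) ^ 3" by simp
      finally have "x = - k" by (rule cube_inj[OF xK(1) uminus_mem[OF k(1)]])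
      then show ?thesis by (simp add: x e_def)
    qed simp
    show "e \<in> carrier G" by (rule e)
    show "e \<noteq> \<one>" by (simp add: e_def one_eq)
  qed
qed

lemma ex_three_torsion_iff:
  "(\<exists>h\<in>carrier G. h \<noteq> \<one> \<and> h [^] (3::nat) = \<one>) \<longleftrightarrow>
     is_square_in K c \<or> is_cube_in K (4 * c) \<and> is_square_in K (- 3 * c)"
proof
  assume "\<exists>h\<in>carrier G. h \<noteq> \<one> \<and> h [^] (3::nat) = \<one>"
  then obtain x y where h: "Affine x y \<in> carrier G" "x = 0 \<or> x ^ 3 = - 4 * c"
    using triple_eq_one_iff by blast
  then have mem: "x \<in> K" "y \<in> K" "y ^ 2 = x ^ 3 + c" by (simp_all add: Affine_mem)
  from h(2) show "is_square_in K c \<or> is_cube_in K (4 * c) \<and> is_square_in K (- 3 * c)"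
  proof
    assume "x = 0"
    then have "c = y ^ 2" using mem by simp
    then show ?thesis using mem unfolding is_square_in_def by blast
  next
    assume x: "x ^ 3 = - 4 * c"
    then have "- 3 * c = y ^ 2" "4 * c = (- x) ^ 3" using mem by simp_all
    moreover have "- x \<in> K" using mem by simp
    ultimately show ?thesis using mem unfolding is_square_in_def is_cube_in_def by blast
  qed
next
  assume "is_square_in K c \<or> is_cube_in K (4 * c) \<and> is_square_in K (- 3 * c)"
  then obtain x y where xy: "Affine x y \<in> carrier G" "x = 0 \<or> x ^ 3 = - 4 * c"
  proof (elim disjE conjE)
    assume "is_square_in K c"
    then obtain s where "s \<in> K" "c = s ^ 2" by (auto simp: is_square_in_def)
    then show thesis using that[of 0 s] by (simp add: Affine_mem)
  next
    assume "is_cube_in K (4 * c)" "is_square_in K (- 3 * c)"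
    then obtain a s where as: "a \<in> K" "4 * c = a ^ 3" "s \<in> K" "- 3 * c = s ^ 2"
      by (auto simp: is_square_in_def is_cube_in_def)
    have "(- a) ^ 3 = - 4 * c" using as(2) by simp
    moreover from this have "s ^ 2 = (- a) ^ 3 + c" using as(4) by simp
    ultimately show thesis using that[of "- a" s] as by (simp add: Affine_mem)
  qed
  then have "Affine x y [^] (3::nat) = \<one>" using triple_eq_one_iff by blast
  moreover have "Affine x y \<noteq> \<one>" by (simp add: one_eq)
  ultimately show "\<exists>h\<in>carrier G. h \<noteq> \<one> \<and> h [^] (3::nat) = \<one>" using xy(1) by blast
qed

lemma nine_torsion_iff:
  "(\<exists>g\<in>carrier G. g [^] (9::nat) = \<one> \<and> g [^] (3::nat) \<noteq> \<one>) \<longleftrightarrow> cond_Z9 K c"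
  using nine_torsion_imp_cond_Z9 cond_Z9_imp_nine_torsion by blast

lemma not_square_both:
  assumes "is_square_in K c" shows "\<not> is_square_in K (- 3 * c)"
proof
  assume "is_square_in K (- 3 * c)"
  then obtain a b where ab: "a \<in> K" "c = a ^ 2" "b \<in> K" "- 3 * c = b ^ 2"
    using assms by (auto simp: is_square_in_def)
  have "(b / a) ^ 2 = - 3"
    unfolding power_divide ab(2) [symmetric] ab(4) [symmetric] using c_nonzero by simp
  moreover have "b / a \<in> K" using ab by simp
  ultimately show False using not_square_minus3 by blast
qed

lemma cube_4c_iff:
  assumes "is_cube_in K c" shows "is_cube_in K (4 * c) \<longleftrightarrow> is_cube_in K 4"
proof -
  obtain a where a: "a \<in> K" "c = a ^ 3" using assms by (auto simp: is_cube_in_def)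
  show ?thesis
  proof
    assume "is_cube_in K (4 * c)"
    then obtain b where b: "b \<in> K" "4 * c = b ^ 3" by (auto simp: is_cube_in_def)
    have "4 = (b / a) ^ 3"
      unfolding power_divide b(2) [symmetric] a(2) [symmetric] using c_nonzero by simp
    moreover have "b / a \<in> K" using a b by simp
    ultimately show "is_cube_in K 4" unfolding is_cube_in_def by blast
  next
    assume "is_cube_in K 4"
    then obtain b where b: "b \<in> K" "4 = b ^ 3" by (auto simp: is_cube_in_def)
    then have "4 * c = (b * a) ^ 3" using a by (simp add: power_mult_distrib)
    moreover have "b * a \<in> K" using a b by simp
    ultimately show "is_cube_in K (4 * c)" unfolding is_cube_in_def by blast
  qed
qed

text \<open>Excludes torsion of order 18: if both \<open>c\<close> and \<open>4 * c\<close> were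
  cubes, so would be 4, but the field of \<open>r\<close> contains no cube root of 4.\<close>

lemma cond_Z9_not_cube:
  assumes "cond_Z9 K c" shows "\<not> is_cube_in K c"
proof
  assume "is_cube_in K c"
  then have "is_cube_in K 4" using assms cube_4c_iff by (simp add: cond_Z9_def)
  moreover obtain r where "r ^ 3 - 3 * r ^ 2 + 1 = 0" "r \<in> K"
    using assms mem_adjoin_rat unfolding cond_Z9_def by metis
  ultimately show False using four_not_cube by blast
qed

lemma ord_eqI:
  assumes g: "g \<in> carrier G" "g [^] n = \<one>" and "\<And>k. k dvd n \<Longrightarrow> k < n \<Longrightarrow> g [^] k \<noteq> \<one>" "n > 0"
  shows "group.ord g = (n::nat)"
proof -
  have "group.ord g dvd n" using g group.pow_eq_id by blast
  moreover have "g [^] group.ord g = \<one>" using g group.pow_ord_eq_1 by blast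
  ultimately show ?thesis using assms(3,4) by (metis dvd_imp_le le_neq_implies_less)
qed

lemma torsion_Z9:
  assumes "cond_Z9 K c"
  shows "T \<cong> integer_mod_group 9"
proof -
  obtain g where g: "g \<in> carrier G" "g [^] (9::nat) = \<one>" "g [^] (3::nat) \<noteq> \<one>"
    using assms nine_torsion_iff by blast
  have g3: "g [^] (3::nat) \<in> carrier G" "(g [^] (3::nat)) [^] (3::nat) = \<one>"
    using g by (simp_all add: group.nat_pow_pow)
  have three: "\<exists>k::nat. y = g [^] k" if y: "y \<in> carrier G" "y [^] (3::nat) = \<one>" for y
  proof -
    have "g [^] (3::nat) \<otimes> g [^] (6::nat) = \<one>" using g by (simp add: group.nat_pow_mult)
    then have "inv (g [^] (3::nat)) = g [^] (6::nat)"
      using g(1) by (metis group.inv_equality group.m_comm group.nat_pow_closed)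
    then have "y = g [^] (0::nat) \<or> y = g [^] (3::nat) \<or> y = g [^] (6::nat)"
      using three_torsion_cyclic[OF g3(1) g(3) g3(2) y] by simp
    then show ?thesis by blast
  qed
  have gen: "\<exists>k::nat. x = g [^] k" if x: "x \<in> carrier T" for x
  proof -
    obtain a b where ab: "a \<in> carrier G" "a [^] (2::nat) = \<one>" "b \<in> carrier G" "b [^] (9::nat) = \<one>" "x = a \<otimes> b"
      using torsion_decompose[OF x] .
    have "a = \<one>" using two_torsion_trivial[OF cond_Z9_not_cube[OF assms]] ab by blast
    then have xb: "x = b" using ab by simp
    have "(b [^] (3::nat)) [^] (3::nat) = \<one>" "b [^] (3::nat) \<in> carrier G" using ab by (simp_all add: group.nat_pow_pow)
    then have "b [^] (3::nat) = \<one> \<or> b [^] (3::nat) = g [^] (3::nat) \<or> b [^] (3::nat) = inv (g [^] (3::nat))"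
      using three_torsion_cyclic[OF g3(1) g(3) g3(2)] by blast
    \<comment> \<open>The cube of \<open>b\<close> is a power of the cube of \<open>g\<close>
      because the 3-torsion is cyclic; so a power of \<open>g\<close> shifts \<open>b\<close> into
      the 3-torsion, which consists of powers of \<open>g\<close>.\<close>
    then obtain j :: nat where j: "(b \<otimes> g [^] j) [^] (3::nat) = \<one>"
    proof (elim disjE)
      assume "b [^] (3::nat) = \<one>"
      then show thesis using that[of 0] ab by simp
    next
      assume "b [^] (3::nat) = g [^] (3::nat)"
      then have "(b \<otimes> g [^] (2::nat)) [^] (3::nat) = g [^] (3::nat) \<otimes> g [^] (6::nat)"
        using ab g by (simp add: group.pow_mult_distrib group.m_comm group.nat_pow_pow)
      then show thesis using that[of 2] g by (simp add: group.nat_pow_mult)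
    next
      assume "b [^] (3::nat) = inv (g [^] (3::nat))"
      then have "(b \<otimes> g [^] (1::nat)) [^] (3::nat) = \<one>"
        using ab g by (simp add: group.pow_mult_distrib group.m_comm)
      then show thesis using that[of 1] by blast
    qed
    obtain k :: nat where k: "b \<otimes> g [^] j = g [^] k" using three[OF _ j] ab g by auto
    have "g [^] j \<otimes> g [^] (8 * j) = (g [^] (9::nat)) [^] j"
      using g(1) by (simp add: group.nat_pow_mult group.nat_pow_pow)
    then have "g [^] j \<otimes> g [^] (8 * j) = \<one>" using g by simp
    then have "b = (b \<otimes> g [^] j) \<otimes> g [^] (8 * j)" using ab g by (simp add: group.m_assoc)
    also have "\<dots> = g [^] (k + 8 * j)" unfolding k using g(1) by (simp add: group.nat_pow_mult)
    finally show ?thesis using xb by blast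
  qed
  have "group.ord g = 9"
  proof (rule ord_eqI[OF g(1,2)])
    fix k :: nat assume k: "k dvd 9" "k < 9"
    have "k = 0 \<or> k = 1 \<or> k = 2 \<or> k = 3 \<or> k = 4 \<or> k = 5 \<or> k = 6 \<or> k = 7 \<or> k = 8" using k(2) by linarith
    then have "k = 1 \<or> k = 3" using k(1) by auto
    then have "k dvd 3" by auto
    then obtain m where "3 = k * m" by (elim dvdE)
    then have "g [^] (3::nat) = (g [^] k) [^] m" using g(1) by (simp add: group.nat_pow_pow)
    then show "g [^] k \<noteq> \<one>" using g(3) by auto
  qed simp
  from group.torsion_cyclic_iso[OF g(1) this _ gen] show ?thesis by simp
qed

lemma torsion_decompose_3:
  assumes not9: "\<not> cond_Z9 K c" and x: "x \<in> carrier T"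
  obtains a b where "a \<in> carrier G" "a [^] (2::nat) = \<one>" "b \<in> carrier G" "b [^] (3::nat) = \<one>" "x = a \<otimes> b"
  using torsion_decompose[OF x] not9 nine_torsion_iff by metis

lemma torsion_Z6:
  assumes not9: "\<not> cond_Z9 K c" and cube: "is_cube_in K c"
    and h: "h \<in> carrier G" "h \<noteq> \<one>" "h [^] (3::nat) = \<one>"
  shows "T \<cong> integer_mod_group 6"
proof -
  obtain e where e: "e \<in> carrier G" "e \<noteq> \<one>" "e [^] (2::nat) = \<one>"
    "\<And>a. a \<in> carrier G \<Longrightarrow> a [^] (2::nat) = \<one> \<Longrightarrow> a = \<one> \<or> a = e"
    using ex_two_torsion[OF cube] by blast
  define g where "g = h \<otimes> e"
  have g: "g \<in> carrier G" using h e by (simp add: g_def)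
  \<comment> \<open>Exponents reduce modulo 3 on \<open>h\<close> and modulo 2 on \<open>e\<close>;
    hence the powers of \<open>g\<close> with exponents 4, 3 and 2 are \<open>h\<close>,
    \<open>e\<close> and \<open>inv h\<close>.\<close>
  have pow: "g [^] k = h [^] (k mod 3) \<otimes> e [^] (k mod 2)" for k :: nat
    using h e by (simp add: g_def group.pow_mult_distrib group.m_comm group.pow_mod)
  have h2: "h [^] (2::nat) = inv h"
  proof -
    have "h [^] (2::nat) \<otimes> h = \<one>" using h by (simp add: numeral_3_eq_3 numeral_2_eq_2)
    then show ?thesis using h(1) by (metis group.inv_equality group.nat_pow_closed)
  qed
  have gs: "g [^] (0::nat) = \<one>" "g [^] (3::nat) = e" "g [^] (4::nat) = h" "g [^] (2::nat) = inv h" "g [^] (6::nat) = \<one>"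
    using pow[of 0] pow[of 3] pow[of 4] pow[of 2] pow[of 6] h e h2 by simp_all
  have "group.ord g = 6"
  proof (rule ord_eqI[OF g gs(5)])
    fix k :: nat assume k: "k dvd 6" "k < 6"
    have "k = 0 \<or> k = 1 \<or> k = 2 \<or> k = 3 \<or> k = 4 \<or> k = 5" using k(2) by linarith
    then have "k = 1 \<or> k = 2 \<or> k = 3" using k(1) by auto
    moreover have "g [^] (1::nat) \<noteq> \<one>"
    proof
      assume "g [^] (1::nat) = \<one>"
      then have "g [^] (3::nat) = \<one>" using g by simp
      then show False using gs e by simp
    qed
    moreover have "inv h \<noteq> \<one>" using h group.inv_eq_1_iff by blast
    ultimately show "g [^] k \<noteq> \<one>" using gs(2,4) e(2) by metis
  qed simp
  moreover have "\<exists>k::nat. x = g [^] k" if x: "x \<in> carrier T" for x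
  proof -
    obtain a b where ab: "a \<in> carrier G" "a [^] (2::nat) = \<one>" "b \<in> carrier G" "b [^] (3::nat) = \<one>" "x = a \<otimes> b"
      using torsion_decompose_3[OF not9 x] .
    have "a = g [^] (0::nat) \<or> a = g [^] (3::nat)" using e(4)[OF ab(1,2)] gs by simp
    moreover have "b = g [^] (0::nat) \<or> b = g [^] (4::nat) \<or> b = g [^] (2::nat)"
      using three_torsion_cyclic[OF h ab(3,4)] gs by simp
    ultimately obtain i j :: nat where "a = g [^] i" "b = g [^] j" by blast
    then have "x = g [^] (i + j)" using g ab(5) by (simp add: group.nat_pow_mult)
    then show ?thesis by blast
  qed
  ultimately show ?thesis using group.torsion_cyclic_iso[OF g] by simp
qed

lemma torsion_Z3:
  assumes not9: "\<not> cond_Z9 K c" and cube: "\<not> is_cube_in K c"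
    and h: "h \<in> carrier G" "h \<noteq> \<one>" "h [^] (3::nat) = \<one>"
  shows "T \<cong> integer_mod_group 3"
proof -
  have h2: "h [^] (2::nat) = inv h"
  proof -
    have "h [^] (2::nat) \<otimes> h = \<one>" using h by (simp add: numeral_3_eq_3 numeral_2_eq_2)
    then show ?thesis using h(1) by (metis group.inv_equality group.nat_pow_closed)
  qed
  have "group.ord h = 3"
  proof (rule ord_eqI[OF h(1,3)])
    fix k :: nat assume k: "k dvd 3" "k < 3"
    have "k = 0 \<or> k = 1 \<or> k = 2" using k(2) by linarith
    then have "k = 1" using k(1) by auto
    then show "h [^] k \<noteq> \<one>" using h by simp
  qed simp
  moreover have "\<exists>k::nat. x = h [^] k" if x: "x \<in> carrier T" for x
  proof -
    obtain a b where ab: "a \<in> carrier G" "a [^] (2::nat) = \<one>" "b \<in> carrier G" "b [^] (3::nat) = \<one>" "x = a \<otimes> b"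
      using torsion_decompose_3[OF not9 x] .
    have "x = b" using two_torsion_trivial[OF cube ab(1,2)] ab by simp
    moreover have "b = h [^] (0::nat) \<or> b = h [^] (1::nat) \<or> b = h [^] (2::nat)"
      using three_torsion_cyclic[OF h ab(3,4)] h h2 by simp
    ultimately show ?thesis by blast
  qed
  ultimately show ?thesis using group.torsion_cyclic_iso[OF h(1)] by simp
qed

lemma no_three_torsion:
  assumes "\<not> (\<exists>h\<in>carrier G. h \<noteq> \<one> \<and> h [^] (3::nat) = \<one>)"
  shows "\<not> cond_Z9 K c"
  using assms ex_three_torsion_iff by (auto simp: cond_Z9_def)

lemma torsion_Z2:
  assumes cube: "is_cube_in K c"
    and no3: "\<not> (\<exists>h\<in>carrier G. h \<noteq> \<one> \<and> h [^] (3::nat) = \<one>)"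
  shows "T \<cong> integer_mod_group 2"
proof -
  obtain e where e: "e \<in> carrier G" "e \<noteq> \<one>" "e [^] (2::nat) = \<one>"
    "\<And>a. a \<in> carrier G \<Longrightarrow> a [^] (2::nat) = \<one> \<Longrightarrow> a = \<one> \<or> a = e"
    using ex_two_torsion[OF cube] by blast
  have "group.ord e = 2"
  proof (rule ord_eqI[OF e(1,3)])
    fix k :: nat assume k: "k dvd 2" "k < 2"
    then have "k = 1" by (cases k) auto
    then show "e [^] k \<noteq> \<one>" using e by simp
  qed simp
  moreover have "\<exists>k::nat. x = e [^] k" if x: "x \<in> carrier T" for x
  proof -
    obtain a b where ab: "a \<in> carrier G" "a [^] (2::nat) = \<one>" "b \<in> carrier G" "b [^] (3::nat) = \<one>" "x = a \<otimes> b"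
      using torsion_decompose_3[OF no_three_torsion[OF no3] x] .
    have "b = \<one>" using no3 ab by blast
    then have "x = e [^] (0::nat) \<or> x = e [^] (1::nat)" using e(1) e(4)[OF ab(1,2)] ab by auto
    then show ?thesis by blast
  qed
  ultimately show ?thesis using group.torsion_cyclic_iso[OF e(1)] by simp
qed

lemma torsion_trivial:
  assumes cube: "\<not> is_cube_in K c"
    and no3: "\<not> (\<exists>h\<in>carrier G. h \<noteq> \<one> \<and> h [^] (3::nat) = \<one>)"
  shows "T \<cong> singleton_group (Infinity :: complex ec_point)"
proof -
  have "x = \<one>" if x: "x \<in> carrier T" for x
  proof -
    obtain a b where ab: "a \<in> carrier G" "a [^] (2::nat) = \<one>" "b \<in> carrier G" "b [^] (3::nat) = \<one>" "x = a \<otimes> b"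
      using torsion_decompose_3[OF no_three_torsion[OF no3] x] .
    have "b = \<one>" using no3 ab by blast
    then show "x = \<one>" using two_torsion_trivial[OF cube ab(1,2)] ab by simp
  qed
  moreover have "\<one> \<in> carrier T" by (auto simp: torsion_subgroup_def intro: exI[of _ 1])
  ultimately have "carrier T = {Infinity}" by (auto simp: one_eq)
  then have "(\<lambda>x. x) \<in> iso T (singleton_group (Infinity :: complex ec_point))"
    by (auto simp: iso_def hom_def bij_betw_def torsion_subgroup_def mult_eq singleton_group_def)
  then show ?thesis by (rule is_isoI)
qed

theorem torsion_classification:
  "(cond_Z9 K c \<longrightarrow> T \<cong> integer_mod_group 9) \<and>
   (cond_Z6 K c \<longrightarrow> T \<cong> integer_mod_group 6) \<and>
   (cond_Z3 K c \<and> \<not> cond_Z6 K c \<longrightarrow> T \<cong> integer_mod_group 3) \<and>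
   (cond_Z2 K c \<longrightarrow> T \<cong> integer_mod_group 2) \<and>
   (\<not> cond_Z9 K c \<and> \<not> cond_Z6 K c \<and> \<not> cond_Z3 K c \<and> \<not> cond_Z2 K c \<longrightarrow>
      T \<cong> singleton_group (Infinity :: complex ec_point))"
proof (intro conjI impI)
  note three = ex_three_torsion_iff and nsq = not_square_both
    and n9 = cond_Z9_not_cube and c4 = cube_4c_iff
  show "T \<cong> integer_mod_group 9" if "cond_Z9 K c" using torsion_Z9[OF that] .
  show "T \<cong> integer_mod_group 6" if Z6: "cond_Z6 K c"
  proof -
    have "is_cube_in K c" using Z6 by (auto simp: cond_Z6_def)
    moreover from this have "\<not> cond_Z9 K c" using n9 by blast
    moreover have "\<exists>h\<in>carrier G. h \<noteq> \<one> \<and> h [^] (3::nat) = \<one>"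
      using Z6 three c4 by (auto simp: cond_Z6_def)
    ultimately show ?thesis using torsion_Z6 by blast
  qed
  show "T \<cong> integer_mod_group 3" if Z3: "cond_Z3 K c \<and> \<not> cond_Z6 K c"
  proof -
    \<comment> \<open>For a cube \<open>c\<close> every clause of \<open>cond_Z3\<close> implies
      \<open>cond_Z6\<close>: a square \<open>c\<close> gives its first clause, and a cube
      \<open>4 * c\<close> makes 4 a cube.\<close>
    have "\<not> is_cube_in K c" using Z3 c4 by (auto simp: cond_Z3_def cond_Z6_def)
    moreover have "\<not> cond_Z9 K c" using Z3 nsq by (auto simp: cond_Z3_def cond_Z9_def)
    moreover have "\<exists>h\<in>carrier G. h \<noteq> \<one> \<and> h [^] (3::nat) = \<one>"
      using Z3 three by (auto simp: cond_Z3_def)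
    ultimately show ?thesis using torsion_Z3 by blast
  qed
  show "T \<cong> integer_mod_group 2" if Z2: "cond_Z2 K c"
  proof (rule torsion_Z2)
    show "is_cube_in K c" using Z2 by (auto simp: cond_Z2_def)
    then show "\<not> (\<exists>h\<in>carrier G. h \<noteq> \<one> \<and> h [^] (3::nat) = \<one>)"
      using Z2 three c4 by (auto simp: cond_Z2_def)
  qed
  show "T \<cong> singleton_group (Infinity :: complex ec_point)"
    if none: "\<not> cond_Z9 K c \<and> \<not> cond_Z6 K c \<and> \<not> cond_Z3 K c \<and> \<not> cond_Z2 K c"
  proof (rule torsion_trivial)
    \<comment> \<open>A square \<open>c\<close> always falls under \<open>cond_Z9\<close> or one of
      the first two clauses of \<open>cond_Z3\<close>.\<close>
    show "\<not> (\<exists>h\<in>carrier G. h \<noteq> \<one> \<and> h [^] (3::nat) = \<one>)"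
      using none three by (auto simp: cond_Z3_def cond_Z9_def)
    show "\<not> is_cube_in K c"
      using none by (auto simp: cond_Z6_def cond_Z2_def)
  qed
qed

end

section \<open>Torsion subgroups up to isomorphism\<close>

lemma (in comm_group) group_torsion_subgroup: "group (torsion_subgroup G)"
proof -
  have "subgroup {x \<in> carrier G. \<exists>n::nat. n > 0 \<and> x [^] n = \<one>} G"
  proof (rule subgroupI)
    have "\<one> \<in> {x \<in> carrier G. \<exists>n::nat. n > 0 \<and> x [^] n = \<one>}" by (auto intro: exI[of _ 1])
    then show "{x \<in> carrier G. \<exists>n::nat. n > 0 \<and> x [^] n = \<one>} \<noteq> {}" by blast
  next
    fix x assume "x \<in> {x \<in> carrier G. \<exists>n::nat. n > 0 \<and> x [^] n = \<one>}"
    then obtain n :: nat where "x \<in> carrier G" "n > 0" "x [^] n = \<one>" by blast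
    then have "inv x \<in> carrier G" "n > 0" "inv x [^] n = \<one>" by (simp_all add: nat_pow_inv)
    then show "inv x \<in> {x \<in> carrier G. \<exists>n::nat. n > 0 \<and> x [^] n = \<one>}" by blast
  next
    fix x y assume "x \<in> {x \<in> carrier G. \<exists>n::nat. n > 0 \<and> x [^] n = \<one>}"
      "y \<in> {x \<in> carrier G. \<exists>n::nat. n > 0 \<and> x [^] n = \<one>}"
    then obtain n m :: nat where x: "x \<in> carrier G" "n > 0" "x [^] n = \<one>"
      and y: "y \<in> carrier G" "m > 0" "y [^] m = \<one>" by blast
    have "(x \<otimes> y) [^] (n * m) = (x [^] n) [^] m \<otimes> (y [^] m) [^] n"
      using x(1) y(1) by (simp add: pow_mult_distrib m_comm nat_pow_pow mult.commute)
    then have "(x \<otimes> y) [^] (n * m) = \<one>" by (simp add: x(3) y(3))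
    then have "x \<otimes> y \<in> carrier G" "n * m > 0" "(x \<otimes> y) [^] (n * m) = \<one>" using x y by simp_all
    then show "x \<otimes> y \<in> {x \<in> carrier G. \<exists>n::nat. n > 0 \<and> x [^] n = \<one>}" by blast
  qed blast
  then show ?thesis unfolding torsion_subgroup_def by (rule subgroup.subgroup_is_group) (rule is_group)
qed

lemma iso_class_eq:
  assumes "group G" "G \<cong> H"
  shows "iso_class G = iso_class H"
proof -
  have "H \<cong> G" using assms by (rule group.iso_sym)
  then have "G \<cong> M \<longleftrightarrow> H \<cong> M" for M :: "int monoid"
    using iso_trans[OF assms(2), of M] iso_trans[of H G M] by blast
  then show ?thesis by (simp add: iso_class_def)
qed

section \<open>The cubic field generated by a root of r^3 - 3 r^2 + 1\<close>

text \<open>A model of \<open>adjoin_rat r\<close> with explicit generators, from which the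
  dimension over the rationals can be computed.\<close>

definition cubic_span :: "complex \<Rightarrow> complex set" where
  "cubic_span r = {a + b * r + d * r ^ 2 | a b d. a \<in> \<rat> \<and> b \<in> \<rat> \<and> d \<in> \<rat>}"

lemma cubic_span_eq_Span: "cubic_span r = CC.Span \<rat> [r ^ 2, r, 1]"
proof (rule Set.set_eqI)
  fix x
  show "x \<in> cubic_span r \<longleftrightarrow> x \<in> CC.Span \<rat> [r ^ 2, r, 1]"
  proof
    assume "x \<in> cubic_span r"
    then obtain a b d where x: "a \<in> \<rat>" "b \<in> \<rat>" "d \<in> \<rat>" "x = d * r ^ 2 + (b * r + (a * 1 + 0))"
      by (auto simp: cubic_span_def)
    have "a * 1 + 0 \<in> CC.line_extension \<rat> 1 {0}"
      using x by (subst CC.line_extension_mem_iff) auto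
    then have "b * r + (a * 1 + 0) \<in> CC.line_extension \<rat> r (CC.line_extension \<rat> 1 {0})"
      using x by (subst CC.line_extension_mem_iff) auto
    then show "x \<in> CC.Span \<rat> [r ^ 2, r, 1]"
      unfolding CC.Span.simps foldr.simps comp_apply id_apply
      by (subst CC.line_extension_mem_iff) (use x in auto)
  next
    assume "x \<in> CC.Span \<rat> [r ^ 2, r, 1]"
    then obtain a b d where "a \<in> \<rat>" "b \<in> \<rat>" "d \<in> \<rat>" "x = d * r ^ 2 + (b * r + a)"
      by (auto simp: CC.line_extension_mem_iff)
    then have "a \<in> \<rat> \<and> b \<in> \<rat> \<and> d \<in> \<rat>" "x = a + b * r + d * r ^ 2" by simp_all
    then show "x \<in> cubic_span r" unfolding cubic_span_def by blast
  qed
qed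

context
  fixes r :: complex
  assumes r: "r ^ 3 - 3 * r ^ 2 + 1 = 0"
begin

lemma square_notin_Span: "r ^ 2 \<notin> CC.Span \<rat> [r, 1]"
proof
  assume "r ^ 2 \<in> CC.Span \<rat> [r, 1]"
  then obtain a b where ab: "a \<in> \<rat>" "b \<in> \<rat>" and r2: "r ^ 2 = b * r + a"
    by (auto simp: CC.line_extension_mem_iff)
  \<comment> \<open>A rational quadratic with root \<open>r\<close> would divide the cubic. Its
    roots add up to \<open>b\<close> and those of the cubic to 3, so \<open>u\<close> is the
    remaining root, and it is rational.\<close>
  define u where "u = 3 - b"
  have "u \<in> \<rat>" using ab by (simp add: u_def)
  have "(u * b - a) * r + (u * a - 1) = 0"
  proof -
    have "(u * b - a) * r + (u * a - 1) = u * (b * r + a) - (a * r + 1)" by (simp add: algebra_simps)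
    also have "\<dots> = 3 * r ^ 2 - 1 - (b * r ^ 2 + a * r)"
      unfolding r2 [symmetric] u_def by (simp add: left_diff_distrib)
    also have "b * r ^ 2 + a * r = r * (b * r + a)"
      by (simp add: algebra_simps power2_eq_square)
    also have "3 * r ^ 2 - 1 - r * (b * r + a) = 3 * r ^ 2 - 1 - r * r ^ 2" by (simp only: r2)
    also have "\<dots> = - (r ^ 3 - 3 * r ^ 2 + 1)"
      by (simp add: power2_eq_square power3_eq_cube)
    finally show ?thesis unfolding r by simp
  qed
  note lin = this
  have "u * b - a = 0"
  proof (rule ccontr)
    assume nz: "u * b - a \<noteq> 0"
    have "r = (((u * b - a) * r + (u * a - 1)) - (u * a - 1)) / (u * b - a)" using nz by simp
    then have "r = - (u * a - 1) / (u * b - a)" unfolding lin by simp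
    moreover have "- (u * a - 1) / (u * b - a) \<in> \<rat>" using ab \<open>u \<in> \<rat>\<close> by simp
    ultimately show False using nonagonal_irrational[OF r] by simp
  qed
  then have a: "a = u * b" by simp
  then have "u * (u * (3 - u)) = 1" using lin by (simp add: u_def)
  moreover have "u ^ 3 - 3 * u ^ 2 + 1 = 1 - u * (u * (3 - u))"
    by (simp add: algebra_simps power2_eq_square power3_eq_cube)
  ultimately have "u ^ 3 - 3 * u ^ 2 + 1 = 0" by simp
  then show False using nonagonal_irrational \<open>u \<in> \<rat>\<close> by blast
qed

lemma dimension_cubic_span: "CC.dimension 3 \<rat> (cubic_span r)"
proof -
  have "CC.independent \<rat> [r ^ 2, r, 1]"
    using square_notin_Span independent_Rats_pair[OF nonagonal_irrational[OF r]]
    by (intro CC.li_Cons[of "r ^ 2"]) simp_all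
  from CC.dimension_independent[OF this] show ?thesis
    unfolding cubic_span_eq_Span by (simp add: numeral_3_eq_3)
qed

lemma cubic_span_mult:
  assumes "x \<in> cubic_span r" "y \<in> cubic_span r"
  shows "x * y \<in> cubic_span r"
proof -
  obtain a b d where x: "x = a + b * r + d * r ^ 2" "a \<in> \<rat>" "b \<in> \<rat>" "d \<in> \<rat>"
    using assms(1) by (auto simp: cubic_span_def)
  obtain a' b' d' where y: "y = a' + b' * r + d' * r ^ 2" "a' \<in> \<rat>" "b' \<in> \<rat>" "d' \<in> \<rat>"
    using assms(2) by (auto simp: cubic_span_def)
  \<comment> \<open>The coefficients of \<open>r ^ 3\<close> and \<open>r ^ 4\<close>, to be reduced
    by \<open>r ^ 3 = 3 * r ^ 2 - 1\<close> and \<open>r ^ 4 = 9 * r ^ 2 - r - 3\<close>.\<close>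
  define k3 k4 where "k3 = b * d' + d * b'" and "k4 = d * d'"
  have "x * y = (a * a' - k3 - 3 * k4) + (a * b' + b * a' - k4) * r +
      (a * d' + b * b' + d * a' + 3 * k3 + 9 * k4) * r ^ 2 + (r ^ 3 - 3 * r ^ 2 + 1) * (k3 + 3 * k4 + k4 * r)"
    unfolding x(1) y(1) k3_def k4_def by (simp add: algebra_simps power2_eq_square power3_eq_cube)
  then have "x * y = (a * a' - k3 - 3 * k4) + (a * b' + b * a' - k4) * r +
      (a * d' + b * b' + d * a' + 3 * k3 + 9 * k4) * r ^ 2"
    unfolding r by simp
  moreover have "a * a' - k3 - 3 * k4 \<in> \<rat>" "a * b' + b * a' - k4 \<in> \<rat>"
    "a * d' + b * b' + d * a' + 3 * k3 + 9 * k4 \<in> \<rat>"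
    unfolding k3_def k4_def using x(2-4) y(2-4) by simp_all
  ultimately show ?thesis unfolding cubic_span_def by blast
qed

lemma cubic_span_add:
  assumes "x \<in> cubic_span r" "y \<in> cubic_span r"
  shows "x + y \<in> cubic_span r"
proof -
  obtain a b d where x: "x = a + b * r + d * r ^ 2" "a \<in> \<rat>" "b \<in> \<rat>" "d \<in> \<rat>"
    using assms(1) by (auto simp: cubic_span_def)
  obtain a' b' d' where y: "y = a' + b' * r + d' * r ^ 2" "a' \<in> \<rat>" "b' \<in> \<rat>" "d' \<in> \<rat>"
    using assms(2) by (auto simp: cubic_span_def)
  have "x + y = (a + a') + (b + b') * r + (d + d') * r ^ 2"
    unfolding x(1) y(1) by (simp add: algebra_simps)
  moreover have "a + a' \<in> \<rat>" "b + b' \<in> \<rat>" "d + d' \<in> \<rat>" using x(2-4) y(2-4) by simp_all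
  ultimately show ?thesis unfolding cubic_span_def by blast
qed

lemma Rats_cubic_span: "q \<in> \<rat> \<Longrightarrow> q \<in> cubic_span r"
proof -
  assume "q \<in> \<rat>"
  moreover have "q = q + 0 * r + 0 * r ^ 2" by simp
  ultimately show ?thesis unfolding cubic_span_def using Rats_0 by blast
qed

lemma gen_cubic_span: "r \<in> cubic_span r"
proof -
  have "r = 0 + 1 * r + 0 * r ^ 2" by simp
  then show ?thesis unfolding cubic_span_def using Rats_0 Rats_1 by blast
qed

text \<open>A rational relation between 1, \<open>x\<close>, \<open>x ^ 2\<close>,
  \<open>x ^ 3\<close>, divided by the largest possible power of \<open>x\<close>, reads
  \<open>p + x * y = 0\<close> with \<open>p\<close> rational and nonzero, which exhibits the
  inverse as \<open>- y / p\<close>.\<close>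

lemma cubic_span_inverse:
  assumes x: "x \<in> cubic_span r"
  shows "inverse x \<in> cubic_span r"
proof (cases "x = 0")
  case False
  note S = cubic_span_add cubic_span_mult Rats_cubic_span
  have "set [1, x, x ^ 2, x ^ 3] \<subseteq> cubic_span r"
    using S(3)[of 1] S(2) x by (simp add: power2_eq_square power3_eq_cube)
  from dimension_3_dependent[OF dimension_cubic_span this] obtain q0 q1 q2 q3
    where q: "q0 \<in> \<rat>" "q1 \<in> \<rat>" "q2 \<in> \<rat>" "q3 \<in> \<rat>" "\<not> (q0 = 0 \<and> q1 = 0 \<and> q2 = 0 \<and> q3 = 0)"
      "q0 * 1 + q1 * x + q2 * x ^ 2 + q3 * x ^ 3 = 0" .
  have inv: "inverse x \<in> cubic_span r"
    if "p \<in> \<rat>" "p \<noteq> 0" "y \<in> cubic_span r" "x ^ k * (p + x * y) = 0" for p y k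
  proof -
    have "p + x * y = 0" using that(4) False by simp
    then have "x * y = - p" by (rule iffD1[OF add_eq_0_iff])
    then have "x * (y * (- 1 / p)) = 1" using that(2) by (simp add: mult.assoc [symmetric])
    then have eq: "inverse x = y * (- 1 / p)" by (rule inverse_unique)
    have "- 1 / p \<in> cubic_span r" using that(1) by (intro Rats_cubic_span) simp
    then show ?thesis unfolding eq by (rule cubic_span_mult[OF that(3)])
  qed
  consider "q0 \<noteq> 0" | "q0 = 0" "q1 \<noteq> 0" | "q0 = 0" "q1 = 0" "q2 \<noteq> 0" | "q0 = 0" "q1 = 0" "q2 = 0" "q3 \<noteq> 0"
    using q(5) by blast
  then show ?thesis
  proof cases
    case 1
    have "x ^ 0 * (q0 + x * (q1 + x * (q2 + x * q3))) = q0 * 1 + q1 * x + q2 * x ^ 2 + q3 * x ^ 3"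
      by (simp add: algebra_simps power2_eq_square power3_eq_cube)
    from inv[OF q(1) 1 _ trans[OF this q(6)]] show ?thesis by (simp add: S x q(1-4))
  next
    case 2
    have "x ^ 1 * (q1 + x * (q2 + x * q3)) = q0 * 1 + q1 * x + q2 * x ^ 2 + q3 * x ^ 3"
      by (simp add: 2 algebra_simps power2_eq_square power3_eq_cube)
    from inv[OF q(2) 2(2) _ trans[OF this q(6)]] show ?thesis by (simp add: S x q(1-4))
  next
    case 3
    have "x ^ 2 * (q2 + x * q3) = q0 * 1 + q1 * x + q2 * x ^ 2 + q3 * x ^ 3"
      by (simp add: 3 algebra_simps power2_eq_square power3_eq_cube)
    from inv[OF q(3) 3(3) _ trans[OF this q(6)]] show ?thesis by (simp add: S x q(1-4))
  next
    case 4
    have "q3 * x ^ 3 = 0" using q(6) by (simp add: 4(1-3))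
    then show ?thesis using False 4(4) by simp
  qed
qed (use Rats_cubic_span in simp)

lemma subfield_cubic_span: "subfield (cubic_span r) complex_ring"
proof (rule subfield_complex_ringI)
  show "- x \<in> cubic_span r" if "x \<in> cubic_span r" for x
    using cubic_span_mult[OF Rats_cubic_span[of "- 1"] that] by simp
qed (use cubic_span_add cubic_span_mult cubic_span_inverse Rats_cubic_span in auto)

lemma adjoin_rat_eq_cubic_span: "adjoin_rat r = cubic_span r"
proof
  show "adjoin_rat r \<subseteq> cubic_span r"
    by (rule adjoin_rat_subset[OF subfield_cubic_span gen_cubic_span])
  interpret A: complex_subfield "adjoin_rat r"
    by (rule complex_subfield.intro) (rule subfield_adjoin_rat)
  show "cubic_span r \<subseteq> adjoin_rat r"
    using mem_adjoin_rat[of r] by (auto simp: cubic_span_def)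
qed

lemma number_field_adjoin_rat: "number_field_of_degree 3 (adjoin_rat r)"
  unfolding number_field_of_degree_def adjoin_rat_eq_cubic_span
  using subfield_cubic_span dimension_cubic_span by blast

end

lemma ex_nonagonal_root: "\<exists>r::complex. r ^ 3 - 3 * r ^ 2 + 1 = 0"
proof -
  let ?p = "[:1, 0, -3, 1:] :: complex poly"
  have "poly ?p 0 \<noteq> poly ?p 1" by simp
  then have "\<not> constant (poly ?p)" unfolding constant_def by blast
  then obtain z where "poly ?p z = 0" using fundamental_theorem_of_algebra by blast
  then have "z ^ 3 - 3 * z ^ 2 + 1 = 0" by (simp add: algebra_simps power2_eq_square power3_eq_cube)
  then show ?thesis by blast
qed

section \<open>Examples realising all five groups\<close>

context cubic_field
begin

lemma not_square_negative:
  assumes "n < 0" shows "\<not> is_square_in K (of_int n)"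
proof
  assume "is_square_in K (of_int n)"
  then obtain s where s: "s \<in> K" "s ^ 2 = of_int n" by (auto simp: is_square_in_def)
  then have "s \<in> \<rat>" using square_rational by simp
  from Rats_square_ne_negative[OF this, of "of_int n"] assms s(2) show False by simp
qed

lemma not_square_3: "\<not> is_square_in K 3"
proof
  assume "is_square_in K 3"
  then obtain s where s: "s \<in> K" "s ^ 2 = 3" by (auto simp: is_square_in_def)
  then have "(3 * s) ^ 2 = 27" by (simp add: power_mult_distrib)
  moreover have "3 * s \<in> \<rat>" using square_rational[of "3 * s"] s calculation by simp
  ultimately show False using Rats_square_ne_27 by blast
qed

end

theorem theorem2:
  shows "mordell_torsion_classes 3 =
           {iso_class (integer_mod_group 9), iso_class (integer_mod_group 6),
            iso_class (integer_mod_group 3), iso_class (integer_mod_group 2),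
            iso_class (singleton_group (Infinity :: complex ec_point))} \<and>
         (\<forall>K c. number_field_of_degree 3 K \<and> c \<in> K \<and> c \<noteq> 0 \<longrightarrow>
           (let T = torsion_subgroup (mordell_group K c) in
              (cond_Z9 K c \<longrightarrow> T \<cong> integer_mod_group 9) \<and>
              (cond_Z6 K c \<longrightarrow> T \<cong> integer_mod_group 6) \<and>
              (cond_Z3 K c \<and> \<not> cond_Z6 K c \<longrightarrow> T \<cong> integer_mod_group 3) \<and>
              (cond_Z2 K c \<longrightarrow> T \<cong> integer_mod_group 2) \<and>
              (\<not> cond_Z9 K c \<and> \<not> cond_Z6 K c \<and> \<not> cond_Z3 K c \<and> \<not> cond_Z2 K c \<longrightarrow>
                 T \<cong> singleton_group (Infinity :: complex ec_point))))"
proof -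
  define T where "T = (\<lambda>K c. torsion_subgroup (mordell_group K (c::complex)))"
  define U where "U = singleton_group (Infinity :: complex ec_point)"
  have loc: "mordell_cubic K c"
    if "number_field_of_degree 3 K" "c \<in> K" "c \<noteq> 0" for K c
  proof -
    interpret cubic_field K using that(1) by (rule cubic_field.intro)
    show ?thesis using that by unfold_locales auto
  qed
  have cases: "(cond_Z9 K c \<longrightarrow> T K c \<cong> integer_mod_group 9) \<and> (cond_Z6 K c \<longrightarrow> T K c \<cong> integer_mod_group 6) \<and>
      (cond_Z3 K c \<and> \<not> cond_Z6 K c \<longrightarrow> T K c \<cong> integer_mod_group 3) \<and> (cond_Z2 K c \<longrightarrow> T K c \<cong> integer_mod_group 2) \<and>
      (\<not> cond_Z9 K c \<and> \<not> cond_Z6 K c \<and> \<not> cond_Z3 K c \<and> \<not> cond_Z2 K c \<longrightarrow> T K c \<cong> U)"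
    if "number_field_of_degree 3 K" "c \<in> K" "c \<noteq> 0" for K c
    unfolding T_def U_def by (rule mordell_cubic.torsion_classification[OF loc[OF that]])
  have iso_T: "iso_class (T K c) = iso_class H"
    if "number_field_of_degree 3 K" "c \<in> K" "c \<noteq> 0" "T K c \<cong> H" for K c and H :: "'b monoid"
  proof -
    interpret mordell_cubic K c "mordell_group K c" by (rule loc[OF that(1-3)])
    show ?thesis using group.group_torsion_subgroup that(4) unfolding T_def by (rule iso_class_eq)
  qed
  \<comment> \<open>One field is enough: over \<open>L\<close> the values 16, 1, 4, -1, -16 of
    \<open>c\<close> fall under the five cases in turn, since -1, -16, 3, 48 are no squares and 4,
    16, -16 are no cubes in \<open>L\<close>.\<close>
  obtain r :: complex where r: "r ^ 3 - 3 * r ^ 2 + 1 = 0" using ex_nonagonal_root by blast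
  define L where "L = adjoin_rat r"
  have L: "number_field_of_degree 3 L" unfolding L_def by (rule number_field_adjoin_rat[OF r])
  interpret L: cubic_field L by (rule cubic_field.intro) (rule L)
  have rL: "r \<in> L" unfolding L_def by (rule mem_adjoin_rat)
  have not_cube_4: "\<not> is_cube_in L 4" by (rule L.four_not_cube[OF rL r])
  have not_cube_16: "\<not> is_cube_in L 16"
  proof
    assume "is_cube_in L 16"
    then obtain s where s: "s \<in> L" "16 = s ^ 3" by (auto simp: is_cube_in_def)
    \<comment> \<open>If 16 is a cube, so is 4 = 16^2 / 64.\<close>
    have "(s ^ 2 / 4) ^ 3 = (s ^ 3) ^ 2 / 64" by (simp add: power_divide)
    then have "4 = (s ^ 2 / 4) ^ 3" by (simp add: s(2) [symmetric])
    moreover have "s ^ 2 / 4 \<in> L" using s by auto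
    ultimately show False using not_cube_4 unfolding is_cube_in_def by blast
  qed
  have squareI: "is_square_in L (s ^ 2)" and cubeI: "is_cube_in L (s ^ 3)" if "s \<in> L" for s
    using that by (auto simp: is_square_in_def is_cube_in_def)
  have "is_square_in L 16" "is_cube_in L (4 * 16)" "is_square_in L 1" "is_cube_in L 1" "is_square_in L 4"
    "is_cube_in L (- 1)"
    using squareI[of 4] cubeI[of 4] squareI[of 1] cubeI[of 1] squareI[of 2] cubeI[of "- 1"] by simp_all
  note pos = this
  have "\<not> is_square_in L (- 1)" "\<not> is_square_in L (- 16)"
    using L.not_square_negative[of "- 1"] L.not_square_negative[of "- 16"] by simp_all
  moreover have "\<not> is_square_in L 48"
  proof
    assume "is_square_in L 48"
    then obtain s where s: "s \<in> L" "48 = s ^ 2" by (auto simp: is_square_in_def)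
    have "(s / 4) ^ 2 = s ^ 2 / 16" by (simp add: power_divide)
    then have "3 = (s / 4) ^ 2" by (simp add: s(2) [symmetric])
    moreover have "s / 4 \<in> L" using s by auto
    ultimately show False using L.not_square_3 unfolding is_square_in_def by blast
  qed
  moreover have "\<not> is_cube_in L (- 16)"
  proof
    assume "is_cube_in L (- 16)"
    then obtain s where s: "s \<in> L" "- 16 = s ^ 3" by (auto simp: is_cube_in_def)
    have "(- s) ^ 3 = - (s ^ 3)" by simp
    then have "16 = (- s) ^ 3" by (simp add: s(2) [symmetric])
    moreover have "- s \<in> L" using s by auto
    ultimately show False using not_cube_16 unfolding is_cube_in_def by blast
  qed
  moreover note L.not_square_3 not_cube_4 not_cube_16
  ultimately have neg: "\<not> is_square_in L (- 1)" "\<not> is_square_in L (- 16)" "\<not> is_square_in L 48"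
    "\<not> is_cube_in L (- 16)" "\<not> is_square_in L 3" "\<not> is_cube_in L 4" "\<not> is_cube_in L 16" by blast+
  have "cond_Z9 L 16" unfolding cond_Z9_def using pos r L_def by blast
  moreover have "cond_Z6 L 1" unfolding cond_Z6_def using pos by blast
  moreover have "cond_Z3 L 4 \<and> \<not> cond_Z6 L 4"
    using pos neg by (simp add: cond_Z3_def cond_Z6_def)
  moreover have "cond_Z2 L (- 1)" using pos neg by (simp add: cond_Z2_def)
  moreover have "\<not> cond_Z9 L (- 16) \<and> \<not> cond_Z6 L (- 16) \<and> \<not> cond_Z3 L (- 16) \<and> \<not> cond_Z2 L (- 16)"
    using neg by (simp add: cond_Z9_def cond_Z6_def cond_Z3_def cond_Z2_def)
  ultimately have examples: "T L 16 \<cong> integer_mod_group 9" "T L 1 \<cong> integer_mod_group 6"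
    "T L 4 \<cong> integer_mod_group 3" "T L (- 1) \<cong> integer_mod_group 2" "T L (- 16) \<cong> U"
    using cases[OF L, of 16] cases[OF L, of 1] cases[OF L, of 4] cases[OF L, of "- 1"] cases[OF L, of "- 16"]
    by simp_all
  have classes: "M \<in> mordell_torsion_classes 3 \<longleftrightarrow>
      (\<exists>K c. M = iso_class (T K c) \<and> number_field_of_degree 3 K \<and> c \<in> K \<and> c \<noteq> 0)" for M
    unfolding mordell_torsion_classes_def T_def by blast
  have realized: "iso_class H \<in> mordell_torsion_classes 3"
    if "T L c \<cong> H" "c \<in> L" "c \<noteq> 0" for c and H :: "'b monoid"
    unfolding classes using iso_T[OF L that(2,3,1)] L that(2,3) by metis
  have "mordell_torsion_classes 3 =
           {iso_class (integer_mod_group 9), iso_class (integer_mod_group 6),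
            iso_class (integer_mod_group 3), iso_class (integer_mod_group 2), iso_class U}" (is "_ = ?C")
  proof
    show "mordell_torsion_classes 3 \<subseteq> ?C"
    proof
      fix M assume "M \<in> mordell_torsion_classes 3"
      then obtain K c where Kc: "M = iso_class (T K c)" "number_field_of_degree 3 K" "c \<in> K" "c \<noteq> 0"
        unfolding classes by blast
      from cases[OF Kc(2-4)] have "T K c \<cong> integer_mod_group 9 \<or> T K c \<cong> integer_mod_group 6 \<or>
          T K c \<cong> integer_mod_group 3 \<or> T K c \<cong> integer_mod_group 2 \<or> T K c \<cong> U" by blast
      then show "M \<in> ?C" unfolding Kc(1) by (elim disjE) (drule iso_T[OF Kc(2-4)], simp)+
    qed
    show "?C \<subseteq> mordell_torsion_classes 3"
      using examples[THEN realized] by auto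
  qed
  moreover have "\<forall>K c. number_field_of_degree 3 K \<and> c \<in> K \<and> c \<noteq> 0 \<longrightarrow>
           (let T = torsion_subgroup (mordell_group K c) in
              (cond_Z9 K c \<longrightarrow> T \<cong> integer_mod_group 9) \<and>
              (cond_Z6 K c \<longrightarrow> T \<cong> integer_mod_group 6) \<and>
              (cond_Z3 K c \<and> \<not> cond_Z6 K c \<longrightarrow> T \<cong> integer_mod_group 3) \<and>
              (cond_Z2 K c \<longrightarrow> T \<cong> integer_mod_group 2) \<and>
              (\<not> cond_Z9 K c \<and> \<not> cond_Z6 K c \<and> \<not> cond_Z3 K c \<and> \<not> cond_Z2 K c \<longrightarrow> T \<cong> U))"
    using cases unfolding T_def Let_def by blast
  ultimately show ?thesis unfolding U_def by blast
qed

end
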